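(* Let $P=D_1\times\cdots\times D_n\subset\subset\mathbb{C}^n$ be a piecewise smooth, bounded product domain, let $1\le q\le n$ and $\omega\in C^\infty_{0,q}(\overline{P})$. Then $$\omega=\overline{\partial}\,\mathbf{S}_q^P\omega+\mathbf{T}_{q+1}^P\overline{\partial}\omega,$$ where $\mathbf{S}_q^P\omega\in C^\infty_{0,q-1}(P)$ and $\mathbf{T}_{q+1}^P\overline{\partial}\omega\in C^\infty_{0,q}(P)$. If $\overline{\partial}\omega=0$, then $\omega=\overline{\partial}\,\mathbf{S}_q^P\omega$.
   Context: A piecewise smooth product domain is $P=D_1\times\cdots\times D_n$ with each $D_j$ a piecewise smooth domain in $\mathbb{C}$; $bD_j$ denotes the boundary of $D_j$. $C^\infty_{0,q}(\overline{P})$ is the space of smooth $(0,q)$-forms on a neighborhood of $\overline{P}$. Given $1\le e\le n$ and a $(0,r)$-form $\omega$, write uniquely $$\omega=\sum_{|J|=r-1,\,e\notin J}a_{eJ}\,d\overline{z_e}\wedge d\overline{z_J}+\sum_{|L|=r,\,e\notin L}a_L\,d\overline{z_L}$$ (sums over increasing multi-indices). Set $$\mathbf{I}_0^{P_e}\omega(z):=\frac{1}{2\pi i}\sum_{|J|=r-1,\,e\notin J}\int_{\zeta_e\in D_e}a_{eJ}(\dots,z_{e-1},\zeta_e,z_{e+1},\dots)\frac{d\zeta_e\wedge d\overline{\zeta_e}}{\zeta_e-z_e}\,d\overline{z_J},$$ $$\mathbf{R}_0^{P_e}\omega(z):=\frac{1}{2\pi i}\sum_{|L|=r,\,e\notin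 L}\int_{\zeta_e\in bD_e}a_L(\dots,z_{e-1},\zeta_e,z_{e+1},\dots)\frac{d\zeta_e}{\zeta_e-z_e}\,d\overline{z_L}$$ for $z$ with $z_e\in D_e$, whenever the integrals exist. (An operator with index $e$ only integrates in the variable $z_e$, the other variables being parameters, so successive operators with decreasing indices can be composed.) For $\omega\in C^\infty_{0,q}(\overline{P})$ define on $P$ $$\mathbf{S}_q^P\omega:=\sum_{k=q}^n\mathbf{I}_0^{P_k}\mathbf{R}_0^{P_{k+1}}\mathbf{R}_0^{P_{k+2}}\cdots\mathbf{R}_0^{P_n}\omega,$$ $$\mathbf{T}_{q+1}^P\overline{\partial}\omega:=\mathbf{I}_0^{P_n}\overline{\partial}\omega+\sum_{k=q}^{n-1}\mathbf{I}_0^{P_k}\,\overline{\partial}\big(\mathbf{R}_0^{P_{k+1}}\mathbf{R}_0^{P_{k+2}}\cdots\mathbf{R}_0^{P_n}\omega\big),$$ where for $k=n$ the product of the operators $\mathbf{R}$ in $\mathbf{S}_q^P$ is the identity. *)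

theory Defs
  imports "HOL-Complex_Analysis.Complex_Analysis"
begin

subsection \<open>Smooth functions\<close>

primrec times_differentiable_on ::
  "nat \<Rightarrow> ('a::real_normed_vector \<Rightarrow> 'b::real_normed_vector) \<Rightarrow> 'a set \<Rightarrow> bool" where
  "times_differentiable_on 0 f U \<longleftrightarrow> continuous_on U f"
| "times_differentiable_on (Suc k) f U \<longleftrightarrow>
     (\<forall>x\<in>U. f differentiable (at x)) \<and>
     (\<forall>v. times_differentiable_on k (\<lambda>x. frechet_derivative f (at x) v) U)"

text \<open>The class \<open>C\<^sup>\<infinity>\<close>; only meant for open \<open>U\<close>.\<close>

definition smooth_on ::
  "('a::real_normed_vector \<Rightarrow> 'b::real_normed_vector) \<Rightarrow> 'a set \<Rightarrow> bool" where
  "smooth_on f U \<longleftrightarrow> (\<forall>k. times_differentiable_on k f U)"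

subsection \<open>Piecewise smooth domains in the plane\<close>

text \<open>
  On every interval of a finite partition of \<open>[0,1]\<close> the curve is regular and \<open>C\<^sup>1\<close> up to the
  endpoints of the interval; \<open>g\<close> is an extension of the piece past these endpoints, which turns
  one-sided derivatives into two-sided ones. The predicate \<^const>\<open>valid_path\<close> is too weak here:
  it puts no condition on the derivative near the partition points, so a valid path may have
  infinite length.
\<close>

definition piecewise_smooth_path :: "(real \<Rightarrow> complex) \<Rightarrow> bool" where
  "piecewise_smooth_path \<gamma> \<longleftrightarrow>
     (\<exists>S. finite S \<and> {0, 1} \<subseteq> S \<and> S \<subseteq> {0..1} \<and>
        (\<forall>a\<in>S. \<forall>b\<in>S. a < b \<and> {a<..<b} \<inter> S = {} \<longrightarrow>
           (\<exists>g. (\<forall>t\<in>{a..b}. g t = \<gamma> t) \<and> g C1_differentiable_on {a..b} \<and>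
                (\<forall>t\<in>{a..b}. vector_derivative g (at t) \<noteq> 0))))"

text \<open>
  \<open>\<Gamma>\<close> is a parametrization of the positively oriented boundary of \<open>D\<close>: finitely many disjoint
  piecewise smooth Jordan curves making up the frontier. Positive orientation is expressed as in
  Ahlfors' definition of a cycle bounding a region: total winding number 1 about the points of \<open>D\<close>
  and 0 about those outside the closure. Each Jordan curve bounding a bounded domain has exactly
  one orientation with this property (outer curve counterclockwise, inner ones clockwise).
\<close>

definition piecewise_smooth_domain :: "complex set \<Rightarrow> (real \<Rightarrow> complex) set \<Rightarrow> bool" where
  "piecewise_smooth_domain D \<Gamma> \<longleftrightarrow>
     open D \<and> connected D \<and> D \<noteq> {} \<and>
     finite \<Gamma> \<and>
     (\<forall>\<gamma>\<in>\<Gamma>. piecewise_smooth_path \<gamma> \<and> simple_path \<gamma> \<and> pathfinish \<gamma> = pathstart \<gamma>) \<and>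
     pairwise (\<lambda>\<gamma> \<delta>. path_image \<gamma> \<inter> path_image \<delta> = {}) \<Gamma> \<and>
     frontier D = (\<Union>\<gamma>\<in>\<Gamma>. path_image \<gamma>) \<and>
     (\<forall>z\<in>D. (\<Sum>\<gamma>\<in>\<Gamma>. winding_number \<gamma> z) = 1) \<and>
     (\<forall>z. z \<notin> closure D \<longrightarrow> (\<Sum>\<gamma>\<in>\<Gamma>. winding_number \<gamma> z) = 0)"

definition boundary_integral :: "(real \<Rightarrow> complex) set \<Rightarrow> (complex \<Rightarrow> complex) \<Rightarrow> complex" where
  "boundary_integral \<Gamma> f = (\<Sum>\<gamma>\<in>\<Gamma>. contour_integral \<gamma> f)"

text \<open>
  The space \<open>\<complex>\<^sup>n\<close> is \<^typ>\<open>complex ^ 'n\<close> with \<open>n = CARD('n)\<close>; the linear order on the index type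
  orders the coordinates, and \<open>coord k\<close> is the \<open>k\<close>-th of them, \<open>1 \<le> k \<le> n\<close>.
\<close>

definition product_domain :: "('n \<Rightarrow> complex set) \<Rightarrow> (complex ^ 'n) set" where
  "product_domain D = {z. \<forall>j. z $ j \<in> D j}"

definition coord :: "nat \<Rightarrow> 'n::{finite,linorder}" where
  "coord k = sorted_list_of_set (UNIV :: 'n set) ! (k - 1)"

definition replace_coord :: "complex ^ 'n \<Rightarrow> 'n \<Rightarrow> complex \<Rightarrow> complex ^ 'n" where
  "replace_coord z e \<zeta> = (\<chi> j. if j = e then \<zeta> else z $ j)"

subsection \<open>Forms of type \<open>(0,r)\<close>\<close>

text \<open>
  Write \<open>w\<^sub>j = cnj z\<^sub>j\<close>. A form \<open>\<Sum>\<^sub>J a\<^sub>J dw\<^sub>J\<close>, the sum being over increasing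
  multi-indices, is represented by its coefficients \<open>J \<mapsto> a\<^sub>J\<close>, increasing multi-indices being identified with sets of coordinates. It
  has type \<open>(0,r)\<close> if only coefficients with \<open>|J| = r\<close> occur.
\<close>

type_synonym 'n antiform = "'n set \<Rightarrow> complex ^ 'n \<Rightarrow> complex"

text \<open>For \<open>e \<notin> J\<close> the wedge product of \<open>dw\<^sub>e\<close> and \<open>dw\<^sub>J\<close>, in this order, is
  \<open>wedge_sign e J\<close> times \<open>dw\<^sub>K\<close> with \<open>K = insert e J\<close>.\<close>

definition wedge_sign :: "'n::{finite,linorder} \<Rightarrow> 'n set \<Rightarrow> complex" where
  "wedge_sign e J = (-1) ^ card {j \<in> J. j < e}"

definition smooth_form_on ::
  "nat \<Rightarrow> (complex ^ ('n::{finite,linorder})) set \<Rightarrow> 'n antiform \<Rightarrow> bool" where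
  "smooth_form_on r U \<omega> \<longleftrightarrow>
     (\<forall>J. smooth_on (\<omega> J) U) \<and> (\<forall>J. card J \<noteq> r \<longrightarrow> (\<forall>z\<in>U. \<omega> J z = 0))"

definition smooth_form_near_closure ::
  "nat \<Rightarrow> (complex ^ ('n::{finite,linorder})) set \<Rightarrow> 'n antiform \<Rightarrow> bool" where
  "smooth_form_near_closure r P \<omega> \<longleftrightarrow>
     (\<exists>U. open U \<and> closure P \<subseteq> U \<and> smooth_form_on r U \<omega>)"

text \<open>The Wirtinger derivative \<open>\<partial>a/\<partial>w\<^sub>j = (\<partial>a/\<partial>x\<^sub>j + \<i> \<partial>a/\<partial>y\<^sub>j) / 2\<close>.\<close>

definition wirtinger_bar ::
  "'n::finite \<Rightarrow> (complex ^ 'n \<Rightarrow> complex) \<Rightarrow> complex ^ 'n \<Rightarrow> complex" where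
  "wirtinger_bar j a z =
     (frechet_derivative a (at z) (axis j 1) + \<i> * frechet_derivative a (at z) (axis j \<i>)) / 2"

definition dbar :: "('n::{finite,linorder}) antiform \<Rightarrow> 'n antiform" where
  "dbar \<omega> K z = (\<Sum>j\<in>K. wedge_sign j (K - {j}) * wirtinger_bar j (\<omega> (K - {j})) z)"

subsection \<open>The integral operators\<close>

text \<open>
  The coefficient \<open>a\<^sub>e\<^sub>J\<close> of the wedge product of \<open>dw\<^sub>e\<close> and \<open>dw\<^sub>J\<close>, for \<open>e \<notin> J\<close>, is
  \<open>wedge_sign e J * \<omega> (insert e J)\<close>, and the wedge product of \<open>d\<zeta>\<close> and its conjugate is \<open>- 2 \<i>\<close>
  times Lebesgue measure.
\<close>

definition I0 ::
  "('n::{finite,linorder} \<Rightarrow> complex set) \<Rightarrow> 'n \<Rightarrow> 'n antiform \<Rightarrow> 'n antiform" where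
  "I0 D e \<omega> J z =
     (if e \<in> J then 0
      else 1 / (2 * of_real pi * \<i>) *
        set_lebesgue_integral lborel (D e)
          (\<lambda>\<zeta>. wedge_sign e J * \<omega> (insert e J) (replace_coord z e \<zeta>) / (\<zeta> - z $ e) * (- 2 * \<i>)))"

definition R0 ::
  "('n::{finite,linorder} \<Rightarrow> (real \<Rightarrow> complex) set) \<Rightarrow> 'n \<Rightarrow> 'n antiform \<Rightarrow> 'n antiform" where
  "R0 \<Gamma> e \<omega> L z =
     (if e \<in> L then 0
      else 1 / (2 * of_real pi * \<i>) *
        boundary_integral (\<Gamma> e) (\<lambda>\<zeta>. \<omega> L (replace_coord z e \<zeta>) / (\<zeta> - z $ e)))"

text \<open>\<open>R_after \<Gamma> k\<close> is the composition \<open>R\<^sub>k\<^sub>+\<^sub>1 R\<^sub>k\<^sub>+\<^sub>2 \<cdots> R\<^sub>n\<close>, with \<open>R\<^sub>n\<close> applied first.\<close>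

definition R_after ::
  "('n::{finite,linorder} \<Rightarrow> (real \<Rightarrow> complex) set) \<Rightarrow> nat \<Rightarrow> 'n antiform \<Rightarrow> 'n antiform" where
  "R_after \<Gamma> k \<omega> = foldr (\<lambda>j. R0 \<Gamma> (coord j)) [k + 1..<CARD('n) + 1] \<omega>"

definition S_op ::
  "('n::{finite,linorder} \<Rightarrow> complex set) \<Rightarrow> ('n \<Rightarrow> (real \<Rightarrow> complex) set) \<Rightarrow> nat \<Rightarrow>
   'n antiform \<Rightarrow> 'n antiform" where
  "S_op D \<Gamma> q \<omega> J z = (\<Sum>k = q..CARD('n). I0 D (coord k) (R_after \<Gamma> k \<omega>) J z)"

text \<open>
  \<open>T_dbar D \<Gamma> q \<omega>\<close> is the form written \<open>T\<^sub>q\<^sub>+\<^sub>1 \<partial>\<omega>\<close> (with the barred operator); it is defined in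
  terms of \<open>\<omega>\<close>, not as an operator applied to \<open>dbar \<omega>\<close>.
\<close>

definition T_dbar ::
  "('n::{finite,linorder} \<Rightarrow> complex set) \<Rightarrow> ('n \<Rightarrow> (real \<Rightarrow> complex) set) \<Rightarrow> nat \<Rightarrow>
   'n antiform \<Rightarrow> 'n antiform" where
  "T_dbar D \<Gamma> q \<omega> J z =
     I0 D (coord CARD('n)) (dbar \<omega>) J z +
     (\<Sum>k = q..<CARD('n). I0 D (coord k) (dbar (R_after \<Gamma> k \<omega>)) J z)"

end

theory Submission
  imports Defs
begin

text \<open>
  The theorem is obtained by treating one coordinate at a time. In a single coordinate \<open>z\<^sub>e\<close> there is
  the homotopy formula
  \<open>\<alpha> = \<partial> (I\<^sub>e \<alpha>) + I\<^sub>e (\<partial> \<alpha>) + R\<^sub>e \<alpha>\<close>, with \<open>\<partial>\<close> standing for the operator \<open>dbar\<close>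
  (\<open>homotopy_formula\<close>). For coefficients whose index set does not contain \<open>e\<close> it is the
  Cauchy-Pompeiu formula, the mixed derivatives cancelling by the sign rule for wedge products; for
  the others it says that the Cauchy transform solves the inhomogeneous Cauchy-Riemann equation.
  Applying it to \<open>\<omega>\<close> with \<open>e\<close> the last coordinate, then to \<open>R\<^sub>n \<omega>\<close> with the last but one, and so
  on down to the \<open>q\<close>-th, the boundary terms telescope. What is left over is \<open>R\<^sub>q \<cdots> R\<^sub>n \<omega>\<close>, a form of
  degree \<open>q\<close> in which only \<open>q - 1\<close> differentials can occur, and this is zero. If \<open>\<omega>\<close> is closed,
  then so are all the forms \<open>R\<^sub>k \<cdots> R\<^sub>n \<omega>\<close>, since \<open>R\<^sub>e\<close> commutes with \<open>\<partial>\<close> (\<open>dbar_R0\<close>), so that the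
  second operator contributes nothing.

  The Cauchy-Pompeiu formula on a domain with corners is reduced to the one for compactly supported
  functions, without Stokes' theorem. A function \<open>f\<close> that is smooth near the closure of \<open>D\<close> is cut
  off to a compactly supported \<open>u\<close>; such a \<open>u\<close> is a superposition of Cauchy kernels
  \<open>1 / (w - \<zeta>)\<close>, for which the boundary integral is a difference of winding numbers. Exchanging the
  two integrations and using that the total winding number of the boundary is the indicator function
  of \<open>D\<close> almost everywhere gives \<open>cauchy_pompeiu\<close>. For compact support the formula follows by
  integrating the derivative of \<open>u\<close> times a regularized kernel over the plane
  (\<open>cauchy_pompeiu_compact_support\<close>).

  Smoothness of all forms involved comes from one lemma on differentiation under the integral sign
  (\<open>parametric_integral_times_differentiable_on\<close>). It applies directly to the boundary operators; for
  the area operators the singularity is first separated by a cutoff function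
  (\<open>cauchy_area_local\<close>).
\<close>

section \<open>Calculus of finitely often differentiable functions\<close>

text \<open>The closure properties of \<^const>\<open>times_differentiable_on\<close> carry the prefix \<open>Ck\<close>, for the class \<open>C\<^sup>k\<close>.\<close>

lemma Ck_cong:
  assumes "open U" "\<And>x. x \<in> U \<Longrightarrow> f x = g x" "times_differentiable_on k f U"
  shows "times_differentiable_on k g U"
  using assms(2,3)
proof (induction k arbitrary: f g)
  case 0
  then show ?case by (auto cong: continuous_on_cong)
next
  case (Suc k)
  have D: "(g has_derivative frechet_derivative f (at x)) (at x)" if "x \<in> U" for x
  proof (rule has_derivative_transform_within_open[OF _ assms(1) that])
    show "(f has_derivative frechet_derivative f (at x)) (at x)"
      using Suc.prems that frechet_derivative_works by auto
  qed (use Suc.prems in auto)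
  have *: "frechet_derivative f (at x) v = frechet_derivative g (at x) v" if "x \<in> U" for x v
    using frechet_derivative_at[OF D[OF that]] by simp
  have "g differentiable (at x)" if "x \<in> U" for x
    using D[OF that] differentiable_def by blast
  moreover have "times_differentiable_on k (\<lambda>x. frechet_derivative g (at x) v) U" for v
    by (rule Suc.IH[of "\<lambda>x. frechet_derivative f (at x) v"]) (fact *, use Suc.prems(2) in simp)
  ultimately show ?case by simp
qed

lemma times_differentiable_onI:
  assumes "open U" "\<And>x. x \<in> U \<Longrightarrow> (f has_derivative f' x) (at x)"
    and "\<And>v. times_differentiable_on k (\<lambda>x. f' x v) U"
  shows "times_differentiable_on (Suc k) f U"
proof -
  have "f' x v = frechet_derivative f (at x) v" if "x \<in> U" for x v
    using frechet_derivative_at[OF assms(2)[OF that]] by simp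
  then have "times_differentiable_on k (\<lambda>x. frechet_derivative f (at x) v) U" for v
    by (rule Ck_cong[OF assms(1) _ assms(3)[of v]])
  with assms(2) show ?thesis
    by (auto simp: differentiable_def)
qed

lemma Ck_derivative:
  assumes "times_differentiable_on (Suc k) f U" "x \<in> U"
  shows "(f has_derivative frechet_derivative f (at x)) (at x)"
  using assms frechet_derivative_works by auto

lemma Ck_Suc_imp:
  "times_differentiable_on (Suc k) f U \<Longrightarrow> times_differentiable_on k f U"
proof (induction k arbitrary: f)
  case 0
  then show ?case
    by (auto intro!: continuous_at_imp_continuous_on differentiable_imp_continuous_within)
next
  case (Suc k)
  then show ?case by auto
qed

lemma Ck_mono:
  assumes "times_differentiable_on k f U" "m \<le> k"
  shows "times_differentiable_on m f U"
  using assms(2,1)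
  by (induction rule: inc_induct) (use Ck_Suc_imp in blast)+

lemma Ck_continuous:
  "times_differentiable_on k f U \<Longrightarrow> continuous_on U f"
  using Ck_mono[of k f U 0] by simp

lemma Ck_subset:
  "times_differentiable_on k f U \<Longrightarrow> V \<subseteq> U \<Longrightarrow> times_differentiable_on k f V"
proof (induction k arbitrary: f)
  case 0
  then show ?case by (auto intro: continuous_on_subset)
next
  case (Suc k)
  then show ?case by auto
qed

lemma Ck_local:
  assumes "\<And>x. x \<in> U \<Longrightarrow> \<exists>N. open N \<and> x \<in> N \<and> times_differentiable_on k f N"
  shows "times_differentiable_on k f U"
  using assms
proof (induction k arbitrary: f)
  case 0
  show ?case unfolding times_differentiable_on.simps
  proof (rule continuous_at_imp_continuous_on, rule ballI)
    fix x assume "x \<in> U"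
    then obtain N where "open N" "x \<in> N" "continuous_on N f"
      using 0[of x] by auto
    then show "continuous (at x) f"
      using continuous_on_eq_continuous_at by blast
  qed
next
  case (Suc k)
  have "f differentiable (at x)" if "x \<in> U" for x
    using Suc.prems[OF that] by auto
  moreover have "times_differentiable_on k (\<lambda>x. frechet_derivative f (at x) v) U" for v
    by (rule Suc.IH) (use Suc.prems in fastforce)
  ultimately show ?case by simp
qed

lemma Ck_const: "times_differentiable_on k (\<lambda>x. c) U"
proof -
  have "times_differentiable_on k (\<lambda>x. c) UNIV"
  proof (induction k arbitrary: c)
    case (Suc k)
    show ?case
      by (rule times_differentiable_onI[where f' = "\<lambda>_ _. 0"]) (use Suc in auto)
  qed simp
  then show ?thesis using Ck_subset by blast
qed

lemma Ck_bounded_linear: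
  assumes "bounded_linear f"
  shows "times_differentiable_on k f U"
proof -
  have "times_differentiable_on k f UNIV"
  proof (cases k)
    case 0
    with assms show ?thesis by (simp add: linear_continuous_on)
  next
    case (Suc m)
    show ?thesis unfolding Suc
      by (rule times_differentiable_onI[where f' = "\<lambda>_. f"])
        (use bounded_linear_imp_has_derivative[OF assms] Ck_const in auto)
  qed
  then show ?thesis using Ck_subset by blast
qed

lemma Ck_linear_image:
  assumes "bounded_linear L" "open U" "times_differentiable_on k f U"
  shows "times_differentiable_on k (\<lambda>x. L (f x)) U"
  using assms(3)
proof (induction k arbitrary: f)
  case 0
  then show ?case
    by (auto intro: bounded_linear.continuous_on[OF assms(1)])
next
  case (Suc k)
  show ?case
  proof (rule times_differentiable_onI[OF assms(2)])
    show "((\<lambda>x. L (f x)) has_derivative (\<lambda>v. L (frechet_derivative f (at x) v))) (at x)" if "x \<in> U" for x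
      by (rule bounded_linear.has_derivative[OF assms(1) Ck_derivative[OF Suc.prems that]])
    show "times_differentiable_on k (\<lambda>x. L (frechet_derivative f (at x) v)) U" for v
      by (rule Suc.IH) (use Suc.prems in simp)
  qed
qed

lemma Ck_add:
  assumes "open U" "times_differentiable_on k f U" "times_differentiable_on k g U"
  shows "times_differentiable_on k (\<lambda>x. f x + g x) U"
  using assms(2,3)
proof (induction k arbitrary: f g)
  case 0
  then show ?case by (auto intro: continuous_intros)
next
  case (Suc k)
  show ?case
  proof (rule times_differentiable_onI[OF assms(1)])
    show "((\<lambda>x. f x + g x) has_derivative
        (\<lambda>v. frechet_derivative f (at x) v + frechet_derivative g (at x) v)) (at x)" if "x \<in> U" for x
      by (rule has_derivative_add[OF Ck_derivative[OF Suc.prems(1) that]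
        Ck_derivative[OF Suc.prems(2) that]])
    show "times_differentiable_on k (\<lambda>x. frechet_derivative f (at x) v + frechet_derivative g (at x) v) U" for v
      by (rule Suc.IH) (use Suc.prems in simp_all)
  qed
qed

lemma Ck_mult:
  fixes f g :: "'a::real_normed_vector \<Rightarrow> 'b::real_normed_algebra"
  assumes "open U" "times_differentiable_on k f U" "times_differentiable_on k g U"
  shows "times_differentiable_on k (\<lambda>x. f x * g x) U"
  using assms(2,3)
proof (induction k arbitrary: f g)
  case 0
  then show ?case by (auto intro: continuous_intros)
next
  case (Suc k)
  show ?case
  proof (rule times_differentiable_onI[OF assms(1)])
    show "((\<lambda>x. f x * g x) has_derivative
        (\<lambda>v. f x * frechet_derivative g (at x) v + frechet_derivative f (at x) v * g x)) (at x)"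
      if "x \<in> U" for x
      by (rule has_derivative_mult[OF Ck_derivative[OF Suc.prems(1) that] 
        Ck_derivative[OF Suc.prems(2) that]])
    show "times_differentiable_on k (\<lambda>x. f x * frechet_derivative g (at x) v +
        frechet_derivative f (at x) v * g x) U" for v
    proof (rule Ck_add[OF assms(1)]; rule Suc.IH)
      show "times_differentiable_on k f U" "times_differentiable_on k g U"
        using Suc.prems Ck_Suc_imp by blast+
    qed (use Suc.prems in simp_all)
  qed
qed

lemma Ck_sum:
  assumes "open U" "\<And>i. i \<in> A \<Longrightarrow> times_differentiable_on k (f i) U"
  shows "times_differentiable_on k (\<lambda>x. \<Sum>i\<in>A. f i x) U"
  using assms(2)
proof (induction A rule: infinite_finite_induct)
  case (insert i A)
  have "times_differentiable_on k (\<lambda>x. f i x + (\<Sum>j\<in>A. f j x)) U"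
    by (rule Ck_add[OF assms(1)]) (use insert in blast)+
  with insert.hyps show ?case by simp
qed (simp, rule Ck_const)+

lemma Ck_prod:
  fixes f :: "'i \<Rightarrow> 'a::real_normed_vector \<Rightarrow> 'b::real_normed_field"
  assumes "open U" "\<And>i. i \<in> A \<Longrightarrow> times_differentiable_on k (f i) U"
  shows "times_differentiable_on k (\<lambda>x. \<Prod>i\<in>A. f i x) U"
  using assms(2)
proof (induction A rule: infinite_finite_induct)
  case (insert i A)
  have "times_differentiable_on k (\<lambda>x. f i x * (\<Prod>j\<in>A. f j x)) U"
    by (rule Ck_mult[OF assms(1)]) (use insert in blast)+
  with insert.hyps show ?case by simp
qed (simp, rule Ck_const)+

lemma Ck_diff:
  assumes "open U" "times_differentiable_on k f U" "times_differentiable_on k g U"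
  shows "times_differentiable_on k (\<lambda>x. f x - g x) U"
  using Ck_add[OF assms(1,2)
    Ck_linear_image[OF bounded_linear_minus[OF bounded_linear_ident] assms(1,3)]]
  by simp

lemma Ck_inverse:
  fixes f :: "'a::real_normed_vector \<Rightarrow> 'b::real_normed_field"
  assumes "open U" "times_differentiable_on k f U" "\<And>x. x \<in> U \<Longrightarrow> f x \<noteq> 0"
  shows "times_differentiable_on k (\<lambda>x. inverse (f x)) U"
  using assms(2)
proof (induction k)
  case 0
  then show ?case using assms(3) by (auto intro: continuous_intros)
next
  case (Suc k)
  have IH: "times_differentiable_on k (\<lambda>x. inverse (f x)) U"
    by (rule Suc.IH[OF Ck_Suc_imp[OF Suc.prems]])
  show ?case
  proof (rule times_differentiable_onI[OF assms(1)])
    show "((\<lambda>x. inverse (f x)) has_derivative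
        (\<lambda>v. - (inverse (f x) * frechet_derivative f (at x) v * inverse (f x)))) (at x)"
      if "x \<in> U" for x
      by (rule Deriv.has_derivative_inverse[OF assms(3)[OF that]
            Ck_derivative[OF Suc.prems that]])
    show "times_differentiable_on k (\<lambda>x. - (inverse (f x) * frechet_derivative f (at x) v *
        inverse (f x))) U" for v
    proof -
      have "times_differentiable_on k (\<lambda>x. frechet_derivative f (at x) v) U"
        using Suc.prems by simp
      then show ?thesis
        by (intro Ck_linear_image[OF bounded_linear_minus[OF bounded_linear_ident]]
          assms(1) Ck_mult IH)
    qed
  qed
qed

lemma Ck_divide:
  fixes f g :: "'a::real_normed_vector \<Rightarrow> 'b::real_normed_field"
  assumes "open U" "times_differentiable_on k f U" "times_differentiable_on k g U"
    "\<And>x. x \<in> U \<Longrightarrow> g x \<noteq> 0"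
  shows "times_differentiable_on k (\<lambda>x. f x / g x) U"
  unfolding divide_inverse
  by (intro Ck_mult Ck_inverse assms)

lemma Ck_compose_affine:
  assumes "open U" "open V" "times_differentiable_on k f U" "\<And>x. x \<in> V \<Longrightarrow> g x \<in> U"
    and g: "\<And>x. (g has_derivative L) (at x)"
  shows "times_differentiable_on k (\<lambda>x. f (g x)) V"
  using assms(3)
proof (induction k arbitrary: f)
  case 0
  have "continuous_on V g"
    using g by (auto intro!: continuous_at_imp_continuous_on intro: has_derivative_continuous)
  with 0 show ?case
    using assms(4) by (auto intro: continuous_on_compose2)
next
  case (Suc k)
  show ?case
  proof (rule times_differentiable_onI[OF assms(2)])
    show "((\<lambda>x. f (g x)) has_derivative (\<lambda>v. frechet_derivative f (at (g x)) (L v))) (at x)"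
      if "x \<in> V" for x
      by (rule has_derivative_compose[OF g Ck_derivative[OF Suc.prems assms(4)[OF that]]])
    show "times_differentiable_on k (\<lambda>x. frechet_derivative f (at (g x)) (L v)) V" for v
      using Suc.prems by (intro Suc.IH[of "\<lambda>y. frechet_derivative f (at y) (L v)"]) auto
  qed
qed

lemma Ck_compose_real:
  fixes h :: "real \<Rightarrow> real" and g :: "'a::real_normed_vector \<Rightarrow> real"
  assumes "open U" "times_differentiable_on k h UNIV" "times_differentiable_on k g U"
  shows "times_differentiable_on k (\<lambda>x. h (g x)) U"
  using assms(2,3)
proof (induction k arbitrary: h g)
  case 0
  then show ?case by (auto intro: continuous_on_compose2)
next
  case (Suc k)
  have lin: "frechet_derivative h (at y) c = c * frechet_derivative h (at y) 1" for y c
    using has_derivative_linear[OF Ck_derivative[OF Suc.prems(1), of y]]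
      linear_scale[of _ c 1] by force
  show ?case
  proof (rule times_differentiable_onI[OF assms(1)])
    fix x assume "x \<in> U"
    then have "((\<lambda>x. h (g x)) has_derivative
        (\<lambda>v. frechet_derivative h (at (g x)) (frechet_derivative g (at x) v))) (at x)"
      by (intro has_derivative_compose[OF Ck_derivative[OF Suc.prems(2)]
            Ck_derivative[OF Suc.prems(1)]]) auto
    also have "(\<lambda>v. frechet_derivative h (at (g x)) (frechet_derivative g (at x) v)) =
        (\<lambda>v. frechet_derivative g (at x) v * frechet_derivative h (at (g x)) 1)"
      by (rule ext) (rule lin)
    finally show "((\<lambda>x. h (g x)) has_derivative (\<lambda>v. frechet_derivative g (at x) v *
       frechet_derivative h (at (g x)) 1)) (at x)" .
  next
    show "times_differentiable_on k (\<lambda>x. frechet_derivative g (at x) v *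
       frechet_derivative h (at (g x)) 1) U" for v
    proof (rule Ck_mult[OF assms(1)])
      show "times_differentiable_on k (\<lambda>x. frechet_derivative h (at (g x)) 1) U"
        by (rule Suc.IH[of "\<lambda>y. frechet_derivative h (at y) 1"])
          (use Suc.prems Ck_Suc_imp[OF Suc.prems(2)] in simp_all)
    qed (use Suc.prems in simp)
  qed
qed

lemma Ck_extend_by_zero:
  assumes N: "open N" and C: "closed C" "C \<subseteq> N" and f: "times_differentiable_on k f N"
    and 0: "\<And>x. x \<in> N - C \<Longrightarrow> f x = 0"
  shows "times_differentiable_on k (\<lambda>x. if x \<in> N then f x else 0) UNIV"
proof (rule Ck_local)
  fix x
  let ?g = "\<lambda>x. if x \<in> N then f x else 0"
  have "times_differentiable_on k ?g N"
    by (rule Ck_cong[OF N _ f]) simp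
  moreover have op: "open (- C)" using C(1) by auto
  have "times_differentiable_on k ?g (- C)"
    by (rule Ck_cong[OF op _ Ck_const[of _ 0]]) (simp add: 0)
  ultimately show "\<exists>M. open M \<and> x \<in> M \<and> times_differentiable_on k ?g M"
    using N op C(2) by (cases "x \<in> N") blast+
qed

lemma frechet_derivative_outside_support:
  assumes "closed C" "z \<notin> C" "\<And>w. w \<notin> C \<Longrightarrow> f w = 0"
  shows "frechet_derivative f (at z) v = 0"
proof -
  have "(f has_derivative (\<lambda>_. 0)) (at z)"
    by (rule has_derivative_transform_within_open[where f = "\<lambda>_. 0" and s = "- C", OF has_derivative_const])
      (use assms in auto)
  from frechet_derivative_at[OF this] show ?thesis by metis
qed

section \<open>Integrals depending on a parameter\<close>

text \<open>The integrals have the form \<open>\<integral> \<kappa>(s) G(x, p(s)) ds\<close>. Everything that is not smooth is put into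
  \<open>\<kappa>\<close>, which only has to be integrable: the Cauchy kernel of an area integral, or the speed vector of
  a curve with corners. The map \<open>p\<close> is the parametrization of that curve, or the identity. Its values
  lie in a compact set \<open>K\<close>, so the smooth factor \<open>G\<close> and its derivatives are bounded, uniformly for
  \<open>x\<close> near a given point.\<close>

context
  fixes O' :: "('v::euclidean_space \<times> 'w::euclidean_space) set" and U :: "'v set" and K :: "'w set"
    and M :: "'s::euclidean_space measure" and \<kappa> :: "'s \<Rightarrow> complex" and p :: "'s \<Rightarrow> 'w"
  assumes open_U: "open U" and compact_K: "compact K" and UK: "U \<times> K \<subseteq> O'"
    and \<kappa>: "integrable M \<kappa>" and p: "p \<in> borel_measurable M"
    and pK: "\<And>s. s \<in> space M \<Longrightarrow> \<kappa> s \<noteq> 0 \<Longrightarrow> p s \<in> K"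
begin

lemma parametric_integrable:
  assumes "continuous_on O' G" "x \<in> U"
  shows "integrable M (\<lambda>s. \<kappa> s * G (x, p s))"
proof -
  have contK: "continuous_on K (\<lambda>w. G (x, w))"
    using UK assms(2) by (intro continuous_on_compose2[OF assms(1)] continuous_intros) auto
  have "compact ((\<lambda>w. G (x, w)) ` K)"
    by (rule compact_continuous_image[OF contK compact_K])
  then obtain B where B: "\<And>w. w \<in> K \<Longrightarrow> norm (G (x, w)) \<le> B"
    by (meson bounded_iff compact_imp_bounded image_eqI)
  have K: "K \<in> sets borel"
    using compact_K by (simp add: borel_compact)
  have "(\<lambda>w. indicator K w *\<^sub>R G (x, w)) \<in> borel_measurable borel"
    by (rule borel_measurable_continuous_on_indicator[OF K contK])
  then have m: "(\<lambda>s. indicator K (p s) *\<^sub>R G (x, p s)) \<in> borel_measurable M"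
    using p by (rule measurable_compose[rotated])
  have "integrable M (\<lambda>s. \<kappa> s * (indicator K (p s) *\<^sub>R G (x, p s)))"
  proof (rule Bochner_Integration.integrable_bound)
    show "integrable M (\<lambda>s. B * norm (\<kappa> s))"
      using \<kappa> by auto
    show "(\<lambda>s. \<kappa> s * (indicator K (p s) *\<^sub>R G (x, p s))) \<in> borel_measurable M"
      using m \<kappa> by measurable
    show "AE s in M. norm (\<kappa> s * (indicator K (p s) *\<^sub>R G (x, p s))) \<le> norm (B * norm (\<kappa> s))"
    proof (rule AE_I2)
      fix s assume s: "s \<in> space M"
      show "norm (\<kappa> s * (indicator K (p s) *\<^sub>R G (x, p s))) \<le> norm (B * norm (\<kappa> s))"
      proof (cases "\<kappa> s = 0")
        case False
        then have "p s \<in> K" using pK s by auto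
        moreover from this have "norm (G (x, p s)) \<le> B" "0 \<le> B" using B[of "p s"] norm_ge_zero order_trans by blast+
        ultimately show ?thesis
          using mult_left_mono[of "norm (G (x, p s))" B "norm (\<kappa> s)"] by (simp add: norm_mult mult.commute)
      qed simp
    qed
  qed
  moreover have "\<kappa> s * (indicator K (p s) *\<^sub>R G (x, p s)) = \<kappa> s * G (x, p s)" if "s \<in> space M" for s
    using pK[OF that] by (cases "\<kappa> s = 0") auto
  ultimately show ?thesis
    by (simp cong: Bochner_Integration.integrable_cong)
qed

lemma parametric_uniformly_continuous:
  fixes G :: "'v \<times> 'w \<Rightarrow> 'b::metric_space"
  assumes "continuous_on O' G" "x \<in> U" "e > 0"
  obtains d where "d > 0" "ball x d \<subseteq> U" "\<And>y w. y \<in> ball x d \<Longrightarrow> w \<in> K \<Longrightarrow> dist (G (y, w)) (G (x, w)) \<le> e"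
proof -
  have "continuous_on (U \<times> K) G"
    using assms(1) UK continuous_on_subset by blast
  from continuous_on_prod_compactE[OF this compact_K assms(2,3)]
  obtain X0 where X: "x \<in> X0" "open X0" "\<forall>y\<in>X0 \<inter> U. \<forall>t \<in> K. dist (G (y, t)) (G (x, t)) \<le> e"
    by blast
  then have "open (X0 \<inter> U)" "x \<in> X0 \<inter> U"
    using open_U assms(2) by auto
  then obtain d where "d > 0" "ball x d \<subseteq> X0 \<inter> U"
    using open_contains_ball_eq by blast
  with X(3) show ?thesis by (intro that[of d]) blast+
qed

lemma parametric_integral_continuous:
  assumes "continuous_on O' G"
  shows "continuous_on U (\<lambda>x. LINT s|M. \<kappa> s * G (x, p s))"
proof (rule continuous_at_imp_continuous_on, rule ballI)
  fix x assume x: "x \<in> U"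
  define B where "B = (LINT s|M. norm (\<kappa> s))"
  have B: "B \<ge> 0" unfolding B_def by simp
  show "continuous (at x) (\<lambda>x. LINT s|M. \<kappa> s * G (x, p s))"
    unfolding continuous_at_eps_delta
  proof (intro allI impI)
    fix e :: real assume e: "e > 0"
    define c where "c = e / (B + 1)"
    have c: "c > 0" using e B by (simp add: c_def)
    obtain d where d: "d > 0" "ball x d \<subseteq> U"
      "\<And>y w. y \<in> ball x d \<Longrightarrow> w \<in> K \<Longrightarrow> dist (G (y, w)) (G (x, w)) \<le> c"
      using parametric_uniformly_continuous[OF assms x c] by metis
    have "dist (LINT s|M. \<kappa> s * G (y, p s)) (LINT s|M. \<kappa> s * G (x, p s)) < e" if "dist y x < d" for y
    proof -
      have y: "y \<in> ball x d" using that by (simp add: dist_commute)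
      have I: "integrable M (\<lambda>s. \<kappa> s * G (y, p s))" "integrable M (\<lambda>s. \<kappa> s * G (x, p s))"
        using parametric_integrable[OF assms] x y d(2) by auto
      have "norm (LINT s|M. \<kappa> s * G (y, p s) - \<kappa> s * G (x, p s)) \<le> (LINT s|M. c * norm (\<kappa> s))"
      proof (rule Bochner_Integration.integral_norm_bound_integral)
        show "norm (\<kappa> s * G (y, p s) - \<kappa> s * G (x, p s)) \<le> c * norm (\<kappa> s)" if "s \<in> space M" for s
        proof (cases "\<kappa> s = 0")
          case False
          then have "norm (G (y, p s) - G (x, p s)) \<le> c"
            using d(3)[OF y pK[OF that]] by (simp add: dist_norm)
          then show ?thesis
            using mult_left_mono[of "norm (G (y, p s) - G (x, p s))" c "norm (\<kappa> s)"]
            by (simp add: norm_mult mult.commute flip: right_diff_distrib)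
        qed simp
      qed (use I \<kappa> in auto)
      also have "\<dots> = c * B" by (simp add: B_def)
      also have "\<dots> < e" using e B by (simp add: c_def field_simps)
      finally show ?thesis using I by (simp add: dist_norm)
    qed
    with d(1) show "\<exists>d>0. \<forall>y. dist y x < d \<longrightarrow>
        dist (LINT s|M. \<kappa> s * G (y, p s)) (LINT s|M. \<kappa> s * G (x, p s)) < e" by auto
  qed
qed

lemma parametric_integral_has_derivative:
  assumes G: "times_differentiable_on (Suc 0) G O'" and x: "x \<in> U"
  shows "((\<lambda>x. LINT s|M. \<kappa> s * G (x, p s)) has_derivative
     (\<lambda>v. LINT s|M. \<kappa> s * frechet_derivative G (at (x, p s)) (v, 0))) (at x)"
proof -
  define B where "B = (LINT s|M. norm (\<kappa> s))"
  have B: "B \<ge> 0" unfolding B_def by simp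
  define G' where "G' = (\<lambda>q v. frechet_derivative G (at q) (v, 0))"
  have contG: "continuous_on O' G"
    using Ck_continuous[OF G] .
  have contG': "continuous_on O' (\<lambda>q. G' q v)" for v
    using G by (simp add: G'_def)
  have der: "((\<lambda>y. G (y, w)) has_derivative G' (y, w)) (at y)" if "y \<in> U" "w \<in> K" for y w
    unfolding G'_def
    by (rule has_derivative_compose[of "\<lambda>y. (y, w)" "\<lambda>v. (v, 0)"])
      (use that UK in \<open>auto intro!: derivative_eq_intros Ck_derivative[OF G]\<close>)
  have blin: "bounded_linear (G' (y, w))" if "y \<in> U" "w \<in> K" for y w
    using has_derivative_bounded_linear[OF der[OF that]] .
  have I': "integrable M (\<lambda>s. \<kappa> s * G' (x, p s) v)" for v
    using parametric_integrable[OF contG' x] .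
  have lin: "linear (\<lambda>v. LINT s|M. \<kappa> s * G' (x, p s) v)"
  proof (rule linearI)
    fix u v
    have "(LINT s|M. \<kappa> s * G' (x, p s) (u + v)) = (LINT s|M. \<kappa> s * G' (x, p s) u + \<kappa> s * G' (x, p s) v)"
    proof (rule Bochner_Integration.integral_cong[OF refl])
      fix s assume "s \<in> space M"
      then show "\<kappa> s * G' (x, p s) (u + v) = \<kappa> s * G' (x, p s) u + \<kappa> s * G' (x, p s) v"
        using bounded_linear.linear[OF blin[OF x pK]] by (cases "\<kappa> s = 0") (auto simp: linear_add algebra_simps)
    qed
    then show "(LINT s|M. \<kappa> s * G' (x, p s) (u + v)) = (LINT s|M. \<kappa> s * G' (x, p s) u) + (LINT s|M. \<kappa> s * G' (x, p s) v)"
      using I' by simp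
  next
    fix r v
    have "(LINT s|M. \<kappa> s * G' (x, p s) (r *\<^sub>R v)) = (LINT s|M. r *\<^sub>R (\<kappa> s * G' (x, p s) v))"
    proof (rule Bochner_Integration.integral_cong[OF refl])
      fix s assume "s \<in> space M"
      then show "\<kappa> s * G' (x, p s) (r *\<^sub>R v) = r *\<^sub>R (\<kappa> s * G' (x, p s) v)"
        using bounded_linear.linear[OF blin[OF x pK]] by (cases "\<kappa> s = 0") (auto simp: linear_scale algebra_simps)
    qed
    then show "(LINT s|M. \<kappa> s * G' (x, p s) (r *\<^sub>R v)) = r *\<^sub>R (LINT s|M. \<kappa> s * G' (x, p s) v)"
      by simp
  qed
  \<comment> \<open>The remainder of the first order expansion of \<open>G\<close> is small uniformly in \<open>w \<in> K\<close>, because the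
     partial derivatives are uniformly continuous near \<open>{x} \<times> K\<close>.\<close>
  have small: "\<exists>d>0. ball x d \<subseteq> U \<and> (\<forall>y\<in>ball x d. \<forall>w\<in>K.
      norm (G (y, w) - G (x, w) - G' (x, w) (y - x)) \<le> norm (y - x) * c)" if c: "c > 0" for c
  proof -
    define c' where "c' = c / (real DIM('v))"
    have c': "c' > 0" using c by (simp add: c'_def)
    have "\<exists>d. d > 0 \<and> ball x d \<subseteq> U \<and> (\<forall>y\<in>ball x d. \<forall>w\<in>K. dist (G' (y, w) b) (G' (x, w) b) \<le> c')" for b
      using parametric_uniformly_continuous[OF contG'[of b] x c'] by metis
    then obtain d where d: "\<And>b. d b > 0" "\<And>b. ball x (d b) \<subseteq> U"
      "\<And>b y w. y \<in> ball x (d b) \<Longrightarrow> w \<in> K \<Longrightarrow> dist (G' (y, w) b) (G' (x, w) b) \<le> c'"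
      by metis
    define r where "r = Min (d ` Basis)"
    have r: "r > 0" using d(1) by (auto simp: r_def)
    have rd: "r \<le> d b" if "b \<in> Basis" for b using that by (auto simp: r_def)
    obtain b0 :: 'v where b0: "b0 \<in> Basis" using nonempty_Basis by blast
    have rU: "ball x r \<subseteq> U"
      using d(2)[of b0] rd[OF b0] subset_ball[of r "d b0" x] by blast
    have "norm (G (y, w) - G (x, w) - G' (x, w) (y - x)) \<le> norm (y - x) * c"
      if y: "y \<in> ball x r" and w: "w \<in> K" for y w
    proof (rule differentiable_bound_linearization[where S = "ball x r"])
      show "x + t *\<^sub>R (y - x) \<in> ball x r" if "t \<in> {0..1}" for t
      proof -
        have "t * norm (y - x) \<le> norm (y - x)" using that by (simp add: mult_left_le_one_le)
        also have "\<dots> < r" using y by (simp add: dist_norm norm_minus_commute)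
        finally show ?thesis using that by (simp add: dist_norm)
      qed
      show "((\<lambda>y. G (y, w)) has_derivative G' (z, w)) (at z within ball x r)" if "z \<in> ball x r" for z
        using der[OF _ w, of z] that rU has_derivative_at_withinI by blast
      show "onorm (G' (z, w) - G' (x, w)) \<le> c" if "z \<in> ball x r" for z
      proof -
        have "bounded_linear (\<lambda>v. G' (z, w) v - G' (x, w) v)"
          using blin[OF _ w, of z] blin[OF x w] that rU by (intro bounded_linear_sub) auto
        then have "onorm (\<lambda>v. G' (z, w) v - G' (x, w) v) \<le> (\<Sum>b\<in>Basis. norm (G' (z, w) b - G' (x, w) b))"
          by (rule onorm_componentwise)
        also have "\<dots> \<le> (\<Sum>b\<in>(Basis::'v set). c')"
        proof (rule sum_mono)
          fix b :: 'v assume b: "b \<in> Basis"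
          show "norm (G' (z, w) b - G' (x, w) b) \<le> c'"
            using d(3)[of z b w] that rd[OF b] w by (auto simp: dist_norm)
        qed
        also have "\<dots> = c" by (simp add: c'_def)
        finally show ?thesis by (simp add: fun_diff_def)
      qed
    qed (use r in auto)
    with r rU show ?thesis by blast
  qed
  have "((\<lambda>x. LINT s|M. \<kappa> s * G (x, p s)) has_derivative (\<lambda>v. LINT s|M. \<kappa> s * G' (x, p s) v)) (at x)"
    unfolding has_derivative_at_alt
  proof (intro conjI allI impI)
    show "bounded_linear (\<lambda>v. LINT s|M. \<kappa> s * G' (x, p s) v)"
      using lin by (simp add: linear_conv_bounded_linear)
    fix e :: real assume e: "e > 0"
    define c where "c = e / (B + 1)"
    have c: "c > 0" using e B by (simp add: c_def)
    obtain d where d: "d > 0" "ball x d \<subseteq> U" "\<And>y w. y \<in> ball x d \<Longrightarrow> w \<in> K \<Longrightarrow>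
      norm (G (y, w) - G (x, w) - G' (x, w) (y - x)) \<le> norm (y - x) * c"
      using small[OF c] by blast
    have "norm ((LINT s|M. \<kappa> s * G (y, p s)) - (LINT s|M. \<kappa> s * G (x, p s)) -
         (LINT s|M. \<kappa> s * G' (x, p s) (y - x))) \<le> e * norm (y - x)" if "norm (y - x) < d" for y
    proof -
      have y: "y \<in> ball x d" using that by (simp add: dist_norm norm_minus_commute)
      have I: "integrable M (\<lambda>s. \<kappa> s * G (y, p s))" "integrable M (\<lambda>s. \<kappa> s * G (x, p s))"
        using parametric_integrable[OF contG] x y d(2) by auto
      have "norm (LINT s|M. \<kappa> s * G (y, p s) - \<kappa> s * G (x, p s) - \<kappa> s * G' (x, p s) (y - x))
         \<le> (LINT s|M. (norm (y - x) * c) * norm (\<kappa> s))"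
      proof (rule Bochner_Integration.integral_norm_bound_integral)
        show "norm (\<kappa> s * G (y, p s) - \<kappa> s * G (x, p s) - \<kappa> s * G' (x, p s) (y - x))
           \<le> (norm (y - x) * c) * norm (\<kappa> s)" if "s \<in> space M" for s
        proof (cases "\<kappa> s = 0")
          case False
          then have "norm (G (y, p s) - G (x, p s) - G' (x, p s) (y - x)) \<le> norm (y - x) * c"
            using d(3)[OF y pK[OF that]] by simp
          then have "norm (\<kappa> s) * norm (G (y, p s) - G (x, p s) - G' (x, p s) (y - x)) \<le> norm (\<kappa> s) * (norm (y - x) * c)"
            by (rule mult_left_mono) simp
          then show ?thesis
            by (simp add: mult.commute flip: right_diff_distrib norm_mult)
        qed simp
      qed (use I I' \<kappa> in auto)
      also have "\<dots> = norm (y - x) * (c * B)" by (simp add: B_def)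
      also have "\<dots> \<le> norm (y - x) * e"
        using e B by (intro mult_left_mono) (simp_all add: c_def field_simps)
      finally show ?thesis using I I' by (simp add: mult.commute)
    qed
    with d(1) show "\<exists>d>0. \<forall>y. norm (y - x) < d \<longrightarrow> norm ((LINT s|M. \<kappa> s * G (y, p s)) -
         (LINT s|M. \<kappa> s * G (x, p s)) - (LINT s|M. \<kappa> s * G' (x, p s) (y - x))) \<le> e * norm (y - x)"
      by auto
  qed
  then show ?thesis unfolding G'_def .
qed

text \<open>Directional derivatives of the integrand are again admissible integrands, of one order less,
  so the two preceding lemmas give the general case by induction.\<close>

lemma parametric_integral_times_differentiable_on:
  assumes "times_differentiable_on k G O'"
  shows "times_differentiable_on k (\<lambda>x. LINT s|M. \<kappa> s * G (x, p s)) U"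
  using assms
proof (induction k arbitrary: G)
  case 0
  then show ?case by (simp add: parametric_integral_continuous)
next
  case (Suc k)
  show ?case
  proof (rule times_differentiable_onI[OF open_U parametric_integral_has_derivative])
    show "times_differentiable_on (Suc 0) G O'"
      by (rule Ck_mono[OF Suc.prems]) simp
    show "times_differentiable_on k (\<lambda>x. LINT s|M. \<kappa> s * frechet_derivative G (at (x, p s)) (v, 0)) U" for v
      using Suc.IH[of "\<lambda>q. frechet_derivative G (at q) (v, 0)"] Suc.prems by simp
  qed
qed

end

section \<open>Smooth cutoff functions\<close>

text \<open>The functions \<open>exp (- 1 / t) / t ^ m\<close> are treated together because the derivative of each one is a
  combination of two others, so that smoothness of all of them follows by a single induction.\<close>

definition flat :: "nat \<Rightarrow> real \<Rightarrow> real" where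
  "flat m t = (if t > 0 then exp (- inverse t) * inverse t ^ m else 0)"

lemma flat_nonneg: "flat m t \<ge> 0" and flat_pos: "t > 0 \<Longrightarrow> flat m t > 0"
  by (simp_all add: flat_def)

lemma flat_tendsto_0: "(flat m \<longlongrightarrow> 0) (at 0)"
proof -
  have "((\<lambda>t::real. inverse t ^ m / exp (inverse t)) \<longlongrightarrow> 0) (at_right 0)"
    by (rule filterlim_compose[OF tendsto_power_div_exp_0 filterlim_inverse_at_top_right])
  moreover have "\<forall>\<^sub>F t in at_right 0. inverse t ^ m / exp (inverse t) = flat m t"
    by (auto simp: eventually_at_filter flat_def exp_minus divide_inverse mult.commute)
  ultimately have "(flat m \<longlongrightarrow> 0) (at_right 0)"
    by (rule Lim_transform_eventually)
  moreover have "\<forall>\<^sub>F t in at_left 0. 0 = flat m t"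
    by (auto simp: eventually_at_filter flat_def)
  then have "(flat m \<longlongrightarrow> 0) (at_left 0)"
    by (rule Lim_transform_eventually[OF tendsto_const])
  ultimately show ?thesis
    by (simp add: filterlim_split_at)
qed

lemma flat_has_derivative: "(flat m has_real_derivative flat (m + 2) t - real m * flat (m + 1) t) (at t)"
proof (cases t "0::real" rule: linorder_cases)
  case less
  have "((\<lambda>t. 0) has_real_derivative 0) (at t)" by simp
  then have "(flat m has_real_derivative 0) (at t)"
    by (rule has_field_derivative_transform_within_open[of _ _ _ "{..<0}"]) (use less in \<open>auto simp: flat_def\<close>)
  then show ?thesis using less by (simp add: flat_def)
next
  case equal
  have "((\<lambda>h. (flat m (0 + h) - flat m 0) / h) \<longlongrightarrow> 0) (at 0)"
    by (rule Lim_transform_eventually[OF flat_tendsto_0[of "Suc m"]])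
      (auto simp: eventually_at_filter flat_def divide_inverse)
  then have "(flat m has_real_derivative 0) (at 0)"
    by (simp add: DERIV_def)
  then show ?thesis using equal by (simp add: flat_def)
next
  case greater
  have "((\<lambda>t. exp (- inverse t) * inverse t ^ m) has_real_derivative
     exp (- inverse t) * inverse t ^ (m + 2) - m * (exp (- inverse t) * inverse t ^ (m + 1))) (at t)"
  proof (cases m)
    case (Suc l)
    show ?thesis unfolding Suc
      by (rule derivative_eq_intros refl | use greater in \<open>simp add: algebra_simps\<close>)+
  qed (use greater in \<open>auto intro!: derivative_eq_intros simp: power2_eq_square\<close>)
  then have "(flat m has_real_derivative
     exp (- inverse t) * inverse t ^ (m + 2) - m * (exp (- inverse t) * inverse t ^ (m + 1))) (at t)"
    by (rule has_field_derivative_transform_within_open[of _ _ _ "{0<..}"]) (use greater in \<open>auto simp: flat_def\<close>)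
  then show ?thesis using greater by (simp add: flat_def)
qed

lemma flat_times_differentiable_on: "times_differentiable_on k (flat m) UNIV"
proof (induction k arbitrary: m)
  case 0
  show ?case
    using flat_has_derivative[of m] DERIV_isCont by (auto intro!: continuous_at_imp_continuous_on)
next
  case (Suc k)
  show ?case
  proof (rule times_differentiable_onI[OF open_UNIV])
    show "(flat m has_derivative (\<lambda>v. (flat (m + 2) t - real m * flat (m + 1) t) * v)) (at t)" for t
      using flat_has_derivative[of m t] by (simp add: has_field_derivative_def)
    show "times_differentiable_on k (\<lambda>t. (flat (m + 2) t - real m * flat (m + 1) t) * v) UNIV" for v
      by (intro Ck_mult Ck_diff
          Ck_const Suc.IH open_UNIV)
  qed
qed

definition smooth_step :: "real \<Rightarrow> real" where
  "smooth_step t = flat 0 t / (flat 0 t + flat 0 (1 - t))"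

lemma smooth_step_eq_0: "t \<le> 0 \<Longrightarrow> smooth_step t = 0"
  and smooth_step_eq_1: "t \<ge> 1 \<Longrightarrow> smooth_step t = 1"
  by (auto simp: smooth_step_def flat_def)

lemma smooth_step_times_differentiable_on: "times_differentiable_on k smooth_step UNIV"
proof -
  have "flat 0 t + flat 0 (1 - t) \<noteq> 0" for t
    using flat_pos[of t 0] flat_pos[of "1 - t" 0] flat_nonneg[of 0 t] flat_nonneg[of 0 "1 - t"]
    by (cases "t > 0") auto
  moreover have "times_differentiable_on k (\<lambda>t. flat 0 (1 - t)) UNIV"
    by (rule Ck_compose_affine[where L = uminus, OF open_UNIV open_UNIV
        flat_times_differentiable_on]) (auto intro!: derivative_eq_intros)
  ultimately show ?thesis
    unfolding smooth_step_def
    by (intro Ck_divide Ck_add open_UNIV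
        flat_times_differentiable_on) auto
qed

lemma norm_square_times_differentiable_on:
  "times_differentiable_on k (\<lambda>w::complex. (norm (w - c))\<^sup>2) U"
proof -
  have "times_differentiable_on k (\<lambda>w. Re (w - c) * Re (w - c) + Im (w - c) * Im (w - c)) UNIV"
    by (intro Ck_add Ck_mult
        Ck_linear_image[OF bounded_linear_Re]
        Ck_linear_image[OF bounded_linear_Im]
        Ck_diff Ck_const
        Ck_bounded_linear bounded_linear_ident open_UNIV)
  then have "times_differentiable_on k (\<lambda>w::complex. (norm (w - c))\<^sup>2) UNIV"
    by (simp only: cmod_power2) (simp only: power2_eq_square)
  then show ?thesis
    using Ck_subset by blast
qed

lemma smooth_bump_ball:
  fixes c :: complex
  assumes "0 < r" "r < R"
  obtains \<phi> :: "complex \<Rightarrow> complex" where "\<And>k. times_differentiable_on k \<phi> UNIV"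
    "\<And>w. w \<in> ball c r \<Longrightarrow> \<phi> w = 1" "\<And>w. w \<notin> ball c R \<Longrightarrow> \<phi> w = 0"
proof
  define g where "g w = (R\<^sup>2 - (norm (w - c))\<^sup>2) * inverse (R\<^sup>2 - r\<^sup>2)" for w
  define \<phi> where "\<phi> w = complex_of_real (smooth_step (g w))" for w
  have "R\<^sup>2 - r\<^sup>2 > 0"
    using assms by (simp add: power_strict_mono)
  show "times_differentiable_on k \<phi> UNIV" for k
    unfolding \<phi>_def g_def
    by (intro Ck_linear_image[OF bounded_linear_of_real] open_UNIV
        Ck_compose_real[OF open_UNIV smooth_step_times_differentiable_on]
        Ck_mult Ck_diff Ck_const
        norm_square_times_differentiable_on)
  show "\<phi> w = 1" if "w \<in> ball c r" for w
  proof -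
    have "(norm (w - c))\<^sup>2 \<le> r\<^sup>2"
      using that by (intro power_mono) (auto simp: dist_norm norm_minus_commute)
    then have "g w \<ge> 1" using \<open>R\<^sup>2 - r\<^sup>2 > 0\<close> by (simp add: g_def field_simps)
    then show ?thesis by (simp add: \<phi>_def smooth_step_eq_1)
  qed
  show "\<phi> w = 0" if "w \<notin> ball c R" for w
  proof -
    have "R\<^sup>2 \<le> (norm (w - c))\<^sup>2"
      using that assms by (intro power_mono) (auto simp: dist_norm norm_minus_commute)
    then have "g w \<le> 0" using \<open>R\<^sup>2 - r\<^sup>2 > 0\<close> by (simp add: g_def field_simps)
    then show ?thesis by (simp add: \<phi>_def smooth_step_eq_0)
  qed
qed

text \<open>If finitely many discs cover \<open>K\<close> and \<open>\<phi>\<^sub>x\<close> is 1 on one of them, then \<open>1 - \<Prod>\<^sub>x (1 - \<phi>\<^sub>x)\<close> is 1 on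
  all of them; unlike the sum it needs no normalization.\<close>

lemma smooth_cutoff:
  fixes K :: "complex set"
  assumes "compact K" "open N" "K \<subseteq> N"
  obtains \<phi> :: "complex \<Rightarrow> complex" and C where "\<And>k. times_differentiable_on k \<phi> UNIV"
    "\<And>w. w \<in> K \<Longrightarrow> \<phi> w = 1" "compact C" "C \<subseteq> N" "\<And>w. w \<notin> C \<Longrightarrow> \<phi> w = 0"
proof -
  have "\<exists>r>0. cball x (2 * r) \<subseteq> N" if "x \<in> K" for x
  proof -
    have "x \<in> N" using that assms(3) by blast
    then obtain s where "s > 0" "cball x s \<subseteq> N"
      using open_contains_cball_eq[OF assms(2)] by blast
    then show ?thesis by (intro exI[of _ "s / 2"]) simp
  qed
  then obtain r where r: "\<And>x. x \<in> K \<Longrightarrow> r x > 0" "\<And>x. x \<in> K \<Longrightarrow> cball x (2 * r x) \<subseteq> N"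
    by metis
  have cov: "K \<subseteq> (\<Union>x\<in>K. ball x (r x))"
    using r(1) centre_in_ball by blast
  obtain F where F: "F \<subseteq> K" "finite F" "K \<subseteq> (\<Union>x\<in>F. ball x (r x))"
    by (rule compactE_image[OF assms(1) _ cov]) auto
  have "\<exists>\<phi>::complex \<Rightarrow> complex. (\<forall>k. times_differentiable_on k \<phi> UNIV) \<and>
      (\<forall>w\<in>ball x (r x). \<phi> w = 1) \<and> (\<forall>w. w \<notin> ball x (2 * r x) \<longrightarrow> \<phi> w = 0)" if x: "x \<in> K" for x
  proof -
    have "r x < 2 * r x" using r(1)[OF x] by simp
    then obtain \<phi> :: "complex \<Rightarrow> complex" where "\<And>k. times_differentiable_on k \<phi> UNIV"
      "\<And>w. w \<in> ball x (r x) \<Longrightarrow> \<phi> w = 1" "\<And>w. w \<notin> ball x (2 * r x) \<Longrightarrow> \<phi> w = 0"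
      by (rule smooth_bump_ball[OF r(1)[OF x], where c = x]) blast
    then show ?thesis by blast
  qed
  then have "\<exists>\<phi>. \<forall>x\<in>K. (\<forall>k. times_differentiable_on k (\<phi> x) UNIV) \<and>
      (\<forall>w\<in>ball x (r x). \<phi> x w = 1) \<and> (\<forall>w. w \<notin> ball x (2 * r x) \<longrightarrow> (\<phi> x w :: complex) = 0)"
    by (intro bchoice) blast
  then obtain \<phi> :: "complex \<Rightarrow> complex \<Rightarrow> complex" where
    \<phi>: "\<And>x k. x \<in> K \<Longrightarrow> times_differentiable_on k (\<phi> x) UNIV"
      "\<And>x w. x \<in> K \<Longrightarrow> w \<in> ball x (r x) \<Longrightarrow> \<phi> x w = 1"
      "\<And>x w. x \<in> K \<Longrightarrow> w \<notin> ball x (2 * r x) \<Longrightarrow> \<phi> x w = 0"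
    by blast
  show ?thesis
  proof (rule that[of "\<lambda>w. 1 - (\<Prod>x\<in>F. 1 - \<phi> x w)" "\<Union>x\<in>F. cball x (2 * r x)"])
    show "times_differentiable_on k (\<lambda>w. 1 - (\<Prod>x\<in>F. 1 - \<phi> x w)) UNIV" for k
      using F \<phi>(1) by (intro Ck_diff Ck_prod
          Ck_const open_UNIV) auto
    show "1 - (\<Prod>x\<in>F. 1 - \<phi> x w) = 1" if w: "w \<in> K" for w
    proof -
      obtain x where "x \<in> F" "w \<in> ball x (r x)" using w F(3) by blast
      then have "\<phi> x w = 1" using F \<phi>(2) by blast
      then have "(\<Prod>x\<in>F. 1 - \<phi> x w) = 0" using F(2) \<open>x \<in> F\<close> by (intro prod_zero) auto
      then show ?thesis by simp
    qed
    show "compact (\<Union>x\<in>F. cball x (2 * r x))" using F by auto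
    show "(\<Union>x\<in>F. cball x (2 * r x)) \<subseteq> N" using F r(2) by blast
    show "1 - (\<Prod>x\<in>F. 1 - \<phi> x w) = 0" if "w \<notin> (\<Union>x\<in>F. cball x (2 * r x))" for w
    proof -
      have "\<phi> x w = 0" if "x \<in> F" for x
        using F \<phi>(3)[of x w] that \<open>w \<notin> _\<close> by force
      then show ?thesis by simp
    qed
  qed
qed

section \<open>The Cauchy kernel\<close>

lemma emeasure_complex_ball: "r \<ge> 0 \<Longrightarrow> emeasure lborel (ball (c::complex) r) = ennreal (pi * r\<^sup>2)"
  by (simp add: emeasure_ball unit_ball_vol_numeral)

text \<open>Split the disc dyadically: on the \<open>n\<close>-th annulus the integrand is of size \<open>2\<^sup>n/R\<close>, the area of
  size \<open>4\<^sup>-\<^sup>n R\<^sup>2\<close>.\<close>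

lemma nn_integral_inverse_norm_ball:
  fixes c :: complex
  assumes R: "R > 0"
  shows "(\<integral>\<^sup>+w. ennreal (indicator (ball c R) w / norm (w - c)) \<partial>lborel) \<le> ennreal (4 * pi * R)"
proof -
  define f where "f n w = ennreal (indicator (ball c (R / 2 ^ n)) w * (2 * 2 ^ n / R))" for n :: nat and w
  have "(\<integral>\<^sup>+w. ennreal (indicator (ball c R) w / norm (w - c)) \<partial>lborel) \<le> (\<integral>\<^sup>+w. (\<Sum>n. f n w) \<partial>lborel)"
  proof (rule nn_integral_mono)
    fix w
    show "ennreal (indicator (ball c R) w / norm (w - c)) \<le> (\<Sum>n. f n w)"
    proof (cases "w \<in> ball c R \<and> w \<noteq> c")
      case True
      define d where "d = norm (w - c)"
      have d: "d > 0" "d < R" using True by (auto simp: d_def dist_norm norm_minus_commute)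
      define n where "n = (LEAST n. R / 2 ^ Suc n \<le> d)"
      have "\<exists>n. (1/2) ^ n < d / R"
        using d R by (intro real_arch_pow_inv) auto
      then obtain m where "(1/2) ^ m < d / R" by blast
      then have "R / 2 ^ Suc m \<le> d"
        using R d by (simp add: field_simps)
      then have n: "R / 2 ^ Suc n \<le> d" unfolding n_def by (rule LeastI)
      have n': "d < R / 2 ^ n"
      proof (cases n)
        case 0
        with d show ?thesis by simp
      next
        case (Suc m)
        then have "\<not> R / 2 ^ Suc m \<le> d" using not_less_Least[of m "\<lambda>n. R / 2 ^ Suc n \<le> d"] n_def by auto
        with Suc show ?thesis by simp
      qed
      have "1 / d \<le> 2 * 2 ^ n / R"
        using n d R by (simp add: field_simps)
      then have "ennreal (indicator (ball c R) w / norm (w - c)) \<le> f n w"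
        using n' True by (auto simp: f_def d_def dist_norm norm_minus_commute intro!: ennreal_leI)
      also have "\<dots> \<le> (\<Sum>n. f n w)"
        using sum_le_suminf[of "\<lambda>n. f n w" "{n}"] by (simp add: summableI)
      finally show ?thesis .
    qed auto
  qed
  also have "\<dots> = (\<Sum>n. \<integral>\<^sup>+w. f n w \<partial>lborel)"
    proof (rule nn_integral_suminf)
    fix n
    have [measurable]: "ball c (R / 2 ^ n) \<in> sets borel" by simp
    show "f n \<in> borel_measurable lborel" unfolding f_def by measurable
  qed
  also have "\<dots> = (\<Sum>n. ennreal (2 * pi * R * (1/2) ^ n))"
  proof (rule suminf_cong)
    fix n
    have "(\<integral>\<^sup>+w. f n w \<partial>lborel) = (\<integral>\<^sup>+w. ennreal (2 * 2 ^ n / R) * indicator (ball c (R / 2 ^ n)) w \<partial>lborel)"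
      by (rule nn_integral_cong) (simp add: f_def indicator_def)
    also have "\<dots> = ennreal (2 * 2 ^ n / R) * ennreal (pi * (R / 2 ^ n)\<^sup>2)"
      using R by (subst nn_integral_cmult_indicator) (auto simp: emeasure_complex_ball)
    also have "\<dots> = ennreal (2 * pi * R * (1/2) ^ n)"
      using R by (subst ennreal_mult[symmetric]) (auto simp: field_simps power2_eq_square)
    finally show "(\<integral>\<^sup>+w. f n w \<partial>lborel) = ennreal (2 * pi * R * (1/2) ^ n)" .
  qed
  also have "\<dots> = ennreal (4 * pi * R)"
  proof (rule suminf_ennreal_eq)
    show "(\<lambda>n. 2 * pi * R * (1/2) ^ n) sums (4 * pi * R)"
      using sums_mult[OF geometric_sums[of "1/2::real"], of "2 * pi * R"] by (simp add: mult_ac)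
  qed (use R in auto)
  finally show ?thesis .
qed

lemma integrable_inverse_ball: "integrable lborel (\<lambda>w. indicator (ball c R) w / (w - c) :: complex)"
proof (cases "R > 0")
  case True
  have [measurable]: "ball c R \<in> sets borel" by simp
  have "ennreal (norm (indicator (ball c R) w / (w - c) :: complex)) =
      ennreal (indicator (ball c R) w / norm (w - c))" for w
    by (simp add: norm_divide indicator_def)
  moreover have "(\<lambda>w. indicator (ball c R) w / (w - c) :: complex) \<in> borel_measurable lborel"
    by measurable
  ultimately show ?thesis
    using nn_integral_inverse_norm_ball[OF True, of c]
    by (intro integrableI_bounded) (auto intro: le_less_trans)
next
  case False
  then have "ball c R = {}" by simp
  then show ?thesis by (simp only: indicator_simps empty_iff not_False_eq_True) simp
qed

lemma integral_inverse_norm_ball_le: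
  fixes c :: complex
  assumes R: "R > 0"
  shows "(LINT w|lborel. indicator (ball c R) w / norm (w - c)) \<le> 4 * pi * R"
proof -
  have [measurable]: "ball c R \<in> sets borel" by simp
  have "(\<lambda>w. indicator (ball c R) w / norm (w - c)) \<in> borel_measurable lborel"
    by measurable
  then show ?thesis
    using R nn_integral_inverse_norm_ball[OF R, of c]
    by (subst integral_eq_nn_integral) (auto intro!: enn2real_leI)
qed

text \<open>Translating the argument does not change the integral, so its derivative with respect to the
  translation is zero.\<close>

lemma integral_frechet_derivative_eq_0:
  fixes h :: "complex \<Rightarrow> complex"
  assumes h: "times_differentiable_on 1 h UNIV" and 0: "\<And>w. w \<notin> cball 0 R \<Longrightarrow> h w = 0"
  shows "(LINT w|lborel. frechet_derivative h (at w) v) = 0"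
proof -
  define K where "K = cball (0::complex) (R + norm v)"
  define \<kappa> where "\<kappa> = (\<lambda>w. indicator K w *\<^sub>R (1::complex))"
  define G where "G = (\<lambda>(t::real, w). h (w + t *\<^sub>R v))"
  have der: "(h has_derivative frechet_derivative h (at w)) (at w)" for w
    using Ck_derivative[of 0 h UNIV w] h by simp
  have lin: "((\<lambda>q. snd q + fst q *\<^sub>R v) has_derivative (\<lambda>q. snd q + fst q *\<^sub>R v)) (at x)" for x :: "real \<times> complex"
    by (auto intro!: derivative_eq_intros)
  have G: "times_differentiable_on 1 G UNIV"
    unfolding G_def case_prod_beta
    by (rule Ck_compose_affine[OF open_UNIV open_UNIV h _ lin]) simp
  have G': "frechet_derivative G (at (0, w)) (1, 0) = frechet_derivative h (at w) v" for w
  proof -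
    have "(G has_derivative (\<lambda>q. frechet_derivative h (at w) (snd q + fst q *\<^sub>R v))) (at (0, w))"
      unfolding G_def case_prod_beta
      using has_derivative_compose[OF lin, of h "frechet_derivative h (at w)" "(0, w)"] der by simp
    from frechet_derivative_at[OF this] show ?thesis
      by (metis (no_types, lifting) add_0 fst_conv scaleR_one snd_conv)
  qed
  have D1: "((\<lambda>t. LINT w|lborel. \<kappa> w * G (t, w)) has_derivative
     (\<lambda>s. LINT w|lborel. \<kappa> w * frechet_derivative G (at (0, w)) (s, 0))) (at 0)"
  proof (rule parametric_integral_has_derivative[where U = "{-1<..<1}" and O' = UNIV and K = K])
    show "complex_integrable lborel \<kappa>"
      unfolding \<kappa>_def K_def by (rule integrable_indicator) (simp, rule emeasure_lborel_cball_finite)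
    show "w \<in> K" if "\<kappa> w \<noteq> 0" for w using that by (auto simp: \<kappa>_def indicator_def split: if_splits)
  qed (use G in \<open>auto simp: K_def\<close>)
  have "(LINT w|lborel. \<kappa> w * G (t, w)) = (LINT w|lborel. h w)" if "t \<in> {-1<..<1}" for t
  proof -
    have "\<kappa> w * G (t, w) = h (t *\<^sub>R v + w)" for w
    proof (cases "w \<in> K")
      case False
      have "norm (t *\<^sub>R v) \<le> norm v" using that mult_right_mono[of "\<bar>t\<bar>" 1 "norm v"] by (simp add: abs_less_iff abs_le_iff)
      moreover have "norm w \<le> norm (t *\<^sub>R v + w) + norm (t *\<^sub>R v)"
        using norm_triangle_ineq4[of "t *\<^sub>R v + w" "t *\<^sub>R v"] by simp
      ultimately have "t *\<^sub>R v + w \<notin> cball 0 R" using False by (auto simp: K_def)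
      with False show ?thesis using 0 by (simp add: \<kappa>_def)
    qed (simp add: G_def \<kappa>_def add.commute)
    then have "(LINT w|lborel. \<kappa> w * G (t, w)) = (LINT w|lborel. h (t *\<^sub>R v + w))" by simp
    also have "\<dots> = (LINT w|distr lborel borel ((+) (t *\<^sub>R v)). h w)"
      using Ck_continuous[OF h]
      by (subst integral_distr) (auto intro: borel_measurable_continuous_onI)
    finally show ?thesis by (simp add: lborel_distr_plus)
  qed
  then have D2: "((\<lambda>t. LINT w|lborel. \<kappa> w * G (t, w)) has_derivative (\<lambda>s. 0)) (at 0)"
    by (intro has_derivative_transform_within_open[OF has_derivative_const, of "{-1<..<1}" 0 "LINT w|lborel. h w"]) auto
  have "(LINT w|lborel. \<kappa> w * frechet_derivative G (at (0, w)) (1, 0)) = 0"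
  proof -
    from has_derivative_unique[OF D1 D2]
    have "(\<lambda>s. LINT w|lborel. \<kappa> w * frechet_derivative G (at (0, w)) (s, 0)) 1 = (\<lambda>s::real. 0::complex) 1"
      by (rule fun_cong)
    then show ?thesis .
  qed
  moreover have "\<kappa> w * frechet_derivative G (at (0, w)) (1, 0) = frechet_derivative h (at w) v" for w
  proof (cases "w \<in> K")
    case False
    have w: "w \<notin> cball 0 R"
      using False norm_ge_zero[of v] by (auto simp: K_def simp del: norm_ge_zero)
    then have "frechet_derivative h (at w) v = 0"
      by (rule frechet_derivative_outside_support[OF closed_cball _ 0])
    with False show ?thesis by (simp add: \<kappa>_def)
  qed (simp add: G' \<kappa>_def)
  ultimately show ?thesis by simp
qed

text \<open>The Wirtinger derivative with respect to the conjugate variable, for functions of one complex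
  variable.\<close>

definition cr_derivative :: "(complex \<Rightarrow> complex) \<Rightarrow> complex \<Rightarrow> complex" where
  "cr_derivative g z = (frechet_derivative g (at z) 1 + \<i> * frechet_derivative g (at z) \<i>) / 2"

lemma cr_derivative_eqI:
  "(g has_derivative g') (at z) \<Longrightarrow> cr_derivative g z = (g' 1 + \<i> * g' \<i>) / 2"
  using frechet_derivative_at[of g g' z] by (simp add: cr_derivative_def)

lemma cr_derivative_mult:
  assumes "f differentiable (at z)" "g differentiable (at z)"
  shows "cr_derivative (\<lambda>w. f w * g w) z = f z * cr_derivative g z + cr_derivative f z * g z"
proof -
  have "((\<lambda>w. f w * g w) has_derivative
     (\<lambda>v. f z * frechet_derivative g (at z) v + frechet_derivative f (at z) v * g z)) (at z)"
    using assms by (intro has_derivative_mult) (auto simp: frechet_derivative_works)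
  from cr_derivative_eqI[OF this] show ?thesis
    by (simp only: cr_derivative_def) (simp add: algebra_simps add_divide_distrib)
qed

lemma cr_derivative_cong:
  assumes "open U" "z \<in> U" "\<And>w. w \<in> U \<Longrightarrow> f w = g w" "f differentiable (at z)"
  shows "cr_derivative f z = cr_derivative g z"
  using frechet_derivative_transform_within_open[OF assms(4,1,2,3)] by (simp add: cr_derivative_def)

lemma cr_derivative_outside_support:
  assumes "closed C" "z \<notin> C" "\<And>w. w \<notin> C \<Longrightarrow> f w = 0"
  shows "cr_derivative f z = 0"
  using frechet_derivative_outside_support[OF assms] by (simp add: cr_derivative_def)

lemma cr_derivative_continuous_on:
  assumes "times_differentiable_on 1 f U"
  shows "continuous_on U (cr_derivative f)"
proof -
  have "continuous_on U (\<lambda>z. frechet_derivative f (at z) v)" for v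
    using assms by simp
  then show ?thesis unfolding cr_derivative_def by (intro continuous_intros) auto
qed

subsection \<open>A regularization of the Cauchy kernel\<close>

definition square_pos :: "real \<Rightarrow> real" where "square_pos t = (max 0 t)\<^sup>2"

lemma square_pos_has_derivative: "(square_pos has_real_derivative 2 * max 0 t) (at t)"
proof (cases t "0::real" rule: linorder_cases)
  case less
  have "((\<lambda>t. 0) has_real_derivative 0) (at t)" by simp
  then have "(square_pos has_real_derivative 0) (at t)"
    by (rule has_field_derivative_transform_within_open[of _ _ _ "{..<0}"])
      (use less in \<open>auto simp: square_pos_def\<close>)
  with less show ?thesis by simp
next
  case equal
  have "((\<lambda>h. max 0 h * (max 0 h / h)) \<longlongrightarrow> 0) (at (0::real))"
  proof (rule Lim_null_comparison)
    show "\<forall>\<^sub>F h in at 0. norm (max 0 h * (max 0 h / h)) \<le> \<bar>h :: real\<bar>"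
      by (auto simp: eventually_at_filter max_def)
    show "((\<lambda>h. \<bar>h\<bar>) \<longlongrightarrow> 0) (at (0::real))" by (intro tendsto_eq_intros) auto
  qed
  then have "(square_pos has_real_derivative 0) (at 0)"
    by (simp add: DERIV_def square_pos_def power2_eq_square)
  with equal show ?thesis by simp
next
  case greater
  have "((\<lambda>t. t\<^sup>2) has_real_derivative 2 * t) (at t)"
    by (auto intro!: derivative_eq_intros)
  then have "(square_pos has_real_derivative 2 * t) (at t)"
    by (rule has_field_derivative_transform_within_open[of _ _ _ "{0<..}"])
      (use greater in \<open>auto simp: square_pos_def\<close>)
  with greater show ?thesis by simp
qed

lemma square_pos_times_differentiable_on: "times_differentiable_on 1 square_pos UNIV"
  unfolding One_nat_def
proof (rule times_differentiable_onI[OF open_UNIV])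
  show "(square_pos has_derivative (\<lambda>v. 2 * max 0 t * v)) (at t)" for t
    using square_pos_has_derivative[of t] by (simp add: has_field_derivative_def)
  show "times_differentiable_on 0 (\<lambda>t. 2 * max 0 t * v) UNIV" for v :: real
    by (auto intro!: continuous_intros)
qed

text \<open>The kernel \<open>1 / w\<close> outside the disc of radius \<open>e\<close>, made continuously differentiable inside. The
  square of the positive part is the simplest profile for which this works, and the derivative of the
  kernel is then the explicit function \<open>bump_density e\<close>, whose total mass is easily computed.\<close>

definition regularized_kernel :: "real \<Rightarrow> complex \<Rightarrow> complex" where
  "regularized_kernel e w = (1 - of_real (square_pos (1 - (norm w)\<^sup>2 / e\<^sup>2))) / w"

text \<open>Near the origin the numerator is \<open>1 - (1 - s)\<^sup>2 = s (2 - s)\<close> with \<open>s = w \<cdot> cnj w / e\<^sup>2\<close>, which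
  contains the factor \<open>w\<close>.\<close>

lemma regularized_kernel_times_differentiable_on:
  assumes e: "e > 0"
  shows "times_differentiable_on 1 (regularized_kernel e) UNIV"
proof (rule Ck_local)
  fix w :: complex
  have ns: "times_differentiable_on k (\<lambda>w::complex. (norm w)\<^sup>2) U" for k U
    using norm_square_times_differentiable_on[of k 0] by simp
  show "\<exists>N. open N \<and> w \<in> N \<and> times_differentiable_on 1 (regularized_kernel e) N"
  proof (cases "w = 0")
    case True
    have "times_differentiable_on 1 (regularized_kernel e) (ball 0 e)"
    proof (rule Ck_cong)
      show "times_differentiable_on 1 (\<lambda>w. cnj w * of_real ((2 - (norm w)\<^sup>2 * inverse (e\<^sup>2)) * inverse (e\<^sup>2))) (ball 0 e)"
        by (intro Ck_mult Ck_bounded_linear bounded_linear_cnj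
            Ck_linear_image[OF bounded_linear_of_real] ns open_ball
            Ck_diff Ck_const)
      fix w :: complex assume w: "w \<in> ball 0 e"
      define s where "s = (norm w)\<^sup>2 / e\<^sup>2"
      have "(norm w)\<^sup>2 \<le> e\<^sup>2" using w by (intro power_mono) auto
      then have s: "s \<le> 1" using e by (simp add: s_def)
      show "cnj w * of_real ((2 - (norm w)\<^sup>2 * inverse (e\<^sup>2)) * inverse (e\<^sup>2)) = regularized_kernel e w"
      proof (cases "w = 0")
        case False
        have "w * (cnj w * of_real ((2 - s) * inverse (e\<^sup>2))) = of_real ((norm w)\<^sup>2 * ((2 - s) * inverse (e\<^sup>2)))"
          by (simp only: of_real_mult complex_norm_square mult.assoc)
        also have "(norm w)\<^sup>2 * ((2 - s) * inverse (e\<^sup>2)) = s * (2 - s)"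
          by (simp add: s_def field_simps)
        also have "\<dots> = 1 - square_pos (1 - s)"
          using s by (simp add: square_pos_def power2_eq_square algebra_simps)
        finally show ?thesis
          using False by (simp add: regularized_kernel_def s_def field_simps)
      qed (simp add: regularized_kernel_def)
    qed simp
    with True e show ?thesis by (intro exI[of _ "ball 0 e"]) simp
  next
    case False
    have "times_differentiable_on 1 (\<lambda>w. (1 - of_real (square_pos (1 - (norm w)\<^sup>2 * inverse (e\<^sup>2)))) / w) (- {0::complex})"
      by (intro Ck_divide Ck_diff Ck_const
          Ck_linear_image[OF bounded_linear_of_real]
          Ck_compose_real[OF _ square_pos_times_differentiable_on]
          Ck_mult ns Ck_bounded_linear bounded_linear_ident) auto
    with False show ?thesis
      by (intro exI[of _ "- {0}"]) (auto simp: regularized_kernel_def[abs_def] divide_inverse simp del: times_differentiable_on.simps)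
  qed
qed

definition bump_density :: "real \<Rightarrow> complex \<Rightarrow> real" where
  "bump_density e w = 2 * max 0 (1 - (norm w)\<^sup>2 / e\<^sup>2) / e\<^sup>2"

lemma cr_derivative_regularized_kernel:
  assumes w: "w \<noteq> 0"
  shows "cr_derivative (regularized_kernel e) w = of_real (bump_density e w)"
proof -
  define m where "m = 2 * max 0 (1 - (norm w)\<^sup>2 / e\<^sup>2)"
  have s: "((\<lambda>w. square_pos (1 - (norm w)\<^sup>2 / e\<^sup>2)) has_derivative (\<lambda>v. - (2 * (w \<bullet> v) / e\<^sup>2) * m)) (at w)"
  proof -
    have "((\<lambda>w. 1 - (norm w)\<^sup>2 / e\<^sup>2) has_derivative (\<lambda>v. - (2 * (w \<bullet> v) / e\<^sup>2))) (at w)"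
      unfolding power2_norm_eq_inner divide_inverse
      by (auto intro!: derivative_eq_intros simp: inner_commute algebra_simps)
    from has_derivative_compose[OF this square_pos_has_derivative[unfolded has_field_derivative_def]]
    show ?thesis by (simp add: m_def mult.commute)
  qed
  have "(regularized_kernel e has_derivative
     (\<lambda>v. - (1 - of_real (square_pos (1 - (norm w)\<^sup>2 / e\<^sup>2))) * (inverse w * v * inverse w) +
          of_real (2 * (w \<bullet> v) / e\<^sup>2 * m) / w)) (at w)"
    unfolding regularized_kernel_def[abs_def]
    by (rule derivative_eq_intros s refl | use w in \<open>simp add: divide_inverse\<close>)+
  from cr_derivative_eqI[OF this]
  have "cr_derivative (regularized_kernel e) w =
     (of_real (2 * (w \<bullet> 1) / e\<^sup>2 * m) / w + \<i> * (of_real (2 * (w \<bullet> \<i>) / e\<^sup>2 * m) / w)) / 2"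
    by (simp add: algebra_simps)
  also have "\<dots> = of_real (m / e\<^sup>2) * ((of_real (w \<bullet> 1) + \<i> * of_real (w \<bullet> \<i>)) / w)"
    by (simp add: add_divide_distrib algebra_simps)
  also have "of_real (w \<bullet> 1) + \<i> * of_real (w \<bullet> \<i>) = w"
    by (simp add: inner_complex_def complex_eq_iff)
  finally show ?thesis using w by (simp add: m_def bump_density_def)
qed

lemma bump_density_nonneg: "bump_density e w \<ge> 0"
  by (simp add: bump_density_def)

lemma bump_density_outside: "e > 0 \<Longrightarrow> w \<notin> ball 0 e \<Longrightarrow> bump_density e w = 0"
proof -
  assume e: "e > 0" and "w \<notin> ball 0 e"
  then have "e\<^sup>2 \<le> (norm w)\<^sup>2" by (intro power_mono) auto
  with e show ?thesis by (simp add: bump_density_def)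
qed

text \<open>The value is \<open>\<pi>\<close> by integrating the areas \<open>\<pi> e\<^sup>2 t\<close> of the sublevel discs \<open>|w|\<^sup>2 < e\<^sup>2 t\<close>.\<close>

lemma nn_integral_bump_density:
  assumes e: "e > 0"
  shows "(\<integral>\<^sup>+w. ennreal (bump_density e w) \<partial>lborel) = ennreal pi"
proof -
  define f where "f w t = ennreal (2 / e\<^sup>2) * indicator {(w, t). norm w < e * sqrt t \<and> 0 \<le> t \<and> t \<le> 1} (w, t)"
    for w :: complex and t :: real
  have [measurable]: "{(w::complex, t). norm w < e * sqrt t \<and> 0 \<le> t \<and> t \<le> 1} \<in> sets (borel \<Otimes>\<^sub>M borel)"
  proof -
    have "{p \<in> space (borel \<Otimes>\<^sub>M borel). norm (fst p :: complex) < e * sqrt (snd p) \<and> 0 \<le> snd p \<and> snd p \<le> 1}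
        \<in> sets (borel \<Otimes>\<^sub>M borel)"
      by measurable
    then show ?thesis by (simp add: space_pair_measure case_prod_unfold)
  qed
  have m: "case_prod f \<in> borel_measurable (lborel \<Otimes>\<^sub>M lborel)"
    unfolding f_def case_prod_beta by measurable
  have sq: "norm w < e * sqrt t \<longleftrightarrow> (norm w)\<^sup>2 / e\<^sup>2 < t" if "t \<ge> 0" for w :: complex and t
  proof -
    have "norm w < e * sqrt t \<longleftrightarrow> (norm w)\<^sup>2 < (e * sqrt t)\<^sup>2"
      using e that by (metis mult_nonneg_nonneg less_imp_le norm_ge_zero power2_less_imp_less power_strict_mono real_sqrt_ge_zero zero_less_numeral)
    also have "\<dots> \<longleftrightarrow> (norm w)\<^sup>2 / e\<^sup>2 < t"
      using e that by (simp add: power_mult_distrib pos_divide_less_eq mult.commute)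
    finally show ?thesis .
  qed
  have "ennreal (bump_density e w) = (\<integral>\<^sup>+t. f w t \<partial>lborel)" for w
  proof -
    have "(\<integral>\<^sup>+t. f w t \<partial>lborel) = (\<integral>\<^sup>+t. ennreal (2 / e\<^sup>2) * indicator {(norm w)\<^sup>2 / e\<^sup>2 <.. 1} t \<partial>lborel)"
    proof (rule nn_integral_cong)
      fix t :: real
      have "t \<ge> 0" if "(norm w)\<^sup>2 / e\<^sup>2 < t"
        using that order_le_less_trans[of 0 "(norm w)\<^sup>2 / e\<^sup>2" t] by simp
      then show "f w t = ennreal (2 / e\<^sup>2) * indicator {(norm w)\<^sup>2 / e\<^sup>2 <.. 1} t"
        using sq[of t w] by (auto simp: f_def indicator_def)
    qed
    also have "\<dots> = ennreal (2 / e\<^sup>2) * emeasure lborel {(norm w)\<^sup>2 / e\<^sup>2 <.. 1}"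
      by (rule nn_integral_cmult_indicator) simp
    also have "emeasure lborel {(norm w)\<^sup>2 / e\<^sup>2 <.. 1} = ennreal (max 0 (1 - (norm w)\<^sup>2 / e\<^sup>2))"
      by (cases "(norm w)\<^sup>2 / e\<^sup>2 \<le> 1") (simp_all add: max_def)
    also have "ennreal (2 / e\<^sup>2) * \<dots> = ennreal (bump_density e w)"
      by (simp add: bump_density_def flip: ennreal_mult)
    finally show ?thesis ..
  qed
  then have "(\<integral>\<^sup>+w. ennreal (bump_density e w) \<partial>lborel) = (\<integral>\<^sup>+w. \<integral>\<^sup>+t. f w t \<partial>lborel \<partial>lborel)"
    by simp
  also have "\<dots> = (\<integral>\<^sup>+t. \<integral>\<^sup>+w. f w t \<partial>lborel \<partial>lborel)"
    by (rule lborel_pair.Fubini'[OF m, symmetric])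
  also have "\<dots> = (\<integral>\<^sup>+t. ennreal (2 * pi * t) * indicator {0..1} t \<partial>lborel)"
  proof (rule nn_integral_cong)
    fix t :: real
    show "(\<integral>\<^sup>+w. f w t \<partial>lborel) = ennreal (2 * pi * t) * indicator {0..1} t"
    proof (cases "t \<in> {0..1}")
      case True
      have "(\<integral>\<^sup>+w. f w t \<partial>lborel) = (\<integral>\<^sup>+w. ennreal (2 / e\<^sup>2) * indicator (ball (0::complex) (e * sqrt t)) w \<partial>lborel)"
        using True by (intro nn_integral_cong) (simp add: f_def indicator_def)
      also have "\<dots> = ennreal (2 / e\<^sup>2) * ennreal (pi * (e * sqrt t)\<^sup>2)"
        using e True by (subst nn_integral_cmult_indicator) (auto simp: emeasure_complex_ball)
      also have "\<dots> = ennreal (2 * pi * t)"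
        using e True by (subst ennreal_mult[symmetric]) (auto simp: power_mult_distrib)
      finally show ?thesis using True by simp
    qed (auto simp: f_def)
  qed
  also have "\<dots> = ennreal (pi * 1\<^sup>2 - pi * 0\<^sup>2)"
    by (rule nn_integral_FTC_Icc[of _ 0 1 "\<lambda>t. pi * t\<^sup>2"]) (auto intro!: derivative_eq_intros)
  finally show ?thesis by simp
qed

lemma bump_density_measurable [measurable]: "bump_density e \<in> borel_measurable borel"
  unfolding bump_density_def[abs_def] by measurable

lemma integrable_bump_density: "e > 0 \<Longrightarrow> integrable lborel (bump_density e)"
  and integral_bump_density: "e > 0 \<Longrightarrow> (LINT w|lborel. bump_density e w) = pi"
proof -
  assume e: "e > 0"
  show "integrable lborel (bump_density e)"
    using nn_integral_bump_density[OF e] bump_density_nonneg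
    by (intro integrableI_nonneg) auto
  show "(LINT w|lborel. bump_density e w) = pi"
    using nn_integral_bump_density[OF e] bump_density_nonneg
    by (subst integral_eq_nn_integral) auto
qed

subsection \<open>The Cauchy-Pompeiu formula\<close>

lemma integrable_continuous_compact_support:
  fixes f :: "'a::euclidean_space \<Rightarrow> complex"
  assumes "continuous_on UNIV f" "compact C" "\<And>w. w \<notin> C \<Longrightarrow> f w = 0"
  shows "integrable lborel f"
proof -
  have "integrable lborel (\<lambda>x. indicator C x *\<^sub>R f x)"
    using assms by (intro borel_integrable_compact) (auto intro: continuous_on_subset)
  also have "(\<lambda>x. indicator C x *\<^sub>R f x) = f"
    using assms(3) by (auto simp: indicator_def)
  finally show ?thesis .
qed

text \<open>The bound does not depend on the position of the singularity; this is what makes the double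
  integral over area and boundary converge absolutely.\<close>

lemma cauchy_kernel_bounded_support:
  fixes f :: "complex \<Rightarrow> complex"
  assumes f [measurable]: "f \<in> borel_measurable borel" and B: "\<And>w. norm (f w) \<le> B"
    and R: "R > 0" and 0: "\<And>w. w \<notin> ball z R \<Longrightarrow> f w = 0"
  shows integrable_cauchy_kernel: "integrable lborel (\<lambda>w. f w / (w - z))"
    and integral_norm_cauchy_kernel_le: "(LINT w|lborel. norm (f w / (w - z))) \<le> B * (4 * pi * R)"
proof -
  have "norm (indicator (ball z R) w / (w - z) :: complex) = indicator (ball z R) w / norm (w - z)" for w
    by (simp add: norm_divide indicator_def)
  then have I: "integrable lborel (\<lambda>w. B * (indicator (ball z R) w / norm (w - z)))"
    using integrable_norm[OF integrable_inverse_ball[of z R]] by (intro integrable_mult_right) simp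
  have "B \<ge> 0" using B[of 0] norm_ge_zero order_trans by blast
  have le: "norm (f w / (w - z)) \<le> B * (indicator (ball z R) w / norm (w - z))" for w
  proof (cases "w \<in> ball z R")
    case True
    then show ?thesis using B[of w] by (simp add: norm_divide divide_right_mono)
  qed (simp add: 0)
  show J: "integrable lborel (\<lambda>w. f w / (w - z))"
  proof (rule Bochner_Integration.integrable_bound[OF I])
    show "AE w in lborel. norm (f w / (w - z)) \<le> norm (B * (indicator (ball z R) w / norm (w - z)))"
      by (rule AE_I2, rule order_trans[OF le]) (simp only: real_norm_def abs_ge_self)
  qed measurable
  have "(LINT w|lborel. norm (f w / (w - z))) \<le> (LINT w|lborel. B * (indicator (ball z R) w / norm (w - z)))"
    by (rule integral_mono[OF integrable_norm[OF J] I le])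
  also have "\<dots> \<le> B * (4 * pi * R)"
    using mult_left_mono[OF integral_inverse_norm_ball_le[OF R, of z] \<open>B \<ge> 0\<close>] by (simp del: times_divide_eq_right)
  finally show "(LINT w|lborel. norm (f w / (w - z))) \<le> B * (4 * pi * R)" .
qed

lemma integral_cr_derivative_eq_0:
  assumes h: "times_differentiable_on 1 h UNIV" and 0: "\<And>w. w \<notin> cball 0 R \<Longrightarrow> h w = 0"
  shows "(LINT w|lborel. cr_derivative h w) = 0"
proof -
  have "frechet_derivative h (at w) v = 0" if "w \<notin> cball 0 R" for w v
    using that by (rule frechet_derivative_outside_support[OF closed_cball _ 0])
  then have "integrable lborel (\<lambda>w. frechet_derivative h (at w) v)" for v
    using h by (intro integrable_continuous_compact_support[of _ "cball 0 R"]) auto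
  then show ?thesis
    using integral_frechet_derivative_eq_0[OF h 0]
    by (simp add: cr_derivative_def[abs_def])
qed

lemma cr_derivative_compact_support:
  assumes u: "times_differentiable_on 1 u UNIV" and C: "compact C" and 0: "\<And>w. w \<notin> C \<Longrightarrow> u w = 0"
  shows cr_derivative_measurable: "cr_derivative u \<in> borel_measurable borel"
    and cr_derivative_eq_0: "w \<notin> C \<Longrightarrow> cr_derivative u w = 0"
    and cr_derivative_bounded: "\<exists>B>0. \<forall>w. norm (cr_derivative u w) \<le> B"
    and integrable_cr_derivative_cauchy_kernel: "integrable lborel (\<lambda>w. cr_derivative u w / (w - z))"
proof -
  have cont: "continuous_on UNIV (cr_derivative u)"
    by (rule cr_derivative_continuous_on[OF u])
  then show m: "cr_derivative u \<in> borel_measurable borel"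
    by (rule borel_measurable_continuous_onI)
  show 0: "cr_derivative u w = 0" if "w \<notin> C" for w
    by (rule cr_derivative_outside_support[OF compact_imp_closed[OF C] that 0])
  have "compact (cr_derivative u ` C)"
    using cont C by (intro compact_continuous_image) (auto intro: continuous_on_subset)
  then have "bounded (cr_derivative u ` C)" by (rule compact_imp_bounded)
  then obtain B where B: "\<forall>w\<in>C. norm (cr_derivative u w) \<le> B"
    by (auto simp: bounded_iff)
  have B: "norm (cr_derivative u w) \<le> max B 1" for w
    using B 0[of w] by (cases "w \<in> C") (auto simp: le_max_iff_disj)
  then show "\<exists>B>0. \<forall>w. norm (cr_derivative u w) \<le> B"
    by (intro exI[of _ "max B 1"]) auto
  obtain R where R: "R > 0" "C \<subseteq> ball z R"
    using bounded_subset_ballD[OF compact_imp_bounded[OF C]] by blast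
  show "integrable lborel (\<lambda>w. cr_derivative u w / (w - z))"
    by (rule integrable_cauchy_kernel[OF m B R(1)], rule 0) (use R(2) in blast)
qed

text \<open>Let \<open>k\<close> be the regularized kernel and \<open>g\<close> the derivative of \<open>u\<close>. The derivative of \<open>u k\<close> has
  integral zero, so \<open>\<integral> g k = - \<integral> u \<partial>k\<close>. As \<open>e\<close> tends to 0, the right hand side tends to
  \<open>- \<pi> u(0)\<close>, because \<open>\<partial>k\<close> has mass \<open>\<pi>\<close> and concentrates at 0, and the left hand side to the integral
  of \<open>g(w) / w\<close>, because the two kernels differ by at most \<open>1 / |w|\<close> on a disc of radius \<open>e\<close>.\<close>

lemma cauchy_pompeiu_compact_support_origin:
  assumes u: "times_differentiable_on 1 u UNIV" and 0: "\<And>w. w \<notin> cball 0 R \<Longrightarrow> u w = 0"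
  shows "(LINT w|lborel. cr_derivative u w / w) = - of_real pi * u 0"
proof -
  define g where "g = cr_derivative u"
  have contg: "continuous_on UNIV g"
    unfolding g_def by (rule cr_derivative_continuous_on[OF u])
  note support = cr_derivative_compact_support[where C = "cball 0 R", OF u compact_cball 0, folded g_def]
  obtain B where B: "B > 0" "\<And>w. norm (g w) \<le> B" using support(3) by blast
  have Ig: "integrable lborel (\<lambda>w. g w / w)" using support(4)[of 0] by simp
  have contu: "continuous_on UNIV u"
    using Ck_continuous[OF u] .
  have um [measurable]: "u \<in> borel_measurable borel"
    using contu by (rule borel_measurable_continuous_onI)
  have "norm ((LINT w|lborel. g w / w) + of_real pi * u 0) \<le> 0 + \<eta>" if \<eta>: "\<eta> > 0" for \<eta>
  proof -
    have "\<eta> / (2 * pi) > 0" using \<eta> by simp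
    then obtain d where d: "d > 0" "\<And>w. norm w < d \<Longrightarrow> norm (u w - u 0) < \<eta> / (2 * pi)"
      using contu unfolding continuous_on_iff by (metis UNIV_I dist_0_norm dist_commute dist_norm)
    \<comment> \<open>This \<open>e\<close> makes the error of either side at most \<open>\<eta> / 2\<close>.\<close>
    define e where "e = min d (\<eta> / (8 * pi * B))"
    have e: "e > 0" "e \<le> d" "e \<le> \<eta> / (8 * pi * B)"
      using d \<eta> B(1) by (auto simp: e_def)
    define k where "k = regularized_kernel e"
    have k: "times_differentiable_on 1 k UNIV"
      unfolding k_def by (rule regularized_kernel_times_differentiable_on[OF e(1)])
    have contk: "continuous_on UNIV k" "continuous_on UNIV (cr_derivative k)"
      using Ck_continuous[OF k] cr_derivative_continuous_on[OF k] by auto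
    have Iuk: "integrable lborel (\<lambda>w. u w * cr_derivative k w)"
      using 0 contu contk by (intro integrable_continuous_compact_support[of _ "cball 0 R"]) (auto intro!: continuous_intros)
    have Igk: "integrable lborel (\<lambda>w. g w * k w)"
      using support(2) contg contk by (intro integrable_continuous_compact_support[of _ "cball 0 R"]) (auto intro!: continuous_intros)
    have "cr_derivative (\<lambda>w. u w * k w) w = u w * cr_derivative k w + g w * k w" for w
      unfolding g_def using u k by (intro cr_derivative_mult) auto
    moreover have "times_differentiable_on 1 (\<lambda>w. u w * k w) UNIV"
      by (rule Ck_mult[OF open_UNIV u k])
    then have "(LINT w|lborel. cr_derivative (\<lambda>w. u w * k w) w) = 0"
      by (rule integral_cr_derivative_eq_0[where R = R]) (use 0 in auto)
    ultimately have sum0: "(LINT w|lborel. u w * cr_derivative k w) + (LINT w|lborel. g w * k w) = 0"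
      using Iuk Igk by simp
    have AEk: "AE w in lborel. u w * cr_derivative k w = u w * of_real (bump_density e w)"
      using AE_lborel_singleton[of "0::complex"]
      by eventually_elim (simp add: k_def cr_derivative_regularized_kernel)
    have Iub: "integrable lborel (\<lambda>w. u w * of_real (bump_density e w))"
      by (rule integrable_cong_AE_imp[OF Iuk]) (use AEk in auto)
    have eq1: "(LINT w|lborel. u w * cr_derivative k w) = (LINT w|lborel. u w * of_real (bump_density e w))"
      by (rule integral_cong_AE) (use Iuk Iub AEk in auto)
    have Ib: "integrable lborel (\<lambda>w. of_real (bump_density e w) :: complex)"
      using integrable_bump_density[OF e(1)] by (rule integrable_of_real)
    have "norm ((LINT w|lborel. u w * of_real (bump_density e w)) - of_real pi * u 0) =
        norm (LINT w|lborel. u w * of_real (bump_density e w) - u 0 * of_real (bump_density e w))"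
      using Iub Ib integral_bump_density[OF e(1)] by (simp add: mult.commute)
    also have "\<dots> \<le> (LINT w|lborel. (\<eta> / (2 * pi)) * bump_density e w)"
    proof (rule Bochner_Integration.integral_norm_bound_integral)
      show "norm (u w * of_real (bump_density e w) - u 0 * of_real (bump_density e w)) \<le> \<eta> / (2 * pi) * bump_density e w" for w
      proof (cases "w \<in> ball 0 e")
        case True
        then have "norm (u w - u 0) \<le> \<eta> / (2 * pi)" using d(2)[of w] e(2) by auto
        then have "norm (u w - u 0) * bump_density e w \<le> \<eta> / (2 * pi) * bump_density e w"
          by (rule mult_right_mono[OF _ bump_density_nonneg])
        then show ?thesis using bump_density_nonneg[of e w]
          by (simp add: norm_mult flip: left_diff_distrib)
      qed (simp add: bump_density_outside[OF e(1)])
    qed (use Iub Ib integrable_bump_density[OF e(1)] in auto)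
    also have "\<dots> = \<eta> / 2" using integral_bump_density[OF e(1)] by simp
    finally have b1: "norm ((LINT w|lborel. u w * of_real (bump_density e w)) - of_real pi * u 0) \<le> \<eta> / 2" .
    have "norm (indicator (ball 0 e) w / (w - 0) :: complex) = indicator (ball 0 e) w / norm w" for w
      by (simp add: norm_divide indicator_def)
    then have Ie: "integrable lborel (\<lambda>w::complex. B * (indicator (ball 0 e) w / norm w))"
      using integrable_norm[OF integrable_inverse_ball[of 0 e]] by (intro integrable_mult_right) simp
    have "norm ((LINT w|lborel. g w / w) - (LINT w|lborel. g w * k w)) =
        norm (LINT w|lborel. g w / w - g w * k w)"
      using Ig Igk by simp
    also have "\<dots> \<le> (LINT w|lborel. B * (indicator (ball 0 e) (w::complex) / norm w))"
    proof (rule Bochner_Integration.integral_norm_bound_integral)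
      fix w :: complex
      define s where "s = square_pos (1 - (norm w)\<^sup>2 / e\<^sup>2)"
      have "g w / w - g w * k w = g w * of_real s / w"
        by (simp add: k_def regularized_kernel_def s_def divide_simps) (simp add: algebra_simps)
      then have "norm (g w / w - g w * k w) = norm (g w) * (\<bar>s\<bar> / norm w)"
        by (simp add: norm_mult norm_divide)
      also have "\<dots> \<le> B * (indicator (ball 0 e) w / norm w)"
      proof (rule mult_mono)
        have "\<bar>s\<bar> \<le> indicator (ball 0 e) w"
        proof (cases "w \<in> ball 0 e")
          case True
          have "max 0 (1 - (norm w)\<^sup>2 / e\<^sup>2) \<le> 1" by simp
          then have "(max 0 (1 - (norm w)\<^sup>2 / e\<^sup>2))\<^sup>2 \<le> 1" by (intro power_le_one) auto
          then show ?thesis using True by (simp add: s_def square_pos_def)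
        next
          case False
          then have "e\<^sup>2 \<le> (norm w)\<^sup>2" using e(1) by (intro power_mono) auto
          then show ?thesis using e(1) by (simp add: s_def square_pos_def)
        qed
        then show "\<bar>s\<bar> / norm w \<le> indicator (ball 0 e) w / norm w"
          by (rule divide_right_mono) simp
      qed (use B less_imp_le in auto)
      finally show "norm (g w / w - g w * k w) \<le> B * (indicator (ball 0 e) w / norm w)" .
    qed (use Ig Igk Ie in auto)
    also have "\<dots> \<le> B * (4 * pi * e)"
      using mult_left_mono[OF integral_inverse_norm_ball_le[OF e(1), of 0], of B] B(1) by (simp del: times_divide_eq_right)
    also have "\<dots> \<le> B * (4 * pi * (\<eta> / (8 * pi * B)))"
      using e(3) B(1) by (intro mult_left_mono) auto
    also have "\<dots> = \<eta> / 2" using B(1) by simp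
    finally have b2: "norm ((LINT w|lborel. g w / w) - (LINT w|lborel. g w * k w)) \<le> \<eta> / 2" .
    have "(LINT w|lborel. g w / w) + of_real pi * u 0 =
       ((LINT w|lborel. g w / w) - (LINT w|lborel. g w * k w)) -
       ((LINT w|lborel. u w * of_real (bump_density e w)) - of_real pi * u 0)"
      using sum0 eq1 by (simp add: algebra_simps add_eq_0_iff)
    also have "norm \<dots> \<le> \<eta> / 2 + \<eta> / 2"
      by (rule order_trans[OF norm_triangle_ineq4 add_mono[OF b2 b1]])
    finally show ?thesis by simp
  qed
  then have "norm ((LINT w|lborel. g w / w) + of_real pi * u 0) \<le> 0"
    by (rule field_le_epsilon)
  then show ?thesis by (simp add: g_def add_eq_0_iff2)
qed

lemma cr_derivative_translate:
  assumes "u differentiable (at (z + w))"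
  shows "cr_derivative (\<lambda>w. u (z + w)) w = cr_derivative u (z + w)"
proof -
  have "((\<lambda>w. u (z + w)) has_derivative frechet_derivative u (at (z + w))) (at w)"
    by (rule has_derivative_compose[of "\<lambda>w. z + w" "\<lambda>v. v"])
      (use assms in \<open>auto intro!: derivative_eq_intros simp: frechet_derivative_works\<close>)
  from cr_derivative_eqI[OF this] show ?thesis by (simp add: cr_derivative_def)
qed

lemma integral_translate:
  fixes f :: "complex \<Rightarrow> complex"
  assumes [measurable]: "f \<in> borel_measurable borel"
  shows "(LINT w|lborel. f (z + w)) = (LINT w|lborel. f w)"
proof -
  have "(LINT w|lborel. f (z + w)) = (LINT w|distr lborel borel ((+) z). f w)"
    by (subst integral_distr) auto
  then show ?thesis by (simp add: lborel_distr_plus)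
qed

lemma cauchy_pompeiu_compact_support:
  assumes u: "times_differentiable_on 1 u UNIV" and C: "compact C" and 0: "\<And>w. w \<notin> C \<Longrightarrow> u w = 0"
  shows "(LINT w|lborel. cr_derivative u w / (w - z)) = - of_real pi * u z"
proof -
  obtain R where R: "R > 0" "C \<subseteq> ball 0 R"
    using bounded_subset_ballD[OF compact_imp_bounded[OF C]] by blast
  have "times_differentiable_on 1 (\<lambda>w. u (z + w)) UNIV"
    by (rule Ck_compose_affine[OF open_UNIV open_UNIV u, where L = "\<lambda>v. v"])
      (auto intro!: derivative_eq_intros)
  moreover have "u (z + w) = 0" if "w \<notin> cball 0 (R + norm z)" for w
  proof -
    have "norm w \<le> norm (z + w) + norm z"
      using norm_triangle_ineq4[of "z + w" z] by simp
    with that R show ?thesis by (intro 0) auto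
  qed
  ultimately have "(LINT w|lborel. cr_derivative (\<lambda>w. u (z + w)) w / w) = - of_real pi * u (z + 0)"
    by (rule cauchy_pompeiu_compact_support_origin[where R = "R + norm z"])
  moreover have "cr_derivative (\<lambda>w. u (z + w)) w = cr_derivative u (z + w)" for w
    by (rule cr_derivative_translate) (use u in simp)
  moreover have "(LINT w|lborel. cr_derivative u (z + w) / ((z + w) - z)) = (LINT w|lborel. cr_derivative u w / (w - z))"
  proof (rule integral_translate)
    note [measurable] = cr_derivative_measurable[OF u C 0]
    show "(\<lambda>w. cr_derivative u w / (w - z)) \<in> borel_measurable borel" by measurable
  qed
  ultimately show ?thesis by simp
qed

section \<open>Integration over piecewise smooth curves\<close>

text \<open>Only the values on \<open>[0,1]\<close> of a path are of interest; the constant extension makes it continuous,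
  hence measurable, on the whole line.\<close>

definition clamped_path :: "(real \<Rightarrow> complex) \<Rightarrow> real \<Rightarrow> complex" where
  "clamped_path \<gamma> t = \<gamma> (max 0 (min 1 t))"

lemma clamped_path_in_image: "clamped_path \<gamma> t \<in> path_image \<gamma>"
  by (auto simp: clamped_path_def path_image_def)

lemma clamped_path_measurable:
  assumes "path \<gamma>"
  shows "clamped_path \<gamma> \<in> borel_measurable borel"
proof -
  have "continuous_on UNIV (\<lambda>t. \<gamma> (max 0 (min 1 t)))"
    using assms unfolding path_def
    by (rule continuous_on_compose2) (auto intro!: continuous_intros)
  then show ?thesis
    unfolding clamped_path_def[abs_def] by (rule borel_measurable_continuous_onI)
qed

text \<open>The bound on the derivative holds because every piece is continuously differentiable up to its
  end points, and there are finitely many pieces.\<close>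

lemma piecewise_smooth_path_breakpoints:
  assumes "piecewise_smooth_path \<gamma>"
  obtains S B where "finite S" "{0, 1} \<subseteq> S" "S \<subseteq> {0..1}" "\<gamma> C1_differentiable_on ({0..1} - S)"
    "\<And>t. t \<in> {0..1} - S \<Longrightarrow> norm (vector_derivative \<gamma> (at t)) \<le> B"
proof -
  obtain S where S: "finite S" "{0, 1} \<subseteq> S" "S \<subseteq> {0..1}"
    and pieces: "\<forall>a\<in>S. \<forall>b\<in>S. a < b \<and> {a<..<b} \<inter> S = {} \<longrightarrow>
           (\<exists>g. (\<forall>t\<in>{a..b}. g t = \<gamma> t) \<and> g C1_differentiable_on {a..b} \<and>
                (\<forall>t\<in>{a..b}. vector_derivative g (at t) \<noteq> 0))"
    using assms unfolding piecewise_smooth_path_def by (elim exE conjE) (rule that)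
  have vd: "\<exists>B. \<forall>t\<in>{a<..<b}. norm (vector_derivative \<gamma> (at t)) \<le> B"
    and d: "\<And>t. t \<in> {a<..<b} \<Longrightarrow> \<gamma> differentiable (at t)"
    and c: "continuous_on {a<..<b} (\<lambda>t. vector_derivative \<gamma> (at t))"
    if ab: "a \<in> S" "b \<in> S" "a < b" "{a<..<b} \<inter> S = {}" for a b
  proof -
    have "a < b \<and> {a<..<b} \<inter> S = {}" using ab by simp
    from pieces[rule_format, OF ab(1,2) this]
    obtain g where g': "\<forall>t\<in>{a..b}. g t = \<gamma> t" and C1: "g C1_differentiable_on {a..b}"
      by (elim exE conjE) (rule that)
    note g = bspec[OF g'] C1
    have D: "(\<gamma> has_vector_derivative vector_derivative g (at t)) (at t)" if "t \<in> {a<..<b}" for t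
    proof (rule has_vector_derivative_transform_within_open[where S = "{a<..<b}"])
      show "(g has_vector_derivative vector_derivative g (at t)) (at t)"
        using g(2) that by (auto simp: C1_differentiable_on_eq vector_derivative_works[symmetric])
    qed (use that g in auto)
    then have eq: "vector_derivative \<gamma> (at t) = vector_derivative g (at t)" if "t \<in> {a<..<b}" for t
      using that by (simp add: vector_derivative_at)
    have cg: "continuous_on {a..b} (\<lambda>t. vector_derivative g (at t))"
      using g(2) by (auto simp: C1_differentiable_on_eq)
    then have "bounded ((\<lambda>t. vector_derivative g (at t)) ` {a..b})"
      by (intro compact_imp_bounded compact_continuous_image) auto
    then obtain B where "\<forall>t\<in>{a..b}. norm (vector_derivative g (at t)) \<le> B"
      by (auto simp: bounded_iff)
    then show "\<exists>B. \<forall>t\<in>{a<..<b}. norm (vector_derivative \<gamma> (at t)) \<le> B"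
      using eq by (intro exI[of _ B]) auto
    show "\<gamma> differentiable (at t)" if "t \<in> {a<..<b}" for t
      using D[OF that] by (auto simp: has_vector_derivative_def differentiable_def)
    have "continuous_on {a<..<b} (\<lambda>t. vector_derivative g (at t))"
      using cg continuous_on_subset[of _ _ "{a<..<b}"] by force
    then show "continuous_on {a<..<b} (\<lambda>t. vector_derivative \<gamma> (at t))"
      by (rule continuous_on_eq) (use eq in simp)
  qed
  define adj where "adj = {(a, b). a \<in> S \<and> b \<in> S \<and> a < b \<and> {a<..<b} \<inter> S = {}}"
  have adj_fin: "finite adj"
    by (rule finite_subset[of _ "S \<times> S"]) (use S in \<open>auto simp: adj_def\<close>)
  have "\<exists>B. \<forall>t\<in>{fst ab<..<snd ab}. norm (vector_derivative \<gamma> (at t)) \<le> B" if "ab \<in> adj" for ab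
    using that vd by (auto simp: adj_def)
  then obtain Bf where Bf: "\<And>ab t. ab \<in> adj \<Longrightarrow> t \<in> {fst ab<..<snd ab} \<Longrightarrow> norm (vector_derivative \<gamma> (at t)) \<le> Bf ab"
    by metis
  define B where "B = (\<Sum>ab\<in>adj. \<bar>Bf ab\<bar>)"
  have piece: "\<exists>ab\<in>adj. t \<in> {fst ab<..<snd ab}" if t: "t \<in> {0..1} - S" for t
  proof -
    define a where "a = Max {s \<in> S. s < t}"
    define b where "b = Min {s \<in> S. t < s}"
    have t01: "0 < t" "t < 1" using t S by (auto simp: less_le)
    have fin: "finite {s \<in> S. s < t}" "finite {s \<in> S. t < s}" using S by auto
    have ne: "{s \<in> S. s < t} \<noteq> {}" "{s \<in> S. t < s} \<noteq> {}" using S t01 by auto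
    have a: "a \<in> S" "a < t" using Max_in[OF fin(1) ne(1)] by (auto simp: a_def)
    have b: "b \<in> S" "t < b" using Min_in[OF fin(2) ne(2)] by (auto simp: b_def)
    have "s \<le> a \<or> s = t \<or> b \<le> s" if "s \<in> S" for s
      using Max_ge[OF fin(1), of s] Min_le[OF fin(2), of s] that
      by (cases s t rule: linorder_cases) (auto simp: a_def b_def)
    with t have "{a<..<b} \<inter> S = {}" by force
    with a b show ?thesis by (intro bexI[of _ "(a, b)"]) (auto simp: adj_def)
  qed
  show ?thesis
  proof (rule that[OF S])
    show "\<gamma> C1_differentiable_on {0..1} - S"
      unfolding C1_differentiable_on_eq
    proof (intro conjI ballI)
      show "\<gamma> differentiable at t" if "t \<in> {0..1} - S" for t
        using piece[OF that] d by (auto simp: adj_def)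
      show "continuous_on ({0..1} - S) (\<lambda>t. vector_derivative \<gamma> (at t))"
      proof (rule continuous_at_imp_continuous_on, rule ballI)
        fix t assume "t \<in> {0..1} - S"
        then obtain a b where ab: "(a, b) \<in> adj" "t \<in> {a<..<b}" using piece by fastforce
        then have "continuous_on {a<..<b} (\<lambda>t. vector_derivative \<gamma> (at t))"
          using c by (auto simp: adj_def)
        then show "isCont (\<lambda>t. vector_derivative \<gamma> (at t)) t"
          using ab(2) continuous_on_eq_continuous_at open_greaterThanLessThan by blast
      qed
    qed
    show "norm (vector_derivative \<gamma> (at t)) \<le> B" if t: "t \<in> {0..1} - S" for t
    proof -
      obtain ab where ab: "ab \<in> adj" "t \<in> {fst ab<..<snd ab}" using piece[OF t] by blast
      have "norm (vector_derivative \<gamma> (at t)) \<le> \<bar>Bf ab\<bar>" using Bf[OF ab] by simp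
      also have "\<dots> \<le> B"
        unfolding B_def using ab(1) adj_fin by (intro member_le_sum) auto
      finally show ?thesis .
    qed
  qed
qed

lemma piecewise_smooth_path_imp_valid_path:
  assumes "piecewise_smooth_path \<gamma>" "path \<gamma>"
  shows "valid_path \<gamma>"
proof -
  obtain S B where "finite S" "\<gamma> C1_differentiable_on ({0..1} - S)"
    using piecewise_smooth_path_breakpoints[OF assms(1)] by metis
  then show ?thesis
    using assms(2) unfolding valid_path_def piecewise_C1_differentiable_on_def path_def by blast
qed

lemma piecewise_smooth_path_null_image:
  assumes "piecewise_smooth_path \<gamma>" "path \<gamma>"
  shows "AE w in lborel. w \<notin> path_image \<gamma>"
proof -
  obtain S B where S: "finite S" "S \<subseteq> {0..1}" "\<gamma> C1_differentiable_on ({0..1} - S)"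
    using piecewise_smooth_path_breakpoints[OF assms(1)] by metis
  have "\<gamma> differentiable_on ({0..1} - S)"
    using S(3) by (auto simp: C1_differentiable_on_eq differentiable_on_def differentiable_at_withinI)
  then have "negligible (\<gamma> ` ({0..1} - S))"
    by (intro negligible_differentiable_image_lowdim) auto
  moreover have "negligible (\<gamma> ` S)"
    using S(1) by (simp add: negligible_finite)
  moreover have "path_image \<gamma> = \<gamma> ` ({0..1} - S) \<union> \<gamma> ` S"
    using S(2) by (auto simp: path_image_def)
  ultimately have "negligible (path_image \<gamma>)"
    using negligible_Un by metis
  moreover have "path_image \<gamma> \<in> sets borel"
    using compact_path_image[OF assms(2)] by (simp add: borel_compact)
  ultimately have "path_image \<gamma> \<in> null_sets lborel"
    by (simp add: negligible_iff_null_sets null_sets_completion_iff)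
  then show ?thesis by (rule AE_not_in)
qed

text \<open>A contour integral becomes a Lebesgue integral over the line against an integrable density, the
  speed vector, which vanishes off \<open>[0,1]\<close> and at the corners.\<close>

lemma piecewise_smooth_path_density:
  assumes "piecewise_smooth_path \<gamma>" "path \<gamma>"
  obtains \<kappa> where "integrable lborel \<kappa>"
    "\<And>f. continuous_on (path_image \<gamma>) f \<Longrightarrow> integrable lborel (\<lambda>t. \<kappa> t * f (clamped_path \<gamma> t))"
    "\<And>f. continuous_on (path_image \<gamma>) f \<Longrightarrow>
       contour_integral \<gamma> f = (LINT t|lborel. \<kappa> t * f (clamped_path \<gamma> t))"
proof -
  obtain S B where S: "finite S" "{0, 1} \<subseteq> S" "S \<subseteq> {0..1}" and C1: "\<gamma> C1_differentiable_on ({0..1} - S)"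
    and B: "\<And>t. t \<in> {0..1} - S \<Longrightarrow> norm (vector_derivative \<gamma> (at t)) \<le> B"
    using piecewise_smooth_path_breakpoints[OF assms(1)] by metis
  define \<kappa> where "\<kappa> t = indicator ({0..1} - S) t *\<^sub>R vector_derivative \<gamma> (at t)" for t
  have [measurable]: "\<kappa> \<in> borel_measurable borel"
    unfolding \<kappa>_def[abs_def]
  proof (rule borel_measurable_continuous_on_indicator)
    show "{0..1} - S \<in> sets borel" using S(1) by (auto intro: borel_closed finite_imp_closed)
    show "continuous_on ({0..1} - S) (\<lambda>t. vector_derivative \<gamma> (at t))"
      using C1 by (simp add: C1_differentiable_on_eq)
  qed
  have \<kappa>: "integrable lborel \<kappa>"
  proof (rule Bochner_Integration.integrable_bound)
    show "integrable lborel (\<lambda>t. indicator {0..1::real} t *\<^sub>R \<bar>B\<bar> :: real)"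
      by (rule integrable_indicator) (simp_all add: emeasure_lborel_Icc_eq)
    show "AE t in lborel. norm (\<kappa> t) \<le> norm (indicator {0..1::real} t *\<^sub>R \<bar>B\<bar> :: real)"
    proof (rule AE_I2)
      fix t :: real
      show "norm (\<kappa> t) \<le> norm (indicator {0..1::real} t *\<^sub>R \<bar>B\<bar> :: real)"
        using B[of t] by (cases "t \<in> {0..1} - S") (auto simp: \<kappa>_def)
    qed
  qed measurable
  have int: "integrable lborel (\<lambda>t. \<kappa> t * f (clamped_path \<gamma> t))" if f: "continuous_on (path_image \<gamma>) f" for f :: "complex \<Rightarrow> complex"
  proof -
    have "continuous_on (UNIV \<times> path_image \<gamma>) (\<lambda>q. f (snd q))"
      by (rule continuous_on_compose2[OF f]) (auto intro!: continuous_intros)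
    then have "integrable lborel (\<lambda>t. \<kappa> t * (\<lambda>q. f (snd q)) (0::real, clamped_path \<gamma> t))"
      by (rule parametric_integrable[rotated 6, where U = UNIV and K = "path_image \<gamma>"])
        (use \<kappa> assms clamped_path_measurable[OF assms(2)] in \<open>auto simp: clamped_path_in_image compact_path_image\<close>)
    then show ?thesis by simp
  qed
  show ?thesis
  proof (rule that[OF \<kappa> int])
    fix f :: "complex \<Rightarrow> complex" assume f: "continuous_on (path_image \<gamma>) f"
    have "((\<lambda>t. \<kappa> t * f (clamped_path \<gamma> t)) has_integral (LINT t|lborel. \<kappa> t * f (clamped_path \<gamma> t))) UNIV"
      by (rule has_integral_integral_lborel[OF int[OF f]])
    then have "((\<lambda>t. if t \<in> {0..1} then \<kappa> t * f (clamped_path \<gamma> t) else 0) has_integral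
        (LINT t|lborel. \<kappa> t * f (clamped_path \<gamma> t))) UNIV"
      by (rule has_integral_eq[rotated]) (auto simp: \<kappa>_def)
    then have "((\<lambda>t. \<kappa> t * f (clamped_path \<gamma> t)) has_integral (LINT t|lborel. \<kappa> t * f (clamped_path \<gamma> t))) {0..1}"
      by (simp only: has_integral_restrict_UNIV)
    then have "((\<lambda>t. f (\<gamma> t) * vector_derivative \<gamma> (at t within {0..1})) has_integral
       (LINT t|lborel. \<kappa> t * f (clamped_path \<gamma> t))) {0..1}"
    proof (rule has_integral_spike_finite[OF S(1), rotated])
      fix t assume t: "t \<in> {0..1} - S"
      then have "(\<gamma> has_vector_derivative vector_derivative \<gamma> (at t)) (at t)"
        using C1 by (auto simp: C1_differentiable_on_eq vector_derivative_works[symmetric])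
      then have "vector_derivative \<gamma> (at t within {0..1}) = vector_derivative \<gamma> (at t)"
        using t by (intro vector_derivative_at_within_ivl) auto
      then show "f (\<gamma> t) * vector_derivative \<gamma> (at t within {0..1}) = \<kappa> t * f (clamped_path \<gamma> t)"
        using t by (simp add: \<kappa>_def clamped_path_def)
    qed
    then show "contour_integral \<gamma> f = (LINT t|lborel. \<kappa> t * f (clamped_path \<gamma> t))"
      by (intro contour_integral_unique) (simp add: has_contour_integral_def)
  qed
qed

section \<open>The Cauchy-Pompeiu formula on piecewise smooth domains\<close>

text \<open>The function \<open>u\<close> is a superposition of Cauchy kernels by the formula for compact support, and for
  the kernel itself the contour integral is the winding number because
  \<open>1 / ((w - \<zeta>) (\<zeta> - z)) = (1 / (\<zeta> - z) - 1 / (\<zeta> - w)) / (w - z)\<close>. The winding number about points of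
  the curve has no meaning, so the inner integral \<open>h\<close> is described almost everywhere only.\<close>

lemma contour_integral_cauchy_kernel_compact_support:
  assumes \<gamma>: "piecewise_smooth_path \<gamma>" "path \<gamma>" and z: "z \<notin> path_image \<gamma>"
    and u: "times_differentiable_on 1 u UNIV" and C: "compact C" and 0: "\<And>w. w \<notin> C \<Longrightarrow> u w = 0"
  obtains h where "integrable lborel h"
    "AE w in lborel. h w = cr_derivative u w / (w - z) * (winding_number \<gamma> z - winding_number \<gamma> w)"
    "contour_integral \<gamma> (\<lambda>\<zeta>. u \<zeta> / (\<zeta> - z)) = - 2 * \<i> * (LINT w|lborel. h w)"
proof -
  obtain \<kappa> where \<kappa>: "integrable lborel \<kappa>"
    and int: "\<And>f. continuous_on (path_image \<gamma>) f \<Longrightarrow> integrable lborel (\<lambda>t. \<kappa> t * f (clamped_path \<gamma> t))"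
    and ci: "\<And>f. continuous_on (path_image \<gamma>) f \<Longrightarrow>
       contour_integral \<gamma> f = (LINT t|lborel. \<kappa> t * f (clamped_path \<gamma> t))"
    using piecewise_smooth_path_density[OF \<gamma>(1,2)] by metis
  define p where "p = clamped_path \<gamma>"
  define g where "g = cr_derivative u"
  note support = cr_derivative_compact_support[OF u C 0, folded g_def]
  note [measurable] = support(1)
  have [measurable]: "p \<in> borel_measurable borel"
    unfolding p_def by (rule clamped_path_measurable[OF \<gamma>(2)])
  have [measurable]: "\<kappa> \<in> borel_measurable borel"
    using borel_measurable_integrable[OF \<kappa>] by simp
  obtain B where B: "\<And>w. norm (g w) \<le> B" using support(3) by blast
  have "bounded (C \<union> path_image \<gamma>)"
    using compact_imp_bounded[OF C] compact_imp_bounded[OF compact_path_image[OF \<gamma>(2)]] by simp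
  then obtain R where R: "R > 0" "C \<union> path_image \<gamma> \<subseteq> ball 0 R"
    using bounded_subset_ballD by blast
  have pI: "p t \<in> path_image \<gamma>" for t
    unfolding p_def by (rule clamped_path_in_image)
  have out: "g w = 0" if "w \<notin> ball (p t) (2 * R)" for w t
  proof (rule support(2))
    have "p t \<in> ball 0 R" using pI[of t] R(2) by blast
    then have "norm (p t) < R" by simp
    moreover have "2 * R \<le> norm (p t - w)" using that by (simp add: dist_norm)
    ultimately have "\<not> norm w < R" using norm_triangle_ineq4[of "p t" w] by linarith
    then show "w \<notin> C" using R(2) by auto
  qed
  have twoR: "2 * R > 0" using R by simp
  have Ig: "integrable lborel (\<lambda>w. g w / (w - p t))" for t
    by (rule integrable_cauchy_kernel[OF _ B twoR out]) auto
  have cz: "continuous_on (path_image \<gamma>) (\<lambda>\<zeta>. 1 / (\<zeta> - z))"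
    using z by (auto intro!: continuous_intros)
  have cuz: "continuous_on (path_image \<gamma>) (\<lambda>\<zeta>. u \<zeta> / (\<zeta> - z))"
    using z Ck_continuous[OF u] by (auto intro!: continuous_intros intro: continuous_on_subset)
  define F where "F t w = \<kappa> t * (1 / (p t - z)) * (g w / (w - p t))" for t w
  have F: "integrable (lborel \<Otimes>\<^sub>M lborel) (case_prod F)"
  proof (rule lborel_pair.Fubini_integrable)
    show "case_prod F \<in> borel_measurable (lborel \<Otimes>\<^sub>M lborel)"
      unfolding F_def case_prod_beta by measurable
    show "AE t in lborel. integrable lborel (\<lambda>w. case_prod F (t, w))"
      by (simp only: F_def prod.case) (intro AE_I2 integrable_mult_right Ig)
    show "integrable lborel (\<lambda>t. LINT w|lborel. norm (case_prod F (t, w)))"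
    proof (rule Bochner_Integration.integrable_bound)
      show "integrable lborel (\<lambda>t. norm (\<kappa> t * (1 / (p t - z))) * (B * (4 * pi * (2 * R))))"
        using integrable_norm[OF int[OF cz]] by (intro integrable_mult_left) (simp add: p_def)
      show "(\<lambda>t. LINT w|lborel. norm (case_prod F (t, w))) \<in> borel_measurable lborel"
        unfolding F_def case_prod_beta by measurable
      show "AE t in lborel. norm (LINT w|lborel. norm (case_prod F (t, w))) \<le>
          norm (norm (\<kappa> t * (1 / (p t - z))) * (B * (4 * pi * (2 * R))))"
      proof (rule AE_I2)
        fix t :: real
        have "(LINT w|lborel. norm (case_prod F (t, w))) =
            norm (\<kappa> t * (1 / (p t - z))) * (LINT w|lborel. norm (g w / (w - p t)))"
          by (simp only: F_def prod.case norm_mult integral_mult_right_zero)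
        also have "\<dots> \<le> norm (\<kappa> t * (1 / (p t - z))) * (B * (4 * pi * (2 * R)))"
          by (intro mult_left_mono integral_norm_cauchy_kernel_le[OF _ B twoR out]) auto
        finally have le: "(LINT w|lborel. norm (case_prod F (t, w))) \<le> \<dots>" .
        have "0 \<le> (LINT w|lborel. norm (case_prod F (t, w)))" by (rule Bochner_Integration.integral_nonneg) simp
        with le show "norm (LINT w|lborel. norm (case_prod F (t, w))) \<le>
          norm (norm (\<kappa> t * (1 / (p t - z))) * (B * (4 * pi * (2 * R))))"
          by (simp only: real_norm_def abs_of_nonneg)
      qed
    qed
  qed
  have inner_w: "(LINT w|lborel. F t w) = - of_real pi * (\<kappa> t * (u (p t) / (p t - z)))" for t
    unfolding F_def g_def integral_mult_right_zero
    by (simp add: cauchy_pompeiu_compact_support[OF u C 0, of "p t"])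
  have wn: "(LINT t|lborel. \<kappa> t * (1 / (p t - v))) = 2 * of_real pi * \<i> * winding_number \<gamma> v"
    and iv: "integrable lborel (\<lambda>t. \<kappa> t * (1 / (p t - v)))" if "v \<notin> path_image \<gamma>" for v
  proof -
    have cv: "continuous_on (path_image \<gamma>) (\<lambda>\<zeta>. 1 / (\<zeta> - v))"
      using that by (auto intro!: continuous_intros)
    show "integrable lborel (\<lambda>t. \<kappa> t * (1 / (p t - v)))"
      using int[OF cv] by (simp add: p_def)
    show "(LINT t|lborel. \<kappa> t * (1 / (p t - v))) = 2 * of_real pi * \<i> * winding_number \<gamma> v"
      using ci[OF cv] winding_number_valid_path[OF piecewise_smooth_path_imp_valid_path[OF \<gamma>(1,2)] that]
      by (simp add: p_def)
  qed
  have inner_t: "(LINT t|lborel. F t w) =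
      2 * of_real pi * \<i> * (g w / (w - z) * (winding_number \<gamma> z - winding_number \<gamma> w))"
    if w: "w \<notin> path_image \<gamma>" "w \<noteq> z" for w
  proof -
    have "F t w = g w / (w - z) * (\<kappa> t * (1 / (p t - z)) - \<kappa> t * (1 / (p t - w)))" for t
    proof -
      have "p t \<noteq> z" "p t \<noteq> w" using pI[of t] z w by auto
      then show ?thesis using w(2) by (simp add: F_def divide_simps) (simp add: algebra_simps)
    qed
    then have "(LINT t|lborel. F t w) = g w / (w - z) *
        (LINT t|lborel. \<kappa> t * (1 / (p t - z)) - \<kappa> t * (1 / (p t - w)))"
      by (simp only: integral_mult_right_zero)
    also have "(LINT t|lborel. \<kappa> t * (1 / (p t - z)) - \<kappa> t * (1 / (p t - w))) =
        2 * of_real pi * \<i> * (winding_number \<gamma> z - winding_number \<gamma> w)"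
      by (simp only: Bochner_Integration.integral_diff[OF iv[OF z] iv[OF w(1)]] wn[OF z] wn[OF w(1)] right_diff_distrib)
    finally show ?thesis by simp
  qed
  define h where "h w = (LINT t|lborel. F t w) / (2 * of_real pi * \<i>)" for w
  show ?thesis
  proof (rule that[of h])
    show "integrable lborel h"
      unfolding h_def using lborel_pair.integrable_snd[OF F] by simp
    have "AE w in lborel. (LINT t|lborel. F t w) =
        2 * of_real pi * \<i> * (g w / (w - z) * (winding_number \<gamma> z - winding_number \<gamma> w))"
      using piecewise_smooth_path_null_image[OF \<gamma>(1,2)] AE_lborel_singleton[of z]
      by eventually_elim (rule inner_t)
    then show "AE w in lborel. h w =
        cr_derivative u w / (w - z) * (winding_number \<gamma> z - winding_number \<gamma> w)"
      by eventually_elim (simp add: h_def g_def)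
    have "(LINT w|lborel. LINT t|lborel. F t w) = (LINT t|lborel. LINT w|lborel. F t w)"
      by (rule lborel_pair.Fubini_integral[OF F])
    also have "\<dots> = - of_real pi * contour_integral \<gamma> (\<lambda>\<zeta>. u \<zeta> / (\<zeta> - z))"
      by (simp only: inner_w integral_mult_right_zero ci[OF cuz, folded p_def])
    finally have "(LINT w|lborel. LINT t|lborel. F t w) = - of_real pi * contour_integral \<gamma> (\<lambda>\<zeta>. u \<zeta> / (\<zeta> - z))" .
    then have "(LINT w|lborel. h w) = - of_real pi * contour_integral \<gamma> (\<lambda>\<zeta>. u \<zeta> / (\<zeta> - z)) / (2 * of_real pi * \<i>)"
      by (simp add: h_def)
    then show "contour_integral \<gamma> (\<lambda>\<zeta>. u \<zeta> / (\<zeta> - z)) = - 2 * \<i> * (LINT w|lborel. h w)"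
      by (simp add: field_simps)
  qed
qed

lemma piecewise_smooth_domain_curve:
  assumes "piecewise_smooth_domain D \<Gamma>" "\<gamma> \<in> \<Gamma>"
  shows "piecewise_smooth_path \<gamma>" "path \<gamma>" "path_image \<gamma> \<subseteq> frontier D"
  using assms unfolding piecewise_smooth_domain_def by (auto simp: simple_path_imp_path)

lemma piecewise_smooth_domain_open: "piecewise_smooth_domain D \<Gamma> \<Longrightarrow> open D"
  unfolding piecewise_smooth_domain_def by blast

lemma piecewise_smooth_domain_frontier_disjoint:
  assumes "piecewise_smooth_domain D \<Gamma>" "z \<in> D" "\<gamma> \<in> \<Gamma>"
  shows "z \<notin> path_image \<gamma>"
  using piecewise_smooth_domain_curve(3)[OF assms(1,3)] piecewise_smooth_domain_open[OF assms(1)] assms(2)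
  by (auto simp: frontier_def interior_open)

text \<open>Summing over the boundary curves replaces the winding numbers by their totals, which are 1 on \<open>D\<close>
  and 0 outside its closure. Hence the double integral extends over the complement of \<open>D\<close>, and it is
  the integral over the plane, known from compact support, minus the one over \<open>D\<close>.\<close>

lemma cauchy_pompeiu_boundary:
  assumes D: "piecewise_smooth_domain D \<Gamma>" and z: "z \<in> D"
    and u: "times_differentiable_on 1 u UNIV" and C: "compact C" and 0: "\<And>w. w \<notin> C \<Longrightarrow> u w = 0"
  shows "boundary_integral \<Gamma> (\<lambda>\<zeta>. u \<zeta> / (\<zeta> - z)) = 2 * of_real pi * \<i> * u z +
     2 * \<i> * set_lebesgue_integral lborel D (\<lambda>w. cr_derivative u w / (w - z))"
proof -
  have fin: "finite \<Gamma>" using D by (simp add: piecewise_smooth_domain_def)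
  note curve = piecewise_smooth_domain_curve[OF D]
  define g where "g w = cr_derivative u w / (w - z)" for w
  have "\<exists>h. integrable lborel h \<and>
      (AE w in lborel. h w = g w * (winding_number \<gamma> z - winding_number \<gamma> w)) \<and>
      contour_integral \<gamma> (\<lambda>\<zeta>. u \<zeta> / (\<zeta> - z)) = - 2 * \<i> * (LINT w|lborel. h w)" if \<gamma>: "\<gamma> \<in> \<Gamma>" for \<gamma>
    unfolding g_def
    by (rule contour_integral_cauchy_kernel_compact_support[OF curve(1,2)[OF \<gamma>]
        piecewise_smooth_domain_frontier_disjoint[OF D z \<gamma>] u C 0]) blast+
  then have "\<forall>\<gamma>\<in>\<Gamma>. \<exists>h. integrable lborel h \<and>
      (AE w in lborel. h w = g w * (winding_number \<gamma> z - winding_number \<gamma> w)) \<and>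
      contour_integral \<gamma> (\<lambda>\<zeta>. u \<zeta> / (\<zeta> - z)) = - 2 * \<i> * (LINT w|lborel. h w)" by blast
  from bchoice[OF this] obtain h where "\<forall>\<gamma>\<in>\<Gamma>. integrable lborel (h \<gamma>) \<and>
      (AE w in lborel. h \<gamma> w = g w * (winding_number \<gamma> z - winding_number \<gamma> w)) \<and>
      contour_integral \<gamma> (\<lambda>\<zeta>. u \<zeta> / (\<zeta> - z)) = - 2 * \<i> * (LINT w|lborel. h \<gamma> w)" by (elim exE)
  then have h: "\<And>\<gamma>. \<gamma> \<in> \<Gamma> \<Longrightarrow> integrable lborel (h \<gamma>)"
    "\<And>\<gamma>. \<gamma> \<in> \<Gamma> \<Longrightarrow> AE w in lborel. h \<gamma> w = g w * (winding_number \<gamma> z - winding_number \<gamma> w)"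
    "\<And>\<gamma>. \<gamma> \<in> \<Gamma> \<Longrightarrow> contour_integral \<gamma> (\<lambda>\<zeta>. u \<zeta> / (\<zeta> - z)) = - 2 * \<i> * (LINT w|lborel. h \<gamma> w)"
    by simp_all
  have [measurable]: "D \<in> sets borel"
    using piecewise_smooth_domain_open[OF D] by simp
  have Ig: "integrable lborel g"
    unfolding g_def by (rule integrable_cr_derivative_cauchy_kernel[OF u C 0])
  have IgD: "integrable lborel (\<lambda>w. indicator D w *\<^sub>R g w)"
    using Ig by (rule integrable_mult_indicator[rotated]) simp
  have "AE w in lborel. \<forall>\<gamma>\<in>\<Gamma>. h \<gamma> w = g w * (winding_number \<gamma> z - winding_number \<gamma> w) \<and> w \<notin> path_image \<gamma>"
    using h(2) piecewise_smooth_path_null_image[OF curve(1,2)]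
    by (intro AE_finite_allI[OF fin]) (simp add: AE_conj_iff)
  then have AE: "AE w in lborel. (\<Sum>\<gamma>\<in>\<Gamma>. h \<gamma> w) = g w - indicator D w *\<^sub>R g w"
  proof eventually_elim
    case (elim w)
    have "w \<notin> frontier D" using elim D by (auto simp: piecewise_smooth_domain_def)
    then have w: "w \<in> D \<or> w \<notin> closure D"
      using piecewise_smooth_domain_open[OF D] by (auto simp: frontier_def interior_open)
    have "(\<Sum>\<gamma>\<in>\<Gamma>. h \<gamma> w) = g w * ((\<Sum>\<gamma>\<in>\<Gamma>. winding_number \<gamma> z) - (\<Sum>\<gamma>\<in>\<Gamma>. winding_number \<gamma> w))"
      using elim by (simp add: sum_distrib_left flip: sum_subtractf)
    also have "(\<Sum>\<gamma>\<in>\<Gamma>. winding_number \<gamma> z) = 1"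
      using D z by (simp add: piecewise_smooth_domain_def)
    also have "(\<Sum>\<gamma>\<in>\<Gamma>. winding_number \<gamma> w) = indicator D w"
    proof (cases "w \<in> D")
      case True
      with D show ?thesis by (simp add: piecewise_smooth_domain_def)
    next
      case False
      with w D show ?thesis by (simp add: piecewise_smooth_domain_def)
    qed
    finally show ?case by (simp add: indicator_def)
  qed
  have "boundary_integral \<Gamma> (\<lambda>\<zeta>. u \<zeta> / (\<zeta> - z)) = - 2 * \<i> * (LINT w|lborel. (\<Sum>\<gamma>\<in>\<Gamma>. h \<gamma> w))"
    using h(1,3) by (simp add: boundary_integral_def sum_distrib_left)
  also have "(LINT w|lborel. (\<Sum>\<gamma>\<in>\<Gamma>. h \<gamma> w)) = (LINT w|lborel. g w - indicator D w *\<^sub>R g w)"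
    by (rule integral_cong_AE) (use h(1) Ig IgD AE in auto)
  also have "\<dots> = - of_real pi * u z - set_lebesgue_integral lborel D g"
    using cauchy_pompeiu_compact_support[OF u C 0, of z]
    unfolding Bochner_Integration.integral_diff[OF Ig IgD] set_lebesgue_integral_def
    by (simp add: g_def[abs_def])
  finally show ?thesis
    by (simp add: g_def[abs_def] algebra_simps)
qed

text \<open>Extending \<open>f\<close> by a cutoff changes neither the boundary values nor the derivative inside.\<close>

theorem cauchy_pompeiu:
  assumes D: "piecewise_smooth_domain D \<Gamma>" and bD: "bounded D" and z: "z \<in> D"
    and N: "open N" "closure D \<subseteq> N" and f: "times_differentiable_on 1 f N"
  shows "boundary_integral \<Gamma> (\<lambda>\<zeta>. f \<zeta> / (\<zeta> - z)) = 2 * of_real pi * \<i> * f z +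
     2 * \<i> * set_lebesgue_integral lborel D (\<lambda>w. cr_derivative f w / (w - z))"
proof -
  have "compact (closure D)" using bD by simp
  then obtain \<phi> :: "complex \<Rightarrow> complex" and C where \<phi>: "\<And>k. times_differentiable_on k \<phi> UNIV"
    "\<And>w. w \<in> closure D \<Longrightarrow> \<phi> w = 1" and C: "compact C" "C \<subseteq> N" "\<And>w. w \<notin> C \<Longrightarrow> \<phi> w = 0"
    by (rule smooth_cutoff[OF _ N]) blast
  define u where "u w = (if w \<in> N then \<phi> w * f w else 0)" for w
  have u0: "u w = 0" if "w \<notin> C" for w using that C(3) by (simp add: u_def)
  have "times_differentiable_on 1 (\<lambda>w. \<phi> w * f w) N"
    by (rule Ck_mult[OF N(1) Ck_subset[OF \<phi>(1) subset_UNIV] f])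
  then have u: "times_differentiable_on 1 u UNIV"
    unfolding u_def
    by (rule Ck_extend_by_zero[OF N(1) compact_imp_closed[OF C(1)] C(2)]) (simp add: C(3))
  have uf: "u w = f w" if "w \<in> closure D" for w
    using that N(2) \<phi>(2) by (auto simp: u_def)
  have "path_image \<gamma> \<subseteq> closure D" if "\<gamma> \<in> \<Gamma>" for \<gamma>
    using piecewise_smooth_domain_curve(3)[OF D that] by (auto simp: frontier_def)
  then have "boundary_integral \<Gamma> (\<lambda>\<zeta>. f \<zeta> / (\<zeta> - z)) = boundary_integral \<Gamma> (\<lambda>\<zeta>. u \<zeta> / (\<zeta> - z))"
    unfolding boundary_integral_def
    by (intro sum.cong refl contour_integral_eq) (use uf in force)
  moreover have "cr_derivative u w = cr_derivative f w" if "w \<in> D" for w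
    using piecewise_smooth_domain_open[OF D] that
    by (rule cr_derivative_cong) (use u uf closure_subset in auto)
  then have "set_lebesgue_integral lborel D (\<lambda>w. cr_derivative u w / (w - z)) =
      set_lebesgue_integral lborel D (\<lambda>w. cr_derivative f w / (w - z))"
    unfolding set_lebesgue_integral_def
    by (intro Bochner_Integration.integral_cong refl) (auto simp: indicator_def)
  moreover have "u z = f z" using z closure_subset uf by blast
  ultimately show ?thesis
    using cauchy_pompeiu_boundary[OF D z u C(1) u0] by simp
qed

section \<open>Cauchy integrals in one of several variables\<close>

lemma replace_coord_nth [simp]: "replace_coord z e \<zeta> $ j = (if j = e then \<zeta> else z $ j)"
  by (simp add: replace_coord_def)

lemma replace_coord_same [simp]: "replace_coord z e (z $ e) = z"
  by (simp add: vec_eq_iff)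

lemma replace_coord_axis: "replace_coord (axis j d) e 0 = (if j = e then 0 else axis j d)"
  by (simp add: vec_eq_iff axis_def)

lemma bounded_linear_replace_coord: "bounded_linear (\<lambda>q. replace_coord (fst q) e (snd q))"
  unfolding linear_conv_bounded_linear[symmetric]
  by (rule linearI) (simp_all add: vec_eq_iff)

lemma has_derivative_replace_coord:
  "((\<lambda>q. replace_coord (fst q) e (snd q)) has_derivative (\<lambda>q. replace_coord (fst q) e (snd q))) (at q)"
  by (rule bounded_linear_imp_has_derivative[OF bounded_linear_replace_coord])

lemma continuous_on_replace_coord [continuous_intros]:
  assumes "continuous_on S f" "continuous_on S g"
  shows "continuous_on S (\<lambda>x. replace_coord (f x) e (g x))"
  using continuous_on_compose2[OF linear_continuous_on[OF bounded_linear_replace_coord]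
      continuous_on_Pair[OF assms], of UNIV e] by simp

lemma wirtinger_bar_eqI:
  "(a has_derivative a') (at z) \<Longrightarrow> wirtinger_bar j a z = (a' (axis j 1) + \<i> * a' (axis j \<i>)) / 2"
  using frechet_derivative_at[of a a' z] by (simp add: wirtinger_bar_def)

lemma wirtinger_bar_cong:
  assumes "open X" "z \<in> X" "\<And>w. w \<in> X \<Longrightarrow> f w = g w" "f differentiable (at z)"
  shows "wirtinger_bar j f z = wirtinger_bar j g z"
  using frechet_derivative_transform_within_open[OF assms(4,1,2,3)] by (simp add: wirtinger_bar_def)

lemma wirtinger_bar_cmult:
  assumes "f differentiable (at z)"
  shows "wirtinger_bar j (\<lambda>z. c * f z) z = c * wirtinger_bar j f z"
proof -
  have "((\<lambda>z. c * f z) has_derivative (\<lambda>v. c * frechet_derivative f (at z) v)) (at z)"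
    using assms by (intro has_derivative_mult_right) (simp add: frechet_derivative_works)
  from wirtinger_bar_eqI[OF this] show ?thesis by (simp add: wirtinger_bar_def algebra_simps)
qed

lemma wirtinger_bar_add:
  assumes "f differentiable (at z)" "g differentiable (at z)"
  shows "wirtinger_bar j (\<lambda>z. f z + g z) z = wirtinger_bar j f z + wirtinger_bar j g z"
proof -
  have "((\<lambda>z. f z + g z) has_derivative
      (\<lambda>v. frechet_derivative f (at z) v + frechet_derivative g (at z) v)) (at z)"
    using assms by (intro has_derivative_add) (simp_all add: frechet_derivative_works)
  note eq = wirtinger_bar_eqI[OF this, of j]
  show ?thesis unfolding eq by (simp add: wirtinger_bar_def algebra_simps add_divide_distrib)
qed

lemma wirtinger_bar_mult_coord:
  fixes z :: "complex ^ 'n::finite" and f :: "complex \<Rightarrow> complex" and a :: "complex ^ 'n \<Rightarrow> complex"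
  assumes "j \<noteq> e" "f differentiable (at (z $ e))" "a differentiable (at z)"
  shows "wirtinger_bar j (\<lambda>z. f (z $ e) * a z) z = f (z $ e) * wirtinger_bar j a z"
proof -
  have f: "(f has_derivative frechet_derivative f (at (z $ e))) (at (z $ e))"
    using assms(2) by (simp add: frechet_derivative_works)
  have "((\<lambda>z. f (z $ e)) has_derivative (\<lambda>v. frechet_derivative f (at (z $ e)) (v $ e))) (at z)"
    by (rule has_derivative_compose[OF bounded_linear_imp_has_derivative[OF bounded_linear_vec_nth] f])
  moreover have "(a has_derivative frechet_derivative a (at z)) (at z)"
    using assms(3) by (simp add: frechet_derivative_works)
  ultimately have "((\<lambda>z. f (z $ e) * a z) has_derivative (\<lambda>v. f (z $ e) * frechet_derivative a (at z) v +
      frechet_derivative f (at (z $ e)) (v $ e) * a z)) (at z)"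
    by (rule has_derivative_mult)
  note eq = wirtinger_bar_eqI[OF this, of j]
  have "axis j d $ e = 0" for d :: complex using assms(1) by (simp add: axis_def)
  then show ?thesis
    unfolding eq by (simp add: wirtinger_bar_def linear_0[OF has_derivative_linear[OF f]] algebra_simps)
qed

lemma wirtinger_bar_sum:
  assumes "\<And>i. i \<in> A \<Longrightarrow> f i differentiable (at z)"
  shows "wirtinger_bar j (\<lambda>z. \<Sum>i\<in>A. f i z) z = (\<Sum>i\<in>A. wirtinger_bar j (f i) z)"
proof -
  have "((\<lambda>z. \<Sum>i\<in>A. f i z) has_derivative (\<lambda>v. \<Sum>i\<in>A. frechet_derivative (f i) (at z) v)) (at z)"
    using assms by (intro has_derivative_sum) (simp add: frechet_derivative_works)
  note eq = wirtinger_bar_eqI[OF this, of j]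
  show ?thesis unfolding eq
    by (simp add: wirtinger_bar_def sum.distrib sum_distrib_left flip: sum_divide_distrib)
qed

lemma wirtinger_bar_times_differentiable_on:
  assumes "open U" "times_differentiable_on (Suc k) a U"
  shows "times_differentiable_on k (wirtinger_bar j a) U"
proof -
  have "times_differentiable_on k (\<lambda>z. (frechet_derivative a (at z) (axis j 1) +
      \<i> * frechet_derivative a (at z) (axis j \<i>)) / 2) U"
    using assms(2) by (intro Ck_divide Ck_add
        Ck_mult Ck_const assms(1)) auto
  then show ?thesis by (simp add: wirtinger_bar_def[abs_def])
qed

text \<open>The derivative of \<open>G\<close> in its first argument, formed from the derivative of \<open>G\<close> as a function of both: the
  lemma on parametric integrals requires joint smoothness, which is inherited by the latter.\<close>

definition wirtinger_bar_fst :: "'n::finite \<Rightarrow> ((complex ^ 'n) \<times> complex \<Rightarrow> complex) \<Rightarrow> (complex ^ 'n) \<times> complex \<Rightarrow> complex" where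
  "wirtinger_bar_fst j G q =
     (frechet_derivative G (at q) (axis j 1, 0) + \<i> * frechet_derivative G (at q) (axis j \<i>, 0)) / 2"

lemma wirtinger_bar_fst_eqI:
  "(G has_derivative G') (at q) \<Longrightarrow> wirtinger_bar_fst j G q = (G' (axis j 1, 0) + \<i> * G' (axis j \<i>, 0)) / 2"
  using frechet_derivative_at[of G G' q] by (simp add: wirtinger_bar_fst_def)

lemma wirtinger_bar_parametric_integral:
  fixes G :: "(complex ^ 'n) \<times> complex \<Rightarrow> complex" and M :: "'s::euclidean_space measure"
  assumes "open X" "compact K" "X \<times> K \<subseteq> O'" "integrable M \<kappa>" "p \<in> borel_measurable M"
    "\<And>s. s \<in> space M \<Longrightarrow> \<kappa> s \<noteq> 0 \<Longrightarrow> p s \<in> K"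
    and G: "times_differentiable_on 1 G O'" and x: "x \<in> X"
  shows "wirtinger_bar j (\<lambda>x. LINT s|M. \<kappa> s * G (x, p s)) x =
    (LINT s|M. \<kappa> s * wirtinger_bar_fst j G (x, p s))"
proof -
  define Gv where "Gv v q = frechet_derivative G (at q) (v, 0)" for v q
  have cont: "continuous_on O' (Gv v)" for v
    using G unfolding Gv_def by simp
  have I: "integrable M (\<lambda>s. \<kappa> s * Gv v (x, p s))" for v
    by (rule parametric_integrable[OF assms(1-5) _ cont x]) (rule assms(6))
  have "((\<lambda>x. LINT s|M. \<kappa> s * G (x, p s)) has_derivative (\<lambda>v. LINT s|M. \<kappa> s * Gv v (x, p s))) (at x)"
    unfolding Gv_def
    by (rule parametric_integral_has_derivative[OF assms(1-5) _ _ x]) (rule assms(6), use G in simp_all)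
  from wirtinger_bar_eqI[OF this]
  have "wirtinger_bar j (\<lambda>x. LINT s|M. \<kappa> s * G (x, p s)) x =
     ((LINT s|M. \<kappa> s * Gv (axis j 1) (x, p s)) + \<i> * (LINT s|M. \<kappa> s * Gv (axis j \<i>) (x, p s))) / 2" .
  also have "\<dots> = (LINT s|M. (\<kappa> s * Gv (axis j 1) (x, p s) + \<i> * (\<kappa> s * Gv (axis j \<i>) (x, p s))) / 2)"
    using I by simp
  also have "\<dots> = (LINT s|M. \<kappa> s * wirtinger_bar_fst j G (x, p s))"
    by (rule Bochner_Integration.integral_cong[OF refl]) (simp add: wirtinger_bar_fst_def Gv_def algebra_simps)
  finally show ?thesis .
qed

text \<open>The integrand of both one-variable operators, as a function of the parameter and the integration
  variable; it is smooth on \<open>kernel_domain e U\<close> if \<open>a\<close> is smooth on \<open>U\<close>.\<close>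

definition kernel_integrand :: "'n::finite \<Rightarrow> (complex ^ 'n \<Rightarrow> complex) \<Rightarrow> (complex ^ 'n) \<times> complex \<Rightarrow> complex" where
  "kernel_integrand e a q = a (replace_coord (fst q) e (snd q)) / (snd q - fst q $ e)"

definition kernel_domain :: "'n::finite \<Rightarrow> (complex ^ 'n) set \<Rightarrow> ((complex ^ 'n) \<times> complex) set" where
  "kernel_domain e U = {q. replace_coord (fst q) e (snd q) \<in> U \<and> snd q \<noteq> fst q $ e}"

lemma open_replace_coord_vimage:
  assumes "open U"
  shows "open {q. replace_coord (fst q) e (snd q) \<in> U}"
proof -
  have "continuous_on UNIV (\<lambda>q. replace_coord (fst q) e (snd q))"
    by (rule linear_continuous_on[OF bounded_linear_replace_coord])
  from open_vimage[OF assms this] show ?thesis by (simp add: vimage_def)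
qed

lemma bounded_linear_snd_diff_fst_nth: "bounded_linear (\<lambda>q :: (complex ^ 'n::finite) \<times> complex. snd q - fst q $ e)"
  unfolding linear_conv_bounded_linear[symmetric]
  by (rule linearI) (simp_all add: algebra_simps)

lemma open_kernel_domain:
  fixes U :: "(complex ^ 'n::finite) set"
  assumes "open U"
  shows "open (kernel_domain e U)"
proof -
  have "open {q :: (complex ^ 'n) \<times> complex. snd q - fst q $ e \<noteq> 0}"
    by (rule open_Collect_neq)
      (auto intro!: linear_continuous_on bounded_linear_snd_diff_fst_nth continuous_intros)
  then have "open {q :: (complex ^ 'n) \<times> complex. snd q \<noteq> fst q $ e}" by simp
  from open_Int[OF open_replace_coord_vimage[OF assms] this] show ?thesis
    by (simp add: kernel_domain_def Collect_conj_eq)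
qed

lemma replace_coord_compose_times_differentiable_on:
  assumes "open U" "times_differentiable_on k a U" "open W" "\<And>q. q \<in> W \<Longrightarrow> replace_coord (fst q) e (snd q) \<in> U"
  shows "times_differentiable_on k (\<lambda>q. a (replace_coord (fst q) e (snd q))) W"
  by (rule Ck_compose_affine[OF assms(1,3,2,4) has_derivative_replace_coord])

lemma kernel_integrand_times_differentiable_on:
  assumes "open U" "times_differentiable_on k a U"
  shows "times_differentiable_on k (kernel_integrand e a) (kernel_domain e U)"
  unfolding kernel_integrand_def[abs_def]
  by (intro Ck_divide replace_coord_compose_times_differentiable_on[OF assms]
      Ck_bounded_linear bounded_linear_snd_diff_fst_nth open_kernel_domain assms)
    (auto simp: kernel_domain_def)

lemma kernel_integrand_has_derivative:
  fixes x :: "complex ^ 'n::finite"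
  assumes a: "a differentiable (at (replace_coord x e \<zeta>))" and ne: "\<zeta> \<noteq> x $ e"
  shows "(kernel_integrand e a has_derivative (\<lambda>q.
     frechet_derivative a (at (replace_coord x e \<zeta>)) (replace_coord (fst q) e (snd q)) / (\<zeta> - x $ e) -
     a (replace_coord x e \<zeta>) * (snd q - fst q $ e) / (\<zeta> - x $ e)\<^sup>2)) (at (x, \<zeta>))"
proof -
  have 1: "((\<lambda>q. a (replace_coord (fst q) e (snd q))) has_derivative
      (\<lambda>q. frechet_derivative a (at (replace_coord x e \<zeta>)) (replace_coord (fst q) e (snd q)))) (at (x, \<zeta>))"
    by (rule has_derivative_compose[OF has_derivative_replace_coord])
      (use a in \<open>simp add: frechet_derivative_works\<close>)
  have 2: "((\<lambda>q. snd q - fst q $ e) has_derivative (\<lambda>q. snd q - fst q $ e)) (at (x, \<zeta>))"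
    by (rule bounded_linear_imp_has_derivative[OF bounded_linear_snd_diff_fst_nth])
  have "snd (x, \<zeta>) - fst (x, \<zeta>) $ e \<noteq> 0" using ne by simp
  from has_derivative_divide[OF 1 2 this] show ?thesis
    unfolding kernel_integrand_def[abs_def]
    by (rule has_derivative_eq_rhs) (use ne in \<open>simp add: fun_eq_iff divide_simps power2_eq_square\<close>)
qed

text \<open>In the parameter \<open>x\<^sub>e\<close> the kernel is holomorphic, in the other parameters it is a constant.\<close>

lemma wirtinger_bar_fst_kernel_integrand:
  fixes x :: "complex ^ 'n::finite"
  assumes a: "a differentiable (at (replace_coord x e \<zeta>))" and ne: "\<zeta> \<noteq> x $ e"
  shows "wirtinger_bar_fst j (kernel_integrand e a) (x, \<zeta>) =
    (if j = e then 0 else kernel_integrand e (wirtinger_bar j a) (x, \<zeta>))"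
proof -
  have lin: "linear (frechet_derivative a (at (replace_coord x e \<zeta>)))"
    using a has_derivative_linear frechet_derivative_works by blast
  have axis_e: "axis j d $ e = (if j = e then d else 0)" for d :: complex
    by (simp add: axis_def)
  define d where "d = \<zeta> - x $ e"
  have i2: "\<i> * (A * \<i>) = - A" for A :: complex by (simp add: mult.left_commute[of \<i> A])
  show ?thesis
    unfolding wirtinger_bar_fst_eqI[OF kernel_integrand_has_derivative[OF assms]]
      fst_conv snd_conv kernel_integrand_def d_def[symmetric]
    by (simp add: replace_coord_axis linear_0[OF lin] wirtinger_bar_def axis_e i2 add_divide_distrib mult.commute[of d 2])
qed

subsection \<open>The boundary operator\<close>

definition cauchy_boundary ::
  "(real \<Rightarrow> complex) set \<Rightarrow> 'n::finite \<Rightarrow> (complex ^ 'n \<Rightarrow> complex) \<Rightarrow> complex ^ 'n \<Rightarrow> complex" where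
  "cauchy_boundary \<Gamma> e a z = boundary_integral \<Gamma> (\<lambda>\<zeta>. a (replace_coord z e \<zeta>) / (\<zeta> - z $ e))"

text \<open>The derivative in \<open>z\<^sub>e\<close> vanishes: a Cauchy integral over a curve is holomorphic off the curve.\<close>

lemma contour_cauchy_integral:
  fixes a :: "complex ^ 'n::finite \<Rightarrow> complex"
  assumes \<gamma>: "piecewise_smooth_path \<gamma>" "path \<gamma>" and U: "open U" and a: "times_differentiable_on k a U"
    and X: "open X" "X \<times> path_image \<gamma> \<subseteq> kernel_domain e U"
  shows "times_differentiable_on k (\<lambda>x. contour_integral \<gamma> (\<lambda>\<zeta>. kernel_integrand e a (x, \<zeta>))) X"
    and "k > 0 \<Longrightarrow> x \<in> X \<Longrightarrow> wirtinger_bar j (\<lambda>x. contour_integral \<gamma> (\<lambda>\<zeta>. kernel_integrand e a (x, \<zeta>))) x =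
      (if j = e then 0 else contour_integral \<gamma> (\<lambda>\<zeta>. kernel_integrand e (wirtinger_bar j a) (x, \<zeta>)))"
proof -
  obtain \<kappa> where \<kappa>: "integrable lborel \<kappa>"
    and ci: "\<And>f. continuous_on (path_image \<gamma>) f \<Longrightarrow>
       contour_integral \<gamma> f = (LINT t|lborel. \<kappa> t * f (clamped_path \<gamma> t))"
    by (rule piecewise_smooth_path_density[OF \<gamma>]) blast
  define p where "p = clamped_path \<gamma>"
  have pK: "p t \<in> path_image \<gamma>" for t
    unfolding p_def by (rule clamped_path_in_image)
  have p: "p \<in> borel_measurable lborel"
    using clamped_path_measurable[OF \<gamma>(2)] by (simp add: p_def)
  have cont: "continuous_on (path_image \<gamma>) (\<lambda>\<zeta>. kernel_integrand e b (x, \<zeta>))"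
    if b: "continuous_on U b" and "x \<in> X" for b x
  proof -
    have "times_differentiable_on 0 b U" using b by simp
    from Ck_continuous[OF kernel_integrand_times_differentiable_on[OF U this]]
    show ?thesis
      by (rule continuous_on_compose2) (use X \<open>x \<in> X\<close> in \<open>auto intro!: continuous_intros\<close>)
  qed
  have eq: "contour_integral \<gamma> (\<lambda>\<zeta>. kernel_integrand e b (x, \<zeta>)) = (LINT t|lborel. \<kappa> t * kernel_integrand e b (x, p t))"
    if "continuous_on U b" "x \<in> X" for b x
    unfolding p_def by (rule ci[OF cont[OF that]])
  note conta = Ck_continuous[OF a]
  note P = X(1) compact_path_image[OF \<gamma>(2)] X(2) \<kappa> p pK
  have G: "times_differentiable_on k (\<lambda>x. LINT t|lborel. \<kappa> t * kernel_integrand e a (x, p t)) X"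
    by (rule parametric_integral_times_differentiable_on[OF P kernel_integrand_times_differentiable_on[OF U a]])
  show D: "times_differentiable_on k (\<lambda>x. contour_integral \<gamma> (\<lambda>\<zeta>. kernel_integrand e a (x, \<zeta>))) X"
    by (rule Ck_cong[OF X(1) _ G]) (rule eq[OF conta, symmetric])
  assume k: "k > 0" and x: "x \<in> X"
  have a1: "times_differentiable_on 1 a U"
    by (rule Ck_mono[OF a]) (use k in simp)
  have contw: "continuous_on U (wirtinger_bar j a)"
    using wirtinger_bar_times_differentiable_on[OF U, of 0 a j] a1 by simp
  have "times_differentiable_on 1 (\<lambda>x. contour_integral \<gamma> (\<lambda>\<zeta>. kernel_integrand e a (x, \<zeta>))) X"
    by (rule Ck_mono[OF D]) (use k in simp)
  then have "wirtinger_bar j (\<lambda>x. contour_integral \<gamma> (\<lambda>\<zeta>. kernel_integrand e a (x, \<zeta>))) x =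
      wirtinger_bar j (\<lambda>x. LINT t|lborel. \<kappa> t * kernel_integrand e a (x, p t)) x"
    using x by (intro wirtinger_bar_cong[OF X(1) x eq[OF conta]]) auto
  also have "\<dots> = (LINT t|lborel. \<kappa> t * wirtinger_bar_fst j (kernel_integrand e a) (x, p t))"
    by (rule wirtinger_bar_parametric_integral[OF P kernel_integrand_times_differentiable_on[OF U a1] x])
  also have "\<dots> = (LINT t|lborel. \<kappa> t * (if j = e then 0 else kernel_integrand e (wirtinger_bar j a) (x, p t)))"
  proof (rule Bochner_Integration.integral_cong[OF refl])
    fix t
    have "(x, p t) \<in> kernel_domain e U" using X(2) x pK by blast
    then have "replace_coord x e (p t) \<in> U" "p t \<noteq> x $ e" by (auto simp: kernel_domain_def)
    then show "\<kappa> t * wirtinger_bar_fst j (kernel_integrand e a) (x, p t) =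
       \<kappa> t * (if j = e then 0 else kernel_integrand e (wirtinger_bar j a) (x, p t))"
      using a1 by (subst wirtinger_bar_fst_kernel_integrand) auto
  qed
  also have "\<dots> = (if j = e then 0 else contour_integral \<gamma> (\<lambda>\<zeta>. kernel_integrand e (wirtinger_bar j a) (x, \<zeta>)))"
    using eq[OF contw x] by simp
  finally show "wirtinger_bar j (\<lambda>x. contour_integral \<gamma> (\<lambda>\<zeta>. kernel_integrand e a (x, \<zeta>))) x =
      (if j = e then 0 else contour_integral \<gamma> (\<lambda>\<zeta>. kernel_integrand e (wirtinger_bar j a) (x, \<zeta>)))" .
qed

lemma has_derivative_replace_coord_slice:
  "((\<lambda>\<zeta>. replace_coord z e \<zeta>) has_derivative (\<lambda>c. replace_coord 0 e c)) (at \<zeta>)"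
proof -
  have "((\<lambda>\<zeta>. (z, \<zeta>)) has_derivative (\<lambda>c. (0, c))) (at \<zeta>)"
    by (auto intro!: derivative_eq_intros)
  from has_derivative_compose[OF this has_derivative_replace_coord[of e]] show ?thesis by simp
qed

lemma wirtinger_bar_slice:
  assumes "a differentiable (at (replace_coord z e \<zeta>))"
  shows "cr_derivative (\<lambda>\<zeta>. a (replace_coord z e \<zeta>)) \<zeta> = wirtinger_bar e a (replace_coord z e \<zeta>)"
proof -
  from has_derivative_compose[OF has_derivative_replace_coord_slice, of a] assms
  have "((\<lambda>\<zeta>. a (replace_coord z e \<zeta>)) has_derivative
      (\<lambda>c. frechet_derivative a (at (replace_coord z e \<zeta>)) (replace_coord 0 e c))) (at \<zeta>)"
    by (simp add: frechet_derivative_works)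
  moreover have "replace_coord 0 e c = axis e c" for c :: complex
    by (simp add: vec_eq_iff axis_def)
  ultimately show ?thesis
    using cr_derivative_eqI[of "\<lambda>\<zeta>. a (replace_coord z e \<zeta>)"] by (simp add: wirtinger_bar_def)
qed

text \<open>The points at which the operators in the variable \<open>z\<^sub>e\<close> can be applied to a function on \<open>U\<close>: the
  integrals only involve values at points of \<open>U\<close>, up to and including the boundary.\<close>

definition slice_region :: "complex set \<Rightarrow> 'n::finite \<Rightarrow> (complex ^ 'n) set \<Rightarrow> (complex ^ 'n) set" where
  "slice_region D e U = {z. z $ e \<in> D \<and> (\<forall>\<zeta>\<in>closure D. replace_coord z e \<zeta> \<in> U)}"

lemma open_slice_region:
  fixes U :: "(complex ^ 'n::finite) set"
  assumes "open D" "bounded D" "open U"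
  shows "open (slice_region D e U)"
proof -
  define W where "W = {q. replace_coord (fst q) e (snd q) \<in> U}"
  have W: "open W" unfolding W_def by (rule open_replace_coord_vimage[OF assms(3)])
  have K: "compact (closure D)" using assms(2) by simp
  have "open {z. \<forall>\<zeta>\<in>closure D. replace_coord z e \<zeta> \<in> U}"
  proof (subst open_subopen, rule ballI)
    fix z assume "z \<in> {z. \<forall>\<zeta>\<in>closure D. replace_coord z e \<zeta> \<in> U}"
    then have "{z} \<times> closure D \<subseteq> W" by (auto simp: W_def)
    from Elementary_Topology.tube_lemma[OF K W this] obtain X where "z \<in> X" "open X" "X \<times> closure D \<subseteq> W" by blast
    then show "\<exists>T. open T \<and> z \<in> T \<and> T \<subseteq> {z. \<forall>\<zeta>\<in>closure D. replace_coord z e \<zeta> \<in> U}"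
      by (intro exI[of _ X]) (auto simp: W_def)
  qed
  moreover have "open {z :: complex ^ 'n. z $ e \<in> D}"
    using open_vimage[OF assms(1), of "\<lambda>z. z $ e"]
    by (simp add: vimage_def linear_continuous_on bounded_linear_vec_nth)
  ultimately show ?thesis
    unfolding slice_region_def by (simp add: Collect_conj_eq open_Int)
qed

context
  fixes D :: "complex set" and \<Gamma> and e :: "'n::finite" and U :: "(complex ^ 'n) set"
  assumes D: "piecewise_smooth_domain D \<Gamma>" and bD: "bounded D" and U: "open U"
begin

lemma slice_region_open: "open (slice_region D e U)"
  by (rule open_slice_region[OF piecewise_smooth_domain_open[OF D] bD U])

lemma slice_region_times_path_image:
  assumes "\<gamma> \<in> \<Gamma>"
  shows "slice_region D e U \<times> path_image \<gamma> \<subseteq> kernel_domain e U"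
proof -
  have "path_image \<gamma> \<subseteq> closure D"
    using piecewise_smooth_domain_curve(3)[OF D assms] by (auto simp: frontier_def)
  then show ?thesis
    using piecewise_smooth_domain_frontier_disjoint[OF D _ assms]
    by (fastforce simp: slice_region_def kernel_domain_def)
qed

lemma cauchy_boundary_eq: "cauchy_boundary \<Gamma> e a = (\<lambda>x. \<Sum>\<gamma>\<in>\<Gamma>. contour_integral \<gamma> (\<lambda>\<zeta>. kernel_integrand e a (x, \<zeta>)))"
  by (rule ext) (simp add: cauchy_boundary_def boundary_integral_def kernel_integrand_def)

lemma cauchy_boundary_times_differentiable_on:
  assumes a: "times_differentiable_on k a U"
  shows "times_differentiable_on k (cauchy_boundary \<Gamma> e a) (slice_region D e U)"
  unfolding cauchy_boundary_eq
  by (intro Ck_sum slice_region_open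
      contour_cauchy_integral(1)[OF piecewise_smooth_domain_curve(1,2)[OF D] U a slice_region_open
        slice_region_times_path_image])

lemma wirtinger_bar_cauchy_boundary:
  assumes a: "times_differentiable_on 1 a U" and z: "z \<in> slice_region D e U"
  shows "wirtinger_bar j (cauchy_boundary \<Gamma> e a) z = (if j = e then 0 else cauchy_boundary \<Gamma> e (wirtinger_bar j a) z)"
proof -
  note C = contour_cauchy_integral[OF piecewise_smooth_domain_curve(1,2)[OF D] U a slice_region_open
        slice_region_times_path_image]
  have "(\<lambda>x. contour_integral \<gamma> (\<lambda>\<zeta>. kernel_integrand e a (x, \<zeta>))) differentiable (at z)" if "\<gamma> \<in> \<Gamma>" for \<gamma>
    using C(1)[OF that that that] z by simp
  then have "wirtinger_bar j (cauchy_boundary \<Gamma> e a) z =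
      (\<Sum>\<gamma>\<in>\<Gamma>. wirtinger_bar j (\<lambda>x. contour_integral \<gamma> (\<lambda>\<zeta>. kernel_integrand e a (x, \<zeta>))) z)"
    unfolding cauchy_boundary_eq by (rule wirtinger_bar_sum)
  also have "\<dots> = (\<Sum>\<gamma>\<in>\<Gamma>. if j = e then 0 else contour_integral \<gamma> (\<lambda>\<zeta>. kernel_integrand e (wirtinger_bar j a) (z, \<zeta>)))"
    by (rule sum.cong[OF refl], rule C(2)) (use z in auto)
  finally show ?thesis by (simp add: cauchy_boundary_eq)
qed

end

subsection \<open>The area operator\<close>

definition cauchy_area :: "complex set \<Rightarrow> 'n::finite \<Rightarrow> (complex ^ 'n \<Rightarrow> complex) \<Rightarrow> complex ^ 'n \<Rightarrow> complex" where
  "cauchy_area D e a z = set_lebesgue_integral lborel D (\<lambda>\<zeta>. a (replace_coord z e \<zeta>) / (\<zeta> - z $ e))"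

context
  fixes D :: "complex set" and \<Gamma> and e :: "'n::finite" and U :: "(complex ^ 'n) set"
  assumes D: "piecewise_smooth_domain D \<Gamma>" and bD: "bounded D" and U: "open U"
begin

lemma cauchy_pompeiu_slice:
  assumes a: "times_differentiable_on 1 a U" and z: "z \<in> slice_region D e U"
  shows "cauchy_boundary \<Gamma> e a z = 2 * of_real pi * \<i> * a z + 2 * \<i> * cauchy_area D e (wirtinger_bar e a) z"
proof -
  define N where "N = {\<zeta>. replace_coord z e \<zeta> \<in> U}"
  have "continuous_on UNIV (\<lambda>\<zeta>. replace_coord z e \<zeta>)"
    by (intro continuous_intros)
  from open_vimage[OF U this] have N: "open N" by (simp add: N_def vimage_def)
  have "closure D \<subseteq> N" using z by (auto simp: N_def slice_region_def)
  moreover have "times_differentiable_on 1 (\<lambda>\<zeta>. a (replace_coord z e \<zeta>)) N"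
    by (rule Ck_compose_affine[OF U N a _ has_derivative_replace_coord_slice]) (simp add: N_def)
  moreover have "z $ e \<in> D" using z by (simp add: slice_region_def)
  ultimately have "boundary_integral \<Gamma> (\<lambda>\<zeta>. a (replace_coord z e \<zeta>) / (\<zeta> - z $ e)) =
     2 * of_real pi * \<i> * a (replace_coord z e (z $ e)) +
     2 * \<i> * set_lebesgue_integral lborel D (\<lambda>w. cr_derivative (\<lambda>\<zeta>. a (replace_coord z e \<zeta>)) w / (w - z $ e))"
    using N by (intro cauchy_pompeiu[OF D bD])
  moreover have "set_lebesgue_integral lborel D (\<lambda>w. cr_derivative (\<lambda>\<zeta>. a (replace_coord z e \<zeta>)) w / (w - z $ e)) =
     cauchy_area D e (wirtinger_bar e a) z"
    unfolding cauchy_area_def set_lebesgue_integral_def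
  proof (rule Bochner_Integration.integral_cong[OF refl])
    fix w
    show "indicator D w *\<^sub>R (cr_derivative (\<lambda>\<zeta>. a (replace_coord z e \<zeta>)) w / (w - z $ e)) =
        indicator D w *\<^sub>R (wirtinger_bar e a (replace_coord z e w) / (w - z $ e))"
    proof (cases "w \<in> D")
      case True
      then have "replace_coord z e w \<in> U" using z closure_subset by (auto simp: slice_region_def)
      then show ?thesis using a by (subst wirtinger_bar_slice) auto
    qed simp
  qed
  ultimately show ?thesis by (simp add: cauchy_boundary_def)
qed

text \<open>Near a point \<open>z0\<close> a cutoff \<open>\<phi>\<close> in the integration variable splits the integral. Away from the
  singularity the kernel is smooth; in the part near the singularity the substitution
  \<open>\<zeta> = x\<^sub>e + w\<close> moves the parameter from the kernel to the smooth factor, which becomes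
  \<open>\<psi>(x + w e)\<close> with \<open>\<psi>(y) = \<phi>(y\<^sub>e) a(y)\<close> and \<open>e\<close> the unit vector. Its derivative with respect to
  \<open>x\<^sub>e\<close> is one with respect to \<open>w\<close>, so the Cauchy-Pompeiu formula for compact support evaluates the
  integral.\<close>

lemma cauchy_area_local:
  assumes z0: "z0 \<in> slice_region D e U"
  obtains X where "open X" "z0 \<in> X"
    "\<And>a k. times_differentiable_on k a U \<Longrightarrow> times_differentiable_on k (cauchy_area D e a) X"
    "\<And>a j. times_differentiable_on 1 a U \<Longrightarrow> wirtinger_bar j (cauchy_area D e a) z0 =
       (if j = e then - of_real pi * a z0 else cauchy_area D e (wirtinger_bar j a) z0)"
proof -
  have oD: "open D" by (rule piecewise_smooth_domain_open[OF D])
  define c where "c = z0 $ e"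
  have "c \<in> D" using z0 by (simp add: c_def slice_region_def)
  then obtain s where s: "s > 0" "ball c s \<subseteq> D" using oD open_contains_ball_eq by blast
  \<comment> \<open>The parameter stays within \<open>r\<close> of \<open>c\<close> and the support of \<open>\<phi>\<close> within \<open>2 * r\<close>, so that \<open>w\<close> ranges
     over the disc of radius \<open>3 * r\<close> and \<open>x $ e + w\<close> stays in \<open>ball c (4 * r)\<close>, inside \<open>D\<close>.\<close>
  define r where "r = s / 4"
  have r: "r > 0" "ball c (4 * r) \<subseteq> D" using s by (simp_all add: r_def)
  obtain \<phi> :: "complex \<Rightarrow> complex" where \<phi>: "\<And>k. times_differentiable_on k \<phi> UNIV"
    "\<And>w. w \<in> ball c r \<Longrightarrow> \<phi> w = 1" "\<And>w. w \<notin> ball c (2 * r) \<Longrightarrow> \<phi> w = 0"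
    by (rule smooth_bump_ball[where c = c and r = r and R = "2 * r"]) (use r in auto)
  define X where "X = {x \<in> slice_region D e U. x $ e \<in> ball c r}"
  have "open {x :: complex ^ 'n. x $ e \<in> ball c r}"
    using open_vimage[of "ball c r" "\<lambda>x. x $ e"]
    by (simp add: vimage_def linear_continuous_on bounded_linear_vec_nth)
  from open_Int[OF slice_region_open[OF D bD U] this] have X: "open X"
    by (simp add: X_def Int_def)
  have z0X: "z0 \<in> X" using z0 r by (simp add: X_def c_def)
  have id: "(\<lambda>w::complex. w) \<in> borel_measurable lborel" by simp
  \<comment> \<open>the part away from the singularity\<close>
  define K1 where "K1 = closure D - ball c r"
  have K1: "compact K1" unfolding K1_def using bD by (intro compact_diff) auto
  have XK1: "X \<times> K1 \<subseteq> kernel_domain e U"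
    by (auto simp: X_def K1_def kernel_domain_def slice_region_def)
  define \<kappa>1 where "\<kappa>1 \<zeta> = indicator D \<zeta> *\<^sub>R (indicator K1 \<zeta> *\<^sub>R (1 - \<phi> \<zeta>))" for \<zeta>
  have "continuous_on K1 (\<lambda>\<zeta>. 1 - \<phi> \<zeta>)"
    using Ck_continuous[OF \<phi>(1)] by (intro continuous_intros) (auto intro: continuous_on_subset)
  then have \<kappa>1: "integrable lborel \<kappa>1"
    unfolding \<kappa>1_def using oD by (intro integrable_mult_indicator borel_integrable_compact K1) auto
  have \<kappa>1K: "\<zeta> \<in> K1" if "\<kappa>1 \<zeta> \<noteq> 0" for \<zeta>
    using that by (auto simp: \<kappa>1_def indicator_def split: if_splits)
  note P1 = X K1 XK1 \<kappa>1 id \<kappa>1K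
  \<comment> \<open>the part near the singularity\<close>
  define \<psi> where "\<psi> a y = \<phi> (y $ e) * a y" for a and y :: "complex ^ 'n"
  define \<kappa>2 :: "complex \<Rightarrow> complex" where "\<kappa>2 w = indicator (ball 0 (3 * r)) w / (w - 0)" for w
  have \<kappa>2: "integrable lborel \<kappa>2" unfolding \<kappa>2_def by (rule integrable_inverse_ball)
  define K2 where "K2 = cball (0::complex) (3 * r)"
  have K2: "compact K2" by (simp add: K2_def)
  have \<kappa>2K: "w \<in> K2" if "\<kappa>2 w \<noteq> 0" for w
    using that by (auto simp: \<kappa>2_def K2_def indicator_def split: if_splits)
  have axis_0: "axis e 0 = (0 :: complex ^ 'n)" by (simp add: vec_eq_iff axis_def)
  define shift where "shift q = fst q + axis e (snd q)" for q :: "(complex ^ 'n) \<times> complex"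
  have "bounded_linear shift"
    unfolding linear_conv_bounded_linear[symmetric] shift_def
    by (rule linearI) (simp_all add: vec_eq_iff axis_def algebra_simps)
  note shift_der = bounded_linear_imp_has_derivative[OF this]
  have shift_eq: "shift (x, w) = replace_coord x e (x $ e + w)" for x w
    by (simp add: shift_def vec_eq_iff axis_def)
  define O2 where "O2 = shift -` U"
  have O2: "open O2" unfolding O2_def
    by (rule open_vimage[OF U]) (auto intro: linear_continuous_on \<open>bounded_linear shift\<close>)
  have XK2: "X \<times> K2 \<subseteq> O2"
  proof clarify
    fix x w assume xw: "x \<in> X" "w \<in> K2"
    have "norm (c - (x $ e + w)) \<le> norm (c - x $ e) + norm w"
      using norm_triangle_ineq4[of "c - x $ e" w] by (simp add: algebra_simps)
    then have "x $ e + w \<in> ball c (4 * r)" using xw by (simp add: X_def K2_def dist_norm)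
    then have "x $ e + w \<in> closure D" using r(2) closure_subset by blast
    then show "(x, w) \<in> O2" using xw(1) by (auto simp: O2_def shift_eq X_def slice_region_def)
  qed
  note P2 = X K2 XK2 \<kappa>2 id \<kappa>2K
  have \<psi>: "times_differentiable_on k (\<psi> a) U" if "times_differentiable_on k a U" for k a
    unfolding \<psi>_def[abs_def]
    by (rule Ck_mult[OF U Ck_compose_affine[OF open_UNIV U \<phi>(1) UNIV_I
          bounded_linear_imp_has_derivative[OF bounded_linear_vec_nth]] that])
  have G2: "times_differentiable_on k (\<lambda>q. \<psi> a (shift q)) O2" if "times_differentiable_on k a U" for k a
    by (rule Ck_compose_affine[OF U O2 \<psi>[OF that] _ shift_der]) (simp add: O2_def)
  have split: "cauchy_area D e a x =
      (LINT \<zeta>|lborel. \<kappa>1 \<zeta> * kernel_integrand e a (x, \<zeta>)) + (LINT w|lborel. \<kappa>2 w * \<psi> a (shift (x, w)))"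
    if a: "continuous_on U a" and x: "x \<in> X" for a x
  proof -
    have a0: "times_differentiable_on 0 a U" using a by simp
    have I1: "integrable lborel (\<lambda>\<zeta>. \<kappa>1 \<zeta> * kernel_integrand e a (x, \<zeta>))"
      by (rule parametric_integrable[OF P1 Ck_continuous[OF
              kernel_integrand_times_differentiable_on[OF U a0]] x])
    define h where "h w = \<kappa>2 w * \<psi> a (shift (x, w))" for w
    have I2: "integrable lborel h"
      unfolding h_def by (rule parametric_integrable[OF P2 Ck_continuous[OF G2[OF a0]] x])
    then have hm: "h \<in> borel_measurable borel" using borel_measurable_integrable by auto
    have "integrable (distr lborel borel ((+) (- (x $ e)))) h"
      unfolding lborel_distr_plus by (rule I2)
    then have Ih: "integrable lborel (\<lambda>\<zeta>. h (- (x $ e) + \<zeta>))"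
      by (subst (asm) integrable_distr_eq) (use hm in auto)
    have xc: "dist c (x $ e) < r" using x by (simp add: X_def)
    have "indicator D \<zeta> *\<^sub>R kernel_integrand e a (x, \<zeta>) = \<kappa>1 \<zeta> * kernel_integrand e a (x, \<zeta>) + h (- (x $ e) + \<zeta>)" for \<zeta>
    proof -
      have "h (- (x $ e) + \<zeta>) = indicator D \<zeta> *\<^sub>R (\<phi> \<zeta> * kernel_integrand e a (x, \<zeta>))"
      proof (cases "\<zeta> \<in> ball c (2 * r)")
        case True
        then have "\<zeta> \<in> D" using r subset_ball[of "2 * r" "4 * r" c] by auto
        moreover have "norm (\<zeta> - x $ e) < 3 * r"
          using xc True dist_triangle[of \<zeta> "x $ e" c] by (simp add: dist_norm norm_minus_commute)
        ultimately show ?thesis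
          by (simp add: h_def \<kappa>2_def shift_eq \<psi>_def kernel_integrand_def)
      next
        case False
        then show ?thesis using \<phi>(3) by (simp add: h_def shift_eq \<psi>_def)
      qed
      moreover have "\<kappa>1 \<zeta> = indicator D \<zeta> *\<^sub>R (1 - \<phi> \<zeta>)"
        using \<phi>(2)[of \<zeta>] closure_subset[of D] by (auto simp: \<kappa>1_def K1_def indicator_def)
      ultimately show ?thesis
        by (cases "\<zeta> \<in> D") (simp_all add: left_diff_distrib)
    qed
    then have "cauchy_area D e a x = (LINT \<zeta>|lborel. \<kappa>1 \<zeta> * kernel_integrand e a (x, \<zeta>) + h (- (x $ e) + \<zeta>))"
      unfolding cauchy_area_def set_lebesgue_integral_def by (simp add: kernel_integrand_def)
    also have "\<dots> = (LINT \<zeta>|lborel. \<kappa>1 \<zeta> * kernel_integrand e a (x, \<zeta>)) + (LINT w|lborel. h w)"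
      unfolding Bochner_Integration.integral_add[OF I1 Ih] integral_translate[OF hm] ..
    finally show ?thesis by (simp add: h_def)
  qed
  have T1: "times_differentiable_on k (\<lambda>x. LINT \<zeta>|lborel. \<kappa>1 \<zeta> * kernel_integrand e a (x, \<zeta>)) X"
    if "times_differentiable_on k a U" for k a
    by (rule parametric_integral_times_differentiable_on[OF P1 kernel_integrand_times_differentiable_on[OF U that]])
  have T2: "times_differentiable_on k (\<lambda>x. LINT w|lborel. \<kappa>2 w * \<psi> a (shift (x, w))) X"
    if "times_differentiable_on k a U" for k a
    by (rule parametric_integral_times_differentiable_on[OF P2 G2[OF that]])
  have T: "times_differentiable_on k (cauchy_area D e a) X" if a: "times_differentiable_on k a U" for k a
    by (rule Ck_cong[OF X _ Ck_add[OF X T1[OF a] T2[OF a]]])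
      (rule split[OF Ck_continuous[OF a], symmetric])
  show ?thesis
  proof (rule that[OF X z0X T])
    fix a :: "complex ^ 'n \<Rightarrow> complex" and j assume a: "times_differentiable_on 1 a U"
    have conta: "continuous_on U a" by (rule Ck_continuous[OF a])
    have contw: "continuous_on U (wirtinger_bar j a)"
      using wirtinger_bar_times_differentiable_on[OF U, of 0 a j] a by simp
    have "wirtinger_bar j (cauchy_area D e a) z0 = wirtinger_bar j (\<lambda>x.
        (LINT \<zeta>|lborel. \<kappa>1 \<zeta> * kernel_integrand e a (x, \<zeta>)) + (LINT w|lborel. \<kappa>2 w * \<psi> a (shift (x, w)))) z0"
      using T[OF a] z0X by (intro wirtinger_bar_cong[OF X z0X split[OF conta]]) auto
    also have "\<dots> = wirtinger_bar j (\<lambda>x. LINT \<zeta>|lborel. \<kappa>1 \<zeta> * kernel_integrand e a (x, \<zeta>)) z0 +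
        wirtinger_bar j (\<lambda>x. LINT w|lborel. \<kappa>2 w * \<psi> a (shift (x, w))) z0"
      using T1[OF a] T2[OF a] z0X by (intro wirtinger_bar_add) auto
    also have "wirtinger_bar j (\<lambda>x. LINT \<zeta>|lborel. \<kappa>1 \<zeta> * kernel_integrand e a (x, \<zeta>)) z0 =
        (LINT \<zeta>|lborel. \<kappa>1 \<zeta> * wirtinger_bar_fst j (kernel_integrand e a) (z0, \<zeta>))"
      by (rule wirtinger_bar_parametric_integral[OF P1 kernel_integrand_times_differentiable_on[OF U a] z0X])
    also have "\<dots> = (LINT \<zeta>|lborel. \<kappa>1 \<zeta> * (if j = e then 0 else kernel_integrand e (wirtinger_bar j a) (z0, \<zeta>)))"
    proof (rule Bochner_Integration.integral_cong[OF refl])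
      fix \<zeta>
      show "\<kappa>1 \<zeta> * wirtinger_bar_fst j (kernel_integrand e a) (z0, \<zeta>) =
          \<kappa>1 \<zeta> * (if j = e then 0 else kernel_integrand e (wirtinger_bar j a) (z0, \<zeta>))"
      proof (cases "\<kappa>1 \<zeta> = 0")
        case False
        then have "(z0, \<zeta>) \<in> kernel_domain e U" using \<kappa>1K XK1 z0X by blast
        then have q: "replace_coord z0 e \<zeta> \<in> U" "\<zeta> \<noteq> z0 $ e" by (auto simp: kernel_domain_def)
        then show ?thesis using a by (subst wirtinger_bar_fst_kernel_integrand) auto
      qed simp
    qed
    also have "wirtinger_bar j (\<lambda>x. LINT w|lborel. \<kappa>2 w * \<psi> a (shift (x, w))) z0 =
        (LINT w|lborel. \<kappa>2 w * wirtinger_bar_fst j (\<lambda>q. \<psi> a (shift q)) (z0, w))"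
      by (rule wirtinger_bar_parametric_integral[OF P2 G2[OF a] z0X])
    also have "\<dots> = (LINT w|lborel. \<kappa>2 w * wirtinger_bar j (\<psi> a) (shift (z0, w)))"
    proof (rule Bochner_Integration.integral_cong[OF refl])
      fix w
      show "\<kappa>2 w * wirtinger_bar_fst j (\<lambda>q. \<psi> a (shift q)) (z0, w) = \<kappa>2 w * wirtinger_bar j (\<psi> a) (shift (z0, w))"
      proof (cases "\<kappa>2 w = 0")
        case False
        then have "shift (z0, w) \<in> U" using \<kappa>2K XK2 z0X by (auto simp: O2_def)
        then have "(\<psi> a has_derivative frechet_derivative (\<psi> a) (at (shift (z0, w)))) (at (shift (z0, w)))"
          using \<psi>[OF a] by (simp add: frechet_derivative_works)
        from wirtinger_bar_fst_eqI[OF has_derivative_compose[OF shift_der this], of j] show ?thesis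
          by (simp add: shift_def wirtinger_bar_def axis_0)
      qed simp
    qed
    finally have main: "wirtinger_bar j (cauchy_area D e a) z0 =
        (LINT \<zeta>|lborel. \<kappa>1 \<zeta> * (if j = e then 0 else kernel_integrand e (wirtinger_bar j a) (z0, \<zeta>))) +
        (LINT w|lborel. \<kappa>2 w * wirtinger_bar j (\<psi> a) (shift (z0, w)))" .
    show "wirtinger_bar j (cauchy_area D e a) z0 =
       (if j = e then - of_real pi * a z0 else cauchy_area D e (wirtinger_bar j a) z0)"
    proof (cases "j = e")
      case False
      have "\<kappa>2 w * wirtinger_bar j (\<psi> a) (shift (z0, w)) = \<kappa>2 w * \<psi> (wirtinger_bar j a) (shift (z0, w))" for w
      proof (cases "\<kappa>2 w = 0")
        case False
        then have "a differentiable (at (shift (z0, w)))" using \<kappa>2K XK2 z0X a by (auto simp: O2_def)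
        moreover have "\<phi> differentiable (at (shift (z0, w) $ e))" using \<phi>(1)[of 1] by simp
        ultimately show ?thesis
          using wirtinger_bar_mult_coord[OF \<open>j \<noteq> e\<close>] by (simp add: \<psi>_def[abs_def])
      qed simp
      then have "(LINT w|lborel. \<kappa>2 w * wirtinger_bar j (\<psi> a) (shift (z0, w))) =
          (LINT w|lborel. \<kappa>2 w * \<psi> (wirtinger_bar j a) (shift (z0, w)))"
        by (rule Bochner_Integration.integral_cong[OF refl])
      then show ?thesis using main False split[OF contw z0X] by simp
    next
      case True
      define u where "u \<zeta> = (if \<zeta> \<in> ball c (4 * r) then \<psi> a (replace_coord z0 e \<zeta>) else 0)" for \<zeta>
      have inU: "replace_coord z0 e \<zeta> \<in> U" if "\<zeta> \<in> ball c (4 * r)" for \<zeta>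
        using that r(2) closure_subset[of D] z0 by (auto simp: slice_region_def subset_iff)
      have \<psi>0: "\<psi> a (replace_coord z0 e \<zeta>) = 0" if "\<zeta> \<notin> cball c (2 * r)" for \<zeta>
        using that \<phi>(3)[of \<zeta>] by (simp add: \<psi>_def)
      then have u0: "u \<zeta> = 0" if "\<zeta> \<notin> cball c (2 * r)" for \<zeta>
        using that by (simp add: u_def)
      have sub: "cball c (2 * r) \<subseteq> ball c (4 * r)" using r(1) by auto
      have u: "times_differentiable_on 1 u UNIV"
        unfolding u_def
        by (rule Ck_extend_by_zero[OF open_ball closed_cball sub
              Ck_compose_affine[OF U open_ball \<psi>[OF a] inU has_derivative_replace_coord_slice]])
          (use \<psi>0 in auto)
      have cru: "cr_derivative u \<zeta> = wirtinger_bar e (\<psi> a) (replace_coord z0 e \<zeta>)" if \<zeta>: "\<zeta> \<in> ball c (4 * r)" for \<zeta>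
      proof -
        have "cr_derivative u \<zeta> = cr_derivative (\<lambda>\<zeta>. \<psi> a (replace_coord z0 e \<zeta>)) \<zeta>"
          by (rule cr_derivative_cong[OF open_ball \<zeta>]) (use u in \<open>simp_all add: u_def\<close>)
        then show ?thesis using wirtinger_bar_slice[of "\<psi> a" z0 e \<zeta>] \<psi>[OF a] inU[OF \<zeta>] by simp
      qed
      have "\<kappa>2 w * wirtinger_bar e (\<psi> a) (shift (z0, w)) = cr_derivative u (c + w) / ((c + w) - c)" for w
      proof (cases "w \<in> ball 0 (3 * r)")
        case True
        then have "c + w \<in> ball c (4 * r)" using r(1) by (simp add: dist_norm)
        then show ?thesis using True by (simp add: cru \<kappa>2_def shift_eq c_def)
      next
        case False
        then have "c + w \<notin> cball c (2 * r)" using r(1) by (simp add: dist_norm)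
        then have "cr_derivative u (c + w) = 0"
          by (rule cr_derivative_outside_support[OF closed_cball _ u0])
        with False show ?thesis by (simp add: \<kappa>2_def)
      qed
      then have "wirtinger_bar e (cauchy_area D e a) z0 = (LINT w|lborel. cr_derivative u (c + w) / ((c + w) - c))"
        using main True by simp
      also have "\<dots> = (LINT \<zeta>|lborel. cr_derivative u \<zeta> / (\<zeta> - c))"
      proof (rule integral_translate)
        note [measurable] = cr_derivative_measurable[OF u compact_cball u0]
        show "(\<lambda>w. cr_derivative u w / (w - c)) \<in> borel_measurable borel" by measurable
      qed
      also have "\<dots> = - of_real pi * u c"
        by (rule cauchy_pompeiu_compact_support[OF u compact_cball u0])
      also have "u c = a z0"
        using r(1) \<phi>(2)[of c] by (simp add: u_def \<psi>_def c_def)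
      finally show ?thesis using True by simp
    qed
  qed
qed

lemma cauchy_area_times_differentiable_on:
  assumes "times_differentiable_on k a U"
  shows "times_differentiable_on k (cauchy_area D e a) (slice_region D e U)"
proof (rule Ck_local)
  fix z assume "z \<in> slice_region D e U"
  then obtain X where "open X" "z \<in> X"
    "\<And>a k. times_differentiable_on k a U \<Longrightarrow> times_differentiable_on k (cauchy_area D e a) X"
    by (rule cauchy_area_local) blast
  with assms show "\<exists>N. open N \<and> z \<in> N \<and> times_differentiable_on k (cauchy_area D e a) N" by blast
qed

lemma wirtinger_bar_cauchy_area:
  assumes "times_differentiable_on 1 a U" "z \<in> slice_region D e U"
  shows "wirtinger_bar j (cauchy_area D e a) z =
     (if j = e then - of_real pi * a z else cauchy_area D e (wirtinger_bar j a) z)"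
  using cauchy_area_local[OF assms(2)] assms(1) by metis

end

section \<open>The homotopy formula in one variable\<close>

lemma smooth_onD: "smooth_on f U \<Longrightarrow> times_differentiable_on k f U"
  by (simp add: smooth_on_def)

lemma smooth_on_subset: "smooth_on f U \<Longrightarrow> V \<subseteq> U \<Longrightarrow> smooth_on f V"
  using Ck_subset unfolding smooth_on_def by blast

lemma smooth_on_differentiable: "smooth_on f U \<Longrightarrow> x \<in> U \<Longrightarrow> f differentiable (at x)"
  using smooth_onD[of f U 1] by simp

lemma smooth_on_wirtinger_bar: "open U \<Longrightarrow> smooth_on a U \<Longrightarrow> smooth_on (wirtinger_bar j a) U"
  unfolding smooth_on_def using wirtinger_bar_times_differentiable_on by blast

lemma smooth_on_cmult_sum:
  fixes f :: "'i \<Rightarrow> 'a::real_normed_vector \<Rightarrow> complex"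
  assumes "open U" "\<And>i. i \<in> A \<Longrightarrow> smooth_on (f i) U"
  shows "smooth_on (\<lambda>x. \<Sum>i\<in>A. c i * f i x) U"
  using assms unfolding smooth_on_def
  by (intro allI Ck_sum Ck_mult Ck_const) auto

lemma smooth_on_dbar:
  assumes "open U" "\<And>J. smooth_on (\<alpha> J) U"
  shows "smooth_on (dbar \<alpha> K) U"
  unfolding dbar_def[abs_def]
  by (intro smooth_on_cmult_sum smooth_on_wirtinger_bar assms)

lemma I0_eq_cauchy_area:
  "I0 D e \<omega> J = (\<lambda>z. if e \<in> J then 0 else - (wedge_sign e J / of_real pi) * cauchy_area (D e) e (\<omega> (insert e J)) z)"
proof
  fix z
  have "wedge_sign e J * \<omega> (insert e J) (replace_coord z e \<zeta>) / (\<zeta> - z $ e) * (- 2 * \<i>) =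
     (wedge_sign e J * (- 2 * \<i>)) * (\<omega> (insert e J) (replace_coord z e \<zeta>) / (\<zeta> - z $ e))" for \<zeta>
    by simp
  then have "set_lebesgue_integral lborel (D e)
      (\<lambda>\<zeta>. wedge_sign e J * \<omega> (insert e J) (replace_coord z e \<zeta>) / (\<zeta> - z $ e) * (- 2 * \<i>)) =
     (wedge_sign e J * (- 2 * \<i>)) * cauchy_area (D e) e (\<omega> (insert e J)) z"
    unfolding cauchy_area_def by (simp only: set_integral_mult_right)
  then show "I0 D e \<omega> J z = (if e \<in> J then 0 else - (wedge_sign e J / of_real pi) * cauchy_area (D e) e (\<omega> (insert e J)) z)"
    unfolding I0_def by (simp add: field_simps)
qed

lemma R0_eq_cauchy_boundary:
  "R0 \<Gamma> e \<omega> L = (\<lambda>z. if e \<in> L then 0 else 1 / (2 * of_real pi * \<i>) * cauchy_boundary (\<Gamma> e) e (\<omega> L) z)"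
  by (rule ext) (simp add: R0_def cauchy_boundary_def)

lemma wedge_sign_square [simp]: "wedge_sign e J * wedge_sign e J = 1"
  by (simp add: wedge_sign_def flip: power_add mult_2)

text \<open>Moving \<open>dw\<^sub>e\<close> to the front past \<open>dw\<^sub>j\<close> costs a sign.\<close>

lemma wedge_sign_swap:
  assumes "e \<notin> J" "j \<in> J"
  shows "wedge_sign e J * wedge_sign j (insert e J - {j}) = - (wedge_sign j (J - {j}) * wedge_sign e (J - {j}))"
proof -
  have "j \<noteq> e" using assms by auto
  then consider "j < e" | "e < j" by (auto simp: neq_iff)
  then show ?thesis
  proof cases
    case 1
    then have "{i \<in> J. i < e} = insert j {i \<in> J - {j}. i < e}" using assms by auto
    then have "wedge_sign e J = - wedge_sign e (J - {j})"
      by (simp add: wedge_sign_def)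
    moreover have "{i \<in> insert e J - {j}. i < j} = {i \<in> J - {j}. i < j}" using 1 by auto
    ultimately show ?thesis by (simp add: wedge_sign_def)
  next
    case 2
    then have "{i \<in> insert e J - {j}. i < j} = insert e {i \<in> J - {j}. i < j}" using assms by auto
    then have "wedge_sign j (insert e J - {j}) = - wedge_sign j (J - {j})"
      using assms by (simp add: wedge_sign_def)
    moreover have "{i \<in> J. i < e} = {i \<in> J - {j}. i < e}" using 2 by auto
    ultimately show ?thesis by (simp add: wedge_sign_def)
  qed
qed

lemma wirtinger_bar_zero: "open X \<Longrightarrow> z \<in> X \<Longrightarrow> (\<And>w. w \<in> X \<Longrightarrow> f w = 0) \<Longrightarrow> wirtinger_bar j f z = 0"
proof -
  assume "open X" "z \<in> X" "\<And>w. w \<in> X \<Longrightarrow> f w = 0"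
  then have "frechet_derivative f (at z) v = 0" for v
    by (intro frechet_derivative_outside_support[of "- X"]) auto
  then show ?thesis by (simp add: wirtinger_bar_def)
qed

lemma contour_integral_linear_combination:
  assumes "piecewise_smooth_path \<gamma>" "path \<gamma>" "\<And>i. i \<in> A \<Longrightarrow> continuous_on (path_image \<gamma>) (f i)"
  shows "contour_integral \<gamma> (\<lambda>\<zeta>. \<Sum>i\<in>A. c i * f i \<zeta>) = (\<Sum>i\<in>A. c i * contour_integral \<gamma> (f i))"
proof -
  obtain \<kappa> where int: "\<And>f. continuous_on (path_image \<gamma>) f \<Longrightarrow> integrable lborel (\<lambda>t. \<kappa> t * f (clamped_path \<gamma> t))"
    and ci: "\<And>f. continuous_on (path_image \<gamma>) f \<Longrightarrow>
       contour_integral \<gamma> f = (LINT t|lborel. \<kappa> t * f (clamped_path \<gamma> t))"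
    by (rule piecewise_smooth_path_density[OF assms(1,2)]) blast
  have "continuous_on (path_image \<gamma>) (\<lambda>\<zeta>. \<Sum>i\<in>A. c i * f i \<zeta>)"
    using assms(3) by (intro continuous_intros) auto
  then have "contour_integral \<gamma> (\<lambda>\<zeta>. \<Sum>i\<in>A. c i * f i \<zeta>) =
      (LINT t|lborel. (\<Sum>i\<in>A. c i * (\<kappa> t * f i (clamped_path \<gamma> t))))"
    by (simp add: ci sum_distrib_left mult.left_commute)
  also have "\<dots> = (\<Sum>i\<in>A. LINT t|lborel. c i * (\<kappa> t * f i (clamped_path \<gamma> t)))"
    using int[OF assms(3)] by (intro Bochner_Integration.integral_sum integrable_mult_right)
  also have "\<dots> = (\<Sum>i\<in>A. c i * contour_integral \<gamma> (f i))"
    using ci[OF assms(3)] by simp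
  finally show ?thesis .
qed

context
  fixes D :: "'n::{finite,linorder} \<Rightarrow> complex set" and \<Gamma> :: "'n \<Rightarrow> (real \<Rightarrow> complex) set"
    and e :: 'n and U :: "(complex ^ ('n::{finite,linorder})) set"
  assumes D: "piecewise_smooth_domain (D e) (\<Gamma> e)" and bD: "bounded (D e)" and U: "open U"
begin

lemma cauchy_area_integrable:
  assumes a: "continuous_on U a" and z: "z \<in> slice_region (D e) e U"
  shows "integrable lborel (\<lambda>\<zeta>. indicator (D e) \<zeta> *\<^sub>R (a (replace_coord z e \<zeta>) / (\<zeta> - z $ e)))"
proof -
  obtain R where R: "D e \<subseteq> ball (z $ e) R"
    using bounded_subset_ballD[OF bD] by blast
  define \<kappa> :: "complex \<Rightarrow> complex" where "\<kappa> \<zeta> = indicator (D e) \<zeta> *\<^sub>R (indicator (ball (z $ e) R) \<zeta> / (\<zeta> - z $ e))" for \<zeta>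
  have "D e \<in> sets lborel" using piecewise_smooth_domain_open[OF D] by simp
  then have \<kappa>: "integrable lborel \<kappa>"
    unfolding \<kappa>_def by (rule integrable_mult_indicator[OF _ integrable_inverse_ball])
  define V where "V = {q. replace_coord (fst q) e (snd q) \<in> U}"
  have K: "compact (closure (D e))" using bD by simp
  have XV: "slice_region (D e) e U \<times> closure (D e) \<subseteq> V" by (auto simp: V_def slice_region_def)
  have m: "(\<lambda>\<zeta>::complex. \<zeta>) \<in> borel_measurable lborel" by simp
  have \<kappa>K: "\<zeta> \<in> closure (D e)" if "\<kappa> \<zeta> \<noteq> 0" for \<zeta>
    using that closure_subset[of "D e"] by (auto simp: \<kappa>_def indicator_def split: if_splits)
  have "continuous_on V (\<lambda>q. a (replace_coord (fst q) e (snd q)))"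
    by (rule continuous_on_compose2[OF a]) (auto intro!: continuous_intros simp: V_def)
  from parametric_integrable[OF slice_region_open[OF D bD U] K XV \<kappa> m \<kappa>K this z]
  have "integrable lborel (\<lambda>\<zeta>. \<kappa> \<zeta> * a (replace_coord z e \<zeta>))" by simp
  moreover have "\<kappa> \<zeta> * a (replace_coord z e \<zeta>) = indicator (D e) \<zeta> *\<^sub>R (a (replace_coord z e \<zeta>) / (\<zeta> - z $ e))" for \<zeta>
    using R by (auto simp: \<kappa>_def indicator_def)
  ultimately show ?thesis by simp
qed

lemma cauchy_area_linear_combination:
  assumes "\<And>i. i \<in> A \<Longrightarrow> continuous_on U (f i)" and z: "z \<in> slice_region (D e) e U"
  shows "cauchy_area (D e) e (\<lambda>z. \<Sum>i\<in>A. c i * f i z) z = (\<Sum>i\<in>A. c i * cauchy_area (D e) e (f i) z)"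
proof -
  have "cauchy_area (D e) e (\<lambda>z. \<Sum>i\<in>A. c i * f i z) z =
      (LINT \<zeta>|lborel. (\<Sum>i\<in>A. c i * (indicator (D e) \<zeta> *\<^sub>R (f i (replace_coord z e \<zeta>) / (\<zeta> - z $ e)))))"
    unfolding cauchy_area_def set_lebesgue_integral_def
    by (rule Bochner_Integration.integral_cong[OF refl])
      (simp add: sum_divide_distrib scaleR_sum_right)
  also have "\<dots> = (\<Sum>i\<in>A. LINT \<zeta>|lborel. c i * (indicator (D e) \<zeta> *\<^sub>R (f i (replace_coord z e \<zeta>) / (\<zeta> - z $ e))))"
    by (intro Bochner_Integration.integral_sum integrable_mult_right cauchy_area_integrable assms)
  also have "\<dots> = (\<Sum>i\<in>A. c i * cauchy_area (D e) e (f i) z)"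
    unfolding cauchy_area_def set_lebesgue_integral_def by (simp only: integral_mult_right_zero)
  finally show ?thesis .
qed

lemma cauchy_boundary_linear_combination:
  assumes "\<And>i. i \<in> A \<Longrightarrow> continuous_on U (f i)" and z: "z \<in> slice_region (D e) e U"
  shows "cauchy_boundary (\<Gamma> e) e (\<lambda>z. \<Sum>i\<in>A. c i * f i z) z = (\<Sum>i\<in>A. c i * cauchy_boundary (\<Gamma> e) e (f i) z)"
proof -
  have "contour_integral \<gamma> (\<lambda>\<zeta>. (\<Sum>i\<in>A. c i * f i (replace_coord z e \<zeta>)) / (\<zeta> - z $ e)) =
      (\<Sum>i\<in>A. c i * contour_integral \<gamma> (\<lambda>\<zeta>. f i (replace_coord z e \<zeta>) / (\<zeta> - z $ e)))" if \<gamma>: "\<gamma> \<in> \<Gamma> e" for \<gamma>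
  proof -
    have sub: "replace_coord z e \<zeta> \<in> U" "\<zeta> \<noteq> z $ e" if "\<zeta> \<in> path_image \<gamma>" for \<zeta>
    proof -
      have "(z, \<zeta>) \<in> kernel_domain e U"
        using slice_region_times_path_image[OF D bD U \<gamma>, of e] z that by blast
      then show "replace_coord z e \<zeta> \<in> U" "\<zeta> \<noteq> z $ e" by (auto simp: kernel_domain_def)
    qed
    have "continuous_on (path_image \<gamma>) (\<lambda>\<zeta>. f i (replace_coord z e \<zeta>) / (\<zeta> - z $ e))" if "i \<in> A" for i
      using sub by (intro continuous_on_divide continuous_on_compose2[OF assms(1)[OF that]])
        (auto intro!: continuous_intros)
    from contour_integral_linear_combination[OF piecewise_smooth_domain_curve(1,2)[OF D \<gamma>] this, where A = A and c = c]
    show ?thesis by (simp add: sum_divide_distrib)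
  qed
  then show ?thesis
    by (simp add: cauchy_boundary_def boundary_integral_def sum_distrib_left) (rule sum.swap)
qed

lemma smooth_on_I0:
  assumes \<alpha>: "\<And>J. smooth_on (\<alpha> J) U"
  shows "smooth_on (I0 D e \<alpha> J) (slice_region (D e) e U)"
  unfolding smooth_on_def
proof
  fix k
  have "times_differentiable_on k (\<lambda>z. - (wedge_sign e J / of_real pi) * cauchy_area (D e) e (\<alpha> (insert e J)) z) (slice_region (D e) e U)"
    by (intro Ck_mult Ck_const slice_region_open[OF D bD U]
        cauchy_area_times_differentiable_on[OF D bD U] smooth_onD[OF \<alpha>])
  then show "times_differentiable_on k (I0 D e \<alpha> J) (slice_region (D e) e U)"
    using Ck_const[of k 0] by (cases "e \<in> J") (simp_all add: I0_eq_cauchy_area)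
qed

lemma smooth_on_R0:
  assumes \<alpha>: "\<And>J. smooth_on (\<alpha> J) U"
  shows "smooth_on (R0 \<Gamma> e \<alpha> J) (slice_region (D e) e U)"
  unfolding smooth_on_def
proof
  fix k
  have "times_differentiable_on k (\<lambda>z. 1 / (2 * of_real pi * \<i>) * cauchy_boundary (\<Gamma> e) e (\<alpha> J) z) (slice_region (D e) e U)"
    by (intro Ck_mult Ck_const slice_region_open[OF D bD U]
        cauchy_boundary_times_differentiable_on[OF D bD U] smooth_onD[OF \<alpha>])
  then show "times_differentiable_on k (R0 \<Gamma> e \<alpha> J) (slice_region (D e) e U)"
    using Ck_const[of k 0] by (cases "e \<in> J") (simp_all add: R0_eq_cauchy_boundary)
qed

lemma wirtinger_bar_I0:
  assumes \<alpha>: "\<And>J. smooth_on (\<alpha> J) U" and z: "z \<in> slice_region (D e) e U"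
  shows "wirtinger_bar j (I0 D e \<alpha> J) z =
    (if e \<in> J then 0 else if j = e then wedge_sign e J * \<alpha> (insert e J) z
     else - (wedge_sign e J / of_real pi) * cauchy_area (D e) e (wirtinger_bar j (\<alpha> (insert e J))) z)"
proof (cases "e \<in> J")
  case True
  then have "I0 D e \<alpha> J w = 0" for w by (simp add: I0_def)
  then show ?thesis using True wirtinger_bar_zero[OF open_UNIV, of z "I0 D e \<alpha> J" j] by simp
next
  case False
  have "cauchy_area (D e) e (\<alpha> (insert e J)) differentiable (at z)"
    using cauchy_area_times_differentiable_on[OF D bD U smooth_onD[OF \<alpha>, of 1]] z by simp
  then have "wirtinger_bar j (I0 D e \<alpha> J) z =
      - (wedge_sign e J / of_real pi) * wirtinger_bar j (cauchy_area (D e) e (\<alpha> (insert e J))) z"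
    using False wirtinger_bar_cmult[of "cauchy_area (D e) e (\<alpha> (insert e J))" z j "- (wedge_sign e J / of_real pi)"]
    by (simp add: I0_eq_cauchy_area)
  then show ?thesis
    using False by (simp add: wirtinger_bar_cauchy_area[OF D bD U smooth_onD[OF \<alpha>] z])
qed

lemma wirtinger_bar_R0:
  assumes \<alpha>: "\<And>J. smooth_on (\<alpha> J) U" and z: "z \<in> slice_region (D e) e U"
  shows "wirtinger_bar j (R0 \<Gamma> e \<alpha> J) z =
    (if e \<in> J \<or> j = e then 0 else 1 / (2 * of_real pi * \<i>) * cauchy_boundary (\<Gamma> e) e (wirtinger_bar j (\<alpha> J)) z)"
proof (cases "e \<in> J")
  case True
  then have "R0 \<Gamma> e \<alpha> J w = 0" for w by (simp add: R0_def)
  then show ?thesis using True wirtinger_bar_zero[OF open_UNIV, of z "R0 \<Gamma> e \<alpha> J" j] by simp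
next
  case False
  have "cauchy_boundary (\<Gamma> e) e (\<alpha> J) differentiable (at z)"
    using cauchy_boundary_times_differentiable_on[OF D bD U smooth_onD[OF \<alpha>, of 1]] z by simp
  then have "wirtinger_bar j (R0 \<Gamma> e \<alpha> J) z =
      1 / (2 * of_real pi * \<i>) * wirtinger_bar j (cauchy_boundary (\<Gamma> e) e (\<alpha> J)) z"
    using False wirtinger_bar_cmult[of "cauchy_boundary (\<Gamma> e) e (\<alpha> J)" z j "1 / (2 * of_real pi * \<i>)"]
    by (simp add: R0_eq_cauchy_boundary)
  then show ?thesis
    using False by (simp add: wirtinger_bar_cauchy_boundary[OF D bD U smooth_onD[OF \<alpha>] z])
qed

text \<open>If \<open>e \<in> J\<close>, then only the derivative with respect to \<open>z\<^sub>e\<close> of the first term survives, and the Cauchy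
  transform is inverted by it. If \<open>e \<notin> J\<close>, then the derivatives with respect to the other variables may
  be taken under the integral; they occur in both of the first two terms, with opposite signs by
  \<open>wedge_sign_swap\<close>, and what remains is the Cauchy-Pompeiu formula.\<close>

lemma homotopy_formula:
  assumes \<alpha>: "\<And>J. smooth_on (\<alpha> J) U" and z: "z \<in> slice_region (D e) e U"
  shows "\<alpha> J z = dbar (I0 D e \<alpha>) J z + I0 D e (dbar \<alpha>) J z + R0 \<Gamma> e \<alpha> J z"
proof (cases "e \<in> J")
  case True
  have "dbar (I0 D e \<alpha>) J z = (\<Sum>j\<in>J. if j = e then \<alpha> J z else 0)"
    unfolding dbar_def
  proof (rule sum.cong[OF refl])
    fix j assume j: "j \<in> J"
    show "wedge_sign j (J - {j}) * wirtinger_bar j (I0 D e \<alpha> (J - {j})) z = (if j = e then \<alpha> J z else 0)"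
      using True j by (auto simp: wirtinger_bar_I0[OF \<alpha> z] insert_absorb simp flip: mult.assoc)
  qed
  also have "\<dots> = \<alpha> J z" using True by simp
  finally show ?thesis using True by (simp add: I0_def R0_def)
next
  case False
  define A where "A a = cauchy_area (D e) e a z" for a
  have contw: "continuous_on U (wirtinger_bar j (\<alpha> K))" for j K
    using smooth_onD[OF smooth_on_wirtinger_bar[OF U \<alpha>], of 0] by simp
  have dI: "dbar (I0 D e \<alpha>) J z = (\<Sum>j\<in>J. wedge_sign j (J - {j}) *
      (- (wedge_sign e (J - {j}) / of_real pi) * A (wirtinger_bar j (\<alpha> (insert e (J - {j}))))))"
    unfolding dbar_def A_def
    by (rule sum.cong[OF refl]) (use False in \<open>auto simp: wirtinger_bar_I0[OF \<alpha> z]\<close>)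
  have "A (dbar \<alpha> (insert e J)) = (\<Sum>j\<in>insert e J. wedge_sign j (insert e J - {j}) *
      A (wirtinger_bar j (\<alpha> (insert e J - {j}))))"
    unfolding dbar_def[abs_def] A_def
    by (rule cauchy_area_linear_combination[OF _ z]) (rule contw)
  also have "\<dots> = wedge_sign e J * A (wirtinger_bar e (\<alpha> J)) +
      (\<Sum>j\<in>J. wedge_sign j (insert e J - {j}) * A (wirtinger_bar j (\<alpha> (insert e J - {j}))))"
    using False by simp
  finally have "I0 D e (dbar \<alpha>) J z = - (wedge_sign e J / of_real pi) * (wedge_sign e J * A (wirtinger_bar e (\<alpha> J)) +
      (\<Sum>j\<in>J. wedge_sign j (insert e J - {j}) * A (wirtinger_bar j (\<alpha> (insert e J - {j})))))"
    using False by (simp add: I0_eq_cauchy_area A_def)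
  also have "\<dots> = - ((wedge_sign e J * wedge_sign e J) * A (wirtinger_bar e (\<alpha> J)) / of_real pi) -
      (\<Sum>j\<in>J. (wedge_sign e J * wedge_sign j (insert e J - {j})) * A (wirtinger_bar j (\<alpha> (insert e J - {j}))) / of_real pi)"
    by (simp add: sum_distrib_left distrib_left mult.assoc sum_negf flip: sum_divide_distrib del: wedge_sign_square)
  also have "\<dots> = - (A (wirtinger_bar e (\<alpha> J)) / of_real pi) - dbar (I0 D e \<alpha>) J z"
  proof -
    have "(wedge_sign e J * wedge_sign j (insert e J - {j})) * A (wirtinger_bar j (\<alpha> (insert e J - {j}))) / of_real pi =
        wedge_sign j (J - {j}) * (- (wedge_sign e (J - {j}) / of_real pi) * A (wirtinger_bar j (\<alpha> (insert e (J - {j})))))"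
      if "j \<in> J" for j
    proof -
      have "insert e J - {j} = insert e (J - {j})" using that False by auto
      then show ?thesis
        unfolding wedge_sign_swap[OF False that] by simp
    qed
    then have "(\<Sum>j\<in>J. (wedge_sign e J * wedge_sign j (insert e J - {j})) *
        A (wirtinger_bar j (\<alpha> (insert e J - {j}))) / of_real pi) = dbar (I0 D e \<alpha>) J z"
      unfolding dI by (rule sum.cong[OF refl])
    then show ?thesis by (simp only: wedge_sign_square mult_1_left)
  qed
  finally have I: "I0 D e (dbar \<alpha>) J z = - (A (wirtinger_bar e (\<alpha> J)) / of_real pi) - dbar (I0 D e \<alpha>) J z" .
  have "R0 \<Gamma> e \<alpha> J z = 1 / (2 * of_real pi * \<i>) * (2 * of_real pi * \<i> * \<alpha> J z + 2 * \<i> * A (wirtinger_bar e (\<alpha> J)))"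
    using False cauchy_pompeiu_slice[OF D bD U smooth_onD[OF \<alpha>] z] by (simp add: R0_eq_cauchy_boundary A_def)
  also have "\<dots> = \<alpha> J z + A (wirtinger_bar e (\<alpha> J)) / of_real pi"
    by (simp add: field_simps)
  finally show ?thesis using I by simp
qed

text \<open>Both sides vanish if \<open>e \<in> K\<close>, the left one because Cauchy integrals are holomorphic in \<open>z\<^sub>e\<close>.\<close>

lemma dbar_R0:
  assumes \<alpha>: "\<And>J. smooth_on (\<alpha> J) U" and z: "z \<in> slice_region (D e) e U"
  shows "dbar (R0 \<Gamma> e \<alpha>) K z = R0 \<Gamma> e (dbar \<alpha>) K z"
proof (cases "e \<in> K")
  case True
  have "dbar (R0 \<Gamma> e \<alpha>) K z = (\<Sum>j\<in>K. 0)"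
    unfolding dbar_def
    by (rule sum.cong[OF refl]) (use True in \<open>auto simp: wirtinger_bar_R0[OF \<alpha> z]\<close>)
  then show ?thesis using True by (simp add: R0_def)
next
  case False
  have contw: "continuous_on U (wirtinger_bar j (\<alpha> J))" for j J
    using smooth_onD[OF smooth_on_wirtinger_bar[OF U \<alpha>], of 0] by simp
  have "dbar (R0 \<Gamma> e \<alpha>) K z = (\<Sum>j\<in>K. 1 / (2 * of_real pi * \<i>) * (wedge_sign j (K - {j}) *
      cauchy_boundary (\<Gamma> e) e (wirtinger_bar j (\<alpha> (K - {j}))) z))"
    unfolding dbar_def
    by (rule sum.cong[OF refl]) (use False in \<open>auto simp: wirtinger_bar_R0[OF \<alpha> z]\<close>)
  also have "\<dots> = 1 / (2 * of_real pi * \<i>) * cauchy_boundary (\<Gamma> e) e (dbar \<alpha> K) z"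
    unfolding dbar_def[abs_def]
    by (subst cauchy_boundary_linear_combination[OF _ z]) (rule contw, rule sum_distrib_left[symmetric])
  finally show ?thesis using False by (simp add: R0_eq_cauchy_boundary)
qed

lemma cauchy_boundary_eq_0:
  assumes "\<And>\<zeta>. \<zeta> \<in> closure (D e) \<Longrightarrow> a (replace_coord z e \<zeta>) = 0"
  shows "cauchy_boundary (\<Gamma> e) e a z = 0"
proof -
  have "contour_integral \<gamma> (\<lambda>\<zeta>. a (replace_coord z e \<zeta>) / (\<zeta> - z $ e)) = contour_integral \<gamma> (\<lambda>_. 0)" if "\<gamma> \<in> \<Gamma> e" for \<gamma>
    using piecewise_smooth_domain_curve(3)[OF D that] assms
    by (intro contour_integral_eq) (auto simp: frontier_def)
  then show ?thesis by (simp add: cauchy_boundary_def boundary_integral_def)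
qed

end

lemma cauchy_area_eq_0:
  assumes "\<And>\<zeta>. \<zeta> \<in> D \<Longrightarrow> a (replace_coord z e \<zeta>) = 0"
  shows "cauchy_area D e a z = 0"
proof -
  have "indicator D \<zeta> *\<^sub>R (a (replace_coord z e \<zeta>) / (\<zeta> - z $ e)) = 0" for \<zeta>
    using assms by (auto simp: indicator_def)
  then show ?thesis
    unfolding cauchy_area_def set_lebesgue_integral_def by (simp only: Bochner_Integration.integral_zero)
qed

section \<open>Iteration over the coordinates\<close>

lemma inj_on_coord: "inj_on (coord :: nat \<Rightarrow> 'n::{finite,linorder}) {1..CARD('n)}"
proof (rule inj_onI)
  fix k l assume kl: "k \<in> {1..CARD('n)}" "l \<in> {1..CARD('n)}" "(coord k :: 'n) = coord l"
  have "k - 1 = l - 1"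
    using kl nth_eq_iff_index_eq[of "sorted_list_of_set (UNIV :: 'n set)" "k - 1" "l - 1"]
    by (auto simp: coord_def)
  with kl show "k = l" by auto
qed

lemma coord_image: "(coord :: nat \<Rightarrow> 'n::{finite,linorder}) ` {1..CARD('n)} = UNIV"
proof (rule card_subset_eq)
  show "card ((coord :: nat \<Rightarrow> 'n) ` {1..CARD('n)}) = CARD('n)"
    unfolding card_image[OF inj_on_coord] by simp
qed simp_all

lemma closure_product_domain:
  fixes z :: "complex ^ 'n"
  assumes "\<And>j. z $ j \<in> closure (D j)"
  shows "z \<in> closure (product_domain D)"
proof -
  have "\<exists>x. (\<forall>m. x m \<in> D j) \<and> x \<longlonglongrightarrow> z $ j" for j
    using assms[of j] by (simp add: closure_sequential)
  then obtain x where x: "\<And>j m. x j m \<in> D j" "\<And>j. x j \<longlonglongrightarrow> z $ j" by metis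
  have "(\<lambda>m. \<chi> j. x j m) \<longlonglongrightarrow> z"
    by (rule vec_tendstoI) (simp add: x(2))
  moreover have "(\<chi> j. x j m) \<in> product_domain D" for m
    using x(1) by (simp add: product_domain_def)
  ultimately show ?thesis
    unfolding closure_sequential by (intro exI[of _ "\<lambda>m. \<chi> j. x j m"]) simp
qed

lemma R_after_last: "R_after \<Gamma> CARD('n) \<omega> = (\<omega> :: 'n::{finite,linorder} antiform)"
  by (simp add: R_after_def)

lemma R_after_step:
  "k < CARD('n) \<Longrightarrow> R_after \<Gamma> k \<omega> = R0 \<Gamma> (coord (Suc k)) (R_after \<Gamma> (Suc k) (\<omega> :: 'n::{finite,linorder} antiform))"
  by (simp add: R_after_def upt_conv_Cons del: upt_Suc)

text \<open>After the boundary operators in the last \<open>n - k\<close> coordinates a form is only defined where these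
  coordinates lie in the open domains; in the first \<open>k\<close> it is still smooth up to the boundary.\<close>

definition partial_closure :: "('n::{finite,linorder} \<Rightarrow> complex set) \<Rightarrow> nat \<Rightarrow> (complex ^ ('n::{finite,linorder})) set" where
  "partial_closure D k = {z. \<forall>j. z $ j \<in> closure (D j) \<and> (j \<in> coord ` {Suc k..CARD('n)} \<longrightarrow> z $ j \<in> D j)}"

lemma product_domain_subset_partial_closure: "product_domain D \<subseteq> partial_closure D k"
  using closure_subset by (fastforce simp: product_domain_def partial_closure_def)

lemma replace_coord_partial_closure:
  fixes z :: "complex ^ ('n::{finite,linorder})"
  assumes k: "k < CARD('n)" and z: "z \<in> partial_closure D k" and \<zeta>: "\<zeta> \<in> closure (D (coord (Suc k)))"
  shows "replace_coord z (coord (Suc k)) \<zeta> \<in> partial_closure D (Suc k)"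
proof -
  have "coord (Suc k) \<notin> (coord ` {Suc (Suc k)..CARD('n)} :: 'n set)"
    using inj_on_coord[where 'n = 'n] k by (force dest: inj_onD)
  then show ?thesis
    using z \<zeta> by (auto simp: partial_closure_def)
qed

lemma partial_closure_subset_slice_region:
  fixes D :: "'n::{finite,linorder} \<Rightarrow> complex set"
  assumes k: "k < CARD('n)" and W: "partial_closure D (Suc k) \<subseteq> W"
  shows "partial_closure D k \<subseteq> slice_region (D (coord (Suc k))) (coord (Suc k)) W"
proof
  fix z assume z: "z \<in> partial_closure D k"
  have "coord (Suc k) \<in> (coord ` {Suc k..CARD('n)} :: 'n set)" using k by simp
  then have "z $ coord (Suc k) \<in> D (coord (Suc k))" using z by (simp add: partial_closure_def)
  then show "z \<in> slice_region (D (coord (Suc k))) (coord (Suc k)) W"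
    using replace_coord_partial_closure[OF k z] W by (auto simp: slice_region_def)
qed

text \<open>Each step applies one more boundary operator, which costs the boundary in one more coordinate.
  The last clause starts from the closure of the product domain, where \<open>dbar \<omega>\<close> vanishes by
  continuity: the next operator integrates over boundary points, so closedness inside would not be
  enough.\<close>

lemma R_after_stage:
  fixes D :: "'n::{finite,linorder} \<Rightarrow> complex set"
  assumes D: "\<And>j. piecewise_smooth_domain (D j) (\<Gamma> j)" and bD: "\<And>j. bounded (D j)"
    and \<omega>: "smooth_form_near_closure q (product_domain D) \<omega>" and k: "k \<le> CARD('n)"
  shows "\<exists>W. open W \<and> partial_closure D k \<subseteq> W \<and> smooth_form_on q W (R_after \<Gamma> k \<omega>) \<and>
    (\<forall>J z. J \<inter> coord ` {Suc k..CARD('n)} \<noteq> {} \<longrightarrow> R_after \<Gamma> k \<omega> J z = 0) \<and>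
    ((\<forall>z\<in>product_domain D. \<forall>K. dbar \<omega> K z = 0) \<longrightarrow>
      (\<forall>z\<in>partial_closure D k. \<forall>K. dbar (R_after \<Gamma> k \<omega>) K z = 0))"
  using k
proof (induction k rule: inc_induct)
  case base
  obtain U where U: "open U" "closure (product_domain D) \<subseteq> U" "smooth_form_on q U \<omega>"
    using \<omega> unfolding smooth_form_near_closure_def by blast
  have sub: "partial_closure D CARD('n) \<subseteq> closure (product_domain D)"
    using closure_product_domain by (auto simp: partial_closure_def)
  have "dbar \<omega> K z = 0" if 0: "\<forall>z\<in>product_domain D. \<forall>K. dbar \<omega> K z = 0" and z: "z \<in> partial_closure D CARD('n)" for K z
  proof -
    have "smooth_on (dbar \<omega> K) U"
      using U by (intro smooth_on_dbar) (auto simp: smooth_form_on_def)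
    then have "continuous_on (closure (product_domain D)) (dbar \<omega> K)"
      using smooth_onD[of _ U 0] U(2) continuous_on_subset by (metis times_differentiable_on.simps(1))
    then show ?thesis
      by (rule continuous_constant_on_closure) (use 0 z sub in auto)
  qed
  then show ?case
    using U sub by (intro exI[of _ U]) (auto simp: R_after_last)
next
  case (step k)
  from step.IH obtain W where W: "open W" "partial_closure D (Suc k) \<subseteq> W" "smooth_form_on q W (R_after \<Gamma> (Suc k) \<omega>)"
    and van': "\<forall>J z. J \<inter> coord ` {Suc (Suc k)..CARD('n)} \<noteq> {} \<longrightarrow> R_after \<Gamma> (Suc k) \<omega> J z = 0"
    and cl': "(\<forall>z\<in>product_domain D. \<forall>K. dbar \<omega> K z = 0) \<longrightarrow>
      (\<forall>z\<in>partial_closure D (Suc k). \<forall>K. dbar (R_after \<Gamma> (Suc k) \<omega>) K z = 0)"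
    by (elim exE conjE) (rule that)
  have van: "R_after \<Gamma> (Suc k) \<omega> J z = 0" if "J \<inter> coord ` {Suc (Suc k)..CARD('n)} \<noteq> {}" for J z
    using van' that by simp
  have cl: "dbar (R_after \<Gamma> (Suc k) \<omega>) K z = 0"
    if "\<forall>z\<in>product_domain D. \<forall>K. dbar \<omega> K z = 0" "z \<in> partial_closure D (Suc k)" for z K
    using mp[OF cl' that(1)] that(2) by simp
  define e :: 'n where "e = coord (Suc k)"
  define \<alpha> where "\<alpha> = R_after \<Gamma> (Suc k) \<omega>"
  have k: "k < CARD('n)" using step by simp
  have \<alpha>: "smooth_on (\<alpha> J) W" for J using W(3) by (simp add: smooth_form_on_def \<alpha>_def)
  have Rk: "R_after \<Gamma> k \<omega> = R0 \<Gamma> e \<alpha>"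
    using R_after_step[OF k] by (simp add: e_def \<alpha>_def)
  define W' where "W' = slice_region (D e) e W"
  have W': "open W'" unfolding W'_def by (rule slice_region_open[OF D bD W(1)])
  have QW': "partial_closure D k \<subseteq> W'"
    unfolding W'_def e_def by (rule partial_closure_subset_slice_region[OF k W(2)])
  have R0_0: "R0 \<Gamma> e \<beta> J z = 0" if "\<And>\<zeta>. \<zeta> \<in> closure (D e) \<Longrightarrow> \<beta> J (replace_coord z e \<zeta>) = 0" for J z \<beta>
    using cauchy_boundary_eq_0[where D = D and \<Gamma> = \<Gamma> and e = e and U = W, OF D bD W(1), where a = "\<beta> J" and z = z] that by (simp add: R0_eq_cauchy_boundary)
  have A1: "smooth_form_on q W' (R0 \<Gamma> e \<alpha>)"
    unfolding smooth_form_on_def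
  proof (intro conjI allI impI ballI)
    show "smooth_on (R0 \<Gamma> e \<alpha> J) W'" for J
      unfolding W'_def by (rule smooth_on_R0[where D = D and \<Gamma> = \<Gamma> and e = e, OF D bD W(1) \<alpha>])
    show "R0 \<Gamma> e \<alpha> J z = 0" if "card J \<noteq> q" "z \<in> W'" for J z
      by (rule R0_0) (use that W(3) in \<open>auto simp: W'_def slice_region_def smooth_form_on_def \<alpha>_def\<close>)
  qed
  have A2: "R0 \<Gamma> e \<alpha> J z = 0" if J: "J \<inter> coord ` {Suc k..CARD('n)} \<noteq> {}" for J z
  proof (cases "e \<in> J")
    case True
    then show ?thesis by (simp add: R0_def)
  next
    case False
    have "{Suc k..CARD('n)} = insert (Suc k) {Suc (Suc k)..CARD('n)}" using k by auto
    then have "J \<inter> coord ` {Suc (Suc k)..CARD('n)} \<noteq> {}" using False J by (auto simp: e_def)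
    then show ?thesis by (intro R0_0) (simp add: \<alpha>_def van)
  qed
  have A3: "dbar (R0 \<Gamma> e \<alpha>) K z = 0"
    if 0: "\<forall>z\<in>product_domain D. \<forall>K. dbar \<omega> K z = 0" and z: "z \<in> partial_closure D k" for K z
  proof -
    have "dbar (R0 \<Gamma> e \<alpha>) K z = R0 \<Gamma> e (dbar \<alpha>) K z"
      by (rule dbar_R0[where D = D and \<Gamma> = \<Gamma> and e = e, OF D bD W(1) \<alpha>]) (use z QW' in \<open>auto simp: W'_def\<close>)
    also have "\<dots> = 0"
      using replace_coord_partial_closure[OF k z] cl[OF 0] by (intro R0_0) (auto simp: e_def \<alpha>_def)
    finally show ?thesis .
  qed
  show ?case
    unfolding Rk
  proof (intro exI[of _ W'] conjI allI impI ballI W' QW' A1)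
    show "R0 \<Gamma> e \<alpha> J z = 0" if "J \<inter> coord ` {Suc k..CARD('n)} \<noteq> {}" for J z
      by (rule A2[OF that])
    show "dbar (R0 \<Gamma> e \<alpha>) K z = 0"
      if "\<forall>z\<in>product_domain D. \<forall>K. dbar \<omega> K z = 0" "z \<in> partial_closure D k" for z K
      by (rule A3[OF that])
  qed
qed

context
  fixes D :: "'n::{finite,linorder} \<Rightarrow> complex set" and \<Gamma> q \<omega> k
  assumes D: "\<And>j. piecewise_smooth_domain (D j) (\<Gamma> j)" and bD: "\<And>j. bounded (D j)"
    and \<omega>: "smooth_form_near_closure q (product_domain D) \<omega>" and k: "k \<le> CARD('n)"
begin

lemma smooth_form_on_R_after:
  obtains W where "open W" "partial_closure D k \<subseteq> W" "smooth_form_on q W (R_after \<Gamma> k \<omega>)"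
  using R_after_stage[OF D bD \<omega> k] by (elim exE conjE) (rule that)

lemma R_after_vanishes:
  assumes "J \<inter> coord ` {Suc k..CARD('n)} \<noteq> {}"
  shows "R_after \<Gamma> k \<omega> J z = 0"
  using R_after_stage[OF D bD \<omega> k] assms by (elim exE conjE) simp

lemma dbar_R_after_eq_0:
  assumes "\<forall>z\<in>product_domain D. \<forall>K. dbar \<omega> K z = 0" "z \<in> partial_closure D k"
  shows "dbar (R_after \<Gamma> k \<omega>) K z = 0"
  using R_after_stage[OF D bD \<omega> k] assms by (elim exE conjE) simp

end

theorem theorem3p7:
  fixes D :: "'n::{finite,linorder} \<Rightarrow> complex set"
    and \<Gamma> :: "'n \<Rightarrow> (real \<Rightarrow> complex) set"
    and \<omega> :: "'n antiform"
    and q :: nat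
  assumes "\<And>j. piecewise_smooth_domain (D j) (\<Gamma> j)"
    and "bounded (product_domain D)"
    and "1 \<le> q" and "q \<le> CARD('n)"
    and "smooth_form_near_closure q (product_domain D) \<omega>"
  shows "smooth_form_on (q - 1) (product_domain D) (S_op D \<Gamma> q \<omega>) \<and>
    smooth_form_on q (product_domain D) (T_dbar D \<Gamma> q \<omega>) \<and>
    (\<forall>z\<in>product_domain D. \<forall>J. \<omega> J z = dbar (S_op D \<Gamma> q \<omega>) J z + T_dbar D \<Gamma> q \<omega> J z) \<and>
    ((\<forall>z\<in>product_domain D. \<forall>J. dbar \<omega> J z = 0) \<longrightarrow>
      (\<forall>z\<in>product_domain D. \<forall>J. \<omega> J z = dbar (S_op D \<Gamma> q \<omega>) J z))"
proof -
  define P where "P = product_domain D"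
  have bD: "bounded (D j)" for j
  proof -
    have "\<forall>j. \<exists>x. x \<in> D j" using assms(1) unfolding piecewise_smooth_domain_def by blast
    then obtain x where x: "\<And>j. x j \<in> D j" by metis
    have "D j \<subseteq> (\<lambda>z. z $ j) ` P"
    proof
      fix \<zeta> assume "\<zeta> \<in> D j"
      then have "replace_coord (\<chi> i. x i) j \<zeta> \<in> P" using x by (simp add: P_def product_domain_def)
      then show "\<zeta> \<in> (\<lambda>z. z $ j) ` P" by (rule rev_image_eqI) simp
    qed
    moreover have "bounded ((\<lambda>z. z $ j) ` P)"
      using assms(2) unfolding P_def by (rule bounded_linear_image[OF _ bounded_linear_vec_nth])
    ultimately show ?thesis by (rule bounded_subset[rotated])
  qed
  have P: "open P"
    using open_vector_box[of D] piecewise_smooth_domain_open[OF assms(1)] by (simp add: P_def product_domain_def)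
  define \<beta> where "\<beta> k = R_after \<Gamma> k \<omega>" for k
  define I where "I k = I0 D (coord k)" for k
  have stage: "\<exists>W. open W \<and> P \<subseteq> slice_region (D (coord k)) (coord k) W \<and> smooth_form_on q W (\<beta> k)"
    if k: "k \<in> {q..CARD('n)}" for k
  proof -
    obtain l where l: "k = Suc l" "l < CARD('n)" using k assms(3) by (cases k) auto
    have "k \<le> CARD('n)" using k by simp
    then obtain W where "open W" "partial_closure D k \<subseteq> W" "smooth_form_on q W (\<beta> k)"
      unfolding \<beta>_def by (rule smooth_form_on_R_after[OF assms(1) bD assms(5)])
    then show ?thesis
      using partial_closure_subset_slice_region[OF l(2)] product_domain_subset_partial_closure[of D l]
      unfolding P_def l(1) by blast
  qed
  have smooth_I: "smooth_on (I k (\<beta> k) J) P" "smooth_on (I k (dbar (\<beta> k)) J) P"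
    and type_I: "\<And>z. card J \<noteq> q - 1 \<Longrightarrow> z \<in> P \<Longrightarrow> I k (\<beta> k) J z = 0"
    and type_I': "\<And>z. card J \<noteq> q \<Longrightarrow> z \<in> P \<Longrightarrow> I k (dbar (\<beta> k)) J z = 0"
    and step: "\<And>z. z \<in> P \<Longrightarrow> \<beta> k J z = dbar (I k (\<beta> k)) J z + I k (dbar (\<beta> k)) J z + \<beta> (k - 1) J z"
    if k: "k \<in> {q..CARD('n)}" for k J
  proof -
    obtain W where W: "open W" "P \<subseteq> slice_region (D (coord k)) (coord k) W" "smooth_form_on q W (\<beta> k)"
      using stage[OF k] by blast
    have s: "smooth_on (\<beta> k J) W" for J using W(3) by (simp add: smooth_form_on_def)
    have s': "smooth_on (dbar (\<beta> k) J) W" for J by (rule smooth_on_dbar[OF W(1) s])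
    show "smooth_on (I k (\<beta> k) J) P" "smooth_on (I k (dbar (\<beta> k)) J) P"
      unfolding I_def
      by (rule smooth_on_subset[OF smooth_on_I0[where D = D and \<Gamma> = \<Gamma> and e = "coord k", OF assms(1) bD W(1)] W(2)], rule s s')+
    have in_W: "replace_coord z (coord k) \<zeta> \<in> W" if "z \<in> P" "\<zeta> \<in> D (coord k)" for z \<zeta>
      using that W(2) closure_subset[of "D (coord k)"] by (auto simp: slice_region_def)
    have type: "\<beta> k K z = 0" if "card K \<noteq> q" "z \<in> W" for K z
      using W(3) that by (simp add: smooth_form_on_def)
    have type': "dbar (\<beta> k) K z = 0" if "card K \<noteq> Suc q" "z \<in> W" for K z
      unfolding dbar_def
    proof (rule sum.neutral, rule ballI)
      fix j assume "j \<in> K"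
      then have "card (K - {j}) \<noteq> q" using that(1) card_Suc_Diff1[of K j] by auto
      then show "wedge_sign j (K - {j}) * wirtinger_bar j (\<beta> k (K - {j})) z = 0"
        using wirtinger_bar_zero[OF W(1) that(2)] type by simp
    qed
    show "I k (\<beta> k) J z = 0" if "card J \<noteq> q - 1" "z \<in> P" for z
    proof (cases "coord k \<in> J")
      case False
      then have "card (insert (coord k) J) \<noteq> q" using that(1) by simp
      then have "cauchy_area (D (coord k)) (coord k) (\<beta> k (insert (coord k) J)) z = 0"
        using in_W[OF that(2)] by (intro cauchy_area_eq_0 type)
      then show ?thesis by (simp add: I_def I0_eq_cauchy_area)
    qed (simp add: I_def I0_def)
    show "I k (dbar (\<beta> k)) J z = 0" if "card J \<noteq> q" "z \<in> P" for z
    proof (cases "coord k \<in> J")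
      case False
      then have "card (insert (coord k) J) \<noteq> Suc q" using that(1) by simp
      then have "cauchy_area (D (coord k)) (coord k) (dbar (\<beta> k) (insert (coord k) J)) z = 0"
        using in_W[OF that(2)] by (intro cauchy_area_eq_0 type')
      then show ?thesis by (simp add: I_def I0_eq_cauchy_area)
    qed (simp add: I_def I0_def)
    have "\<beta> (k - 1) = R0 \<Gamma> (coord k) (\<beta> k)"
    proof -
      have "k - 1 < CARD('n)" "Suc (k - 1) = k" using k assms(3) by auto
      then show ?thesis using R_after_step[of "k - 1" \<Gamma> \<omega>] by (simp add: \<beta>_def)
    qed
    then show "\<beta> k J z = dbar (I k (\<beta> k)) J z + I k (dbar (\<beta> k)) J z + \<beta> (k - 1) J z" if "z \<in> P" for z
      using homotopy_formula[where \<alpha> = "\<beta> k" and D = D and \<Gamma> = \<Gamma> and e = "coord k", OF assms(1) bD W(1) s, where z = z and J = J] W(2) that by (auto simp: I_def)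
  qed
  \<comment> \<open>The factors 1 bring the sums into the form of linear combinations.\<close>
  have S: "S_op D \<Gamma> q \<omega> J = (\<lambda>z. \<Sum>k = q..CARD('n). 1 * I k (\<beta> k) J z)" for J
    by (rule ext) (simp add: S_op_def I_def \<beta>_def)
  have T: "T_dbar D \<Gamma> q \<omega> J = (\<lambda>z. \<Sum>k = q..CARD('n). 1 * I k (dbar (\<beta> k)) J z)" for J
  proof
    fix z
    have "{q..CARD('n)} = insert CARD('n) {q..<CARD('n)}" using assms(4) by auto
    then show "T_dbar D \<Gamma> q \<omega> J z = (\<Sum>k = q..CARD('n). 1 * I k (dbar (\<beta> k)) J z)"
      by (simp add: T_dbar_def I_def \<beta>_def R_after_last)
  qed
  have "smooth_form_on (q - 1) P (S_op D \<Gamma> q \<omega>)"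
    unfolding smooth_form_on_def S
  proof (intro conjI allI impI ballI)
    show "smooth_on (\<lambda>z. \<Sum>k = q..CARD('n). 1 * I k (\<beta> k) J z) P" for J
      by (intro smooth_on_cmult_sum P smooth_I(1))
    show "(\<Sum>k = q..CARD('n). 1 * I k (\<beta> k) J z) = 0" if "card J \<noteq> q - 1" "z \<in> P" for J z
      by (rule sum.neutral, rule ballI) (simp only: mult_1_left, rule type_I[OF _ that])
  qed
  moreover have "smooth_form_on q P (T_dbar D \<Gamma> q \<omega>)"
    unfolding smooth_form_on_def T
  proof (intro conjI allI impI ballI)
    show "smooth_on (\<lambda>z. \<Sum>k = q..CARD('n). 1 * I k (dbar (\<beta> k)) J z) P" for J
      by (intro smooth_on_cmult_sum P smooth_I(2))
    show "(\<Sum>k = q..CARD('n). 1 * I k (dbar (\<beta> k)) J z) = 0" if "card J \<noteq> q" "z \<in> P" for J z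
      by (rule sum.neutral, rule ballI) (simp only: mult_1_left, rule type_I'[OF _ that])
  qed
  moreover have formula: "\<omega> J z = dbar (S_op D \<Gamma> q \<omega>) J z + T_dbar D \<Gamma> q \<omega> J z" if z: "z \<in> P" for z J
  proof -
    have q1: "q - 1 \<le> CARD('n)" using assms(4) by simp
    \<comment> \<open>The boundary operators have removed all differentials but the first \<open>q - 1\<close>.\<close>
    have "\<beta> (q - 1) J z = 0"
    proof (cases "J \<inter> coord ` {q..CARD('n)} = {}")
      case True
      have "{1..CARD('n)} = {1..q - 1} \<union> {q..CARD('n)}" using assms(3,4) by auto
      then have "J \<subseteq> coord ` {1..q - 1}" using True coord_image[where 'n = 'n] by blast
      then have "card J \<le> card (coord ` {1..q - 1} :: 'n set)" by (intro card_mono) auto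
      also have "\<dots> \<le> q - 1" using card_image_le[of "{1..q - 1}" coord] by simp
      finally have "card J \<noteq> q" using assms(3) by simp
      moreover obtain W where "partial_closure D (q - 1) \<subseteq> W" "smooth_form_on q W (\<beta> (q - 1))"
        unfolding \<beta>_def by (rule smooth_form_on_R_after[OF assms(1) bD assms(5) q1])
      ultimately show ?thesis
        using z product_domain_subset_partial_closure[of D "q - 1"]
        unfolding P_def smooth_form_on_def by blast
    next
      case False
      then show ?thesis
        unfolding \<beta>_def using assms(3) by (intro R_after_vanishes[OF assms(1) bD assms(5) q1]) simp
    qed
    moreover have "(\<Sum>k\<in>{Suc (q - 1)..CARD('n)}. \<beta> k J z - \<beta> (k - 1) J z) = \<beta> CARD('n) J z - \<beta> (q - 1) J z"
      by (rule sum_telescope'') (use assms(4) in simp)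
    ultimately have "\<omega> J z = (\<Sum>k = q..CARD('n). \<beta> k J z - \<beta> (k - 1) J z)"
      using assms(3) by (simp add: \<beta>_def R_after_last)
    also have "\<dots> = (\<Sum>k = q..CARD('n). dbar (I k (\<beta> k)) J z + I k (dbar (\<beta> k)) J z)"
      by (rule sum.cong[OF refl]) (use step[OF _ z] in \<open>simp add: algebra_simps\<close>)
    also have "\<dots> = (\<Sum>k = q..CARD('n). dbar (I k (\<beta> k)) J z) + T_dbar D \<Gamma> q \<omega> J z"
      by (simp add: sum.distrib T)
    also have "(\<Sum>k = q..CARD('n). dbar (I k (\<beta> k)) J z) = dbar (S_op D \<Gamma> q \<omega>) J z"
    proof -
      have "wirtinger_bar j (S_op D \<Gamma> q \<omega> K) z = (\<Sum>k = q..CARD('n). wirtinger_bar j (I k (\<beta> k) K) z)" for j K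
        unfolding S mult_1_left
        by (rule wirtinger_bar_sum) (rule smooth_on_differentiable[OF smooth_I(1) z])
      then show ?thesis
        by (simp add: dbar_def sum_distrib_left) (rule sum.swap)
    qed
    finally show ?thesis .
  qed
  moreover have "T_dbar D \<Gamma> q \<omega> J z = 0"
    if 0: "\<forall>z\<in>P. \<forall>J. dbar \<omega> J z = 0" and z: "z \<in> P" for z J
    unfolding T
  proof (rule sum.neutral, rule ballI)
    fix k assume k: "k \<in> {q..CARD('n)}"
    have "dbar (\<beta> k) K w = 0" if "w \<in> P" for K w
      unfolding \<beta>_def
      by (rule dbar_R_after_eq_0[OF assms(1) bD assms(5)])
        (use 0 k that product_domain_subset_partial_closure[of D k] in \<open>auto simp: P_def\<close>)
    moreover have "replace_coord z (coord k) \<zeta> \<in> P" if "\<zeta> \<in> D (coord k)" for \<zeta>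
      using z that by (simp add: P_def product_domain_def)
    ultimately have "cauchy_area (D (coord k)) (coord k) (dbar (\<beta> k) (insert (coord k) J)) z = 0"
      by (intro cauchy_area_eq_0) auto
    then show "1 * I k (dbar (\<beta> k)) J z = 0" by (simp add: I_def I0_eq_cauchy_area)
  qed
  ultimately show ?thesis unfolding P_def by simp
qed

end
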